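(* Let $\tilde Q$ be an absorptive $n$TBI $q$-matrix satisfying (A-1), (A-2), (A-3) and $B_1(0,\dots,0)>0$, let $\tilde P(t)=(\tilde p_{\mathbf{ij}}(t))$ be the Feller minimal $\tilde Q$-function and let $a_{\mathbf{i0}}=\lim_{t\to\infty}\tilde p_{\mathbf{i0}}(t)$ be the extinction probability starting from $\mathbf i$. Write $A(y)$ and $B_1(y)$ for $A(y,u_2(y),\dots,u_n(y))$ and $B_1(y,u_2(y),\dots,u_n(y))$. For any $\mathbf i\ne\mathbf 0$, $a_{\mathbf{i0}}=1$ if and only if $\rho(1,\dots,1)\le0$ and $J=+\infty$, where $$J:=\int_0^1\frac{1}{B_1(y)}\,e^{\int_0^y\frac{A(x)}{B_1(x)}dx}\,dy .$$ More specifically: (i) If $\rho(1,\dots,1)\le0$ and $J=+\infty$, then $a_{\mathbf{i0}}=1$ for all $\mathbf i\ne\mathbf 0$. (ii) If $\rho(1,\dots,1)\le0$ and $J<+\infty$, then for all $\mathbf i\neq\mathbf 0$ $$a_{\mathbf{i0}}=\frac{\int_0^1\frac{y^{i_1}u_2(y)^{i_2}\cdots u_n(y)^{i_n}}{B_1(y)}e^{\int_0^y\frac{A(x)}{B_1(x)}dx}dy}{\int_0^1\frac{1}{B_1(y)}e^{\int_0^y\frac{A(x)}{B_1(x)}dx}dy}<1 .$$ (iii) If $0<\rho(1,\dots,1)\le+\infty$, and thus the system $B_1=\dots=B_n=0$ has smallest nonnegative root $\mathbf q=(q_1,u_2(q_1),\dots,u_n(q_1))\in(0,1)^n$, then for all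 $\mathbf i\ne\mathbf 0$ $$a_{\mathbf{i0}}=\frac{\int_0^{q_1}\frac{y^{i_1}u_2(y)^{i_2}\cdots u_n(y)^{i_n}}{B_1(y)}e^{\int_0^y\frac{A(x)}{B_1(x)}dx}dy}{\int_0^{q_1}\frac{1}{B_1(y)}e^{\int_0^y\frac{A(x)}{B_1(x)}dx}dy}<\prod_{k=1}^nq_k^{i_k}<1 .$$
   Context: Fix $n\ge1$. For $\mathbf i\in\mathbf Z_+^n$ write $|\mathbf i|=\sum_k i_k$; $\mathbf e_k$ is the $k$-th unit vector and $\chi$ is the indicator function of $\mathbf Z_+^n$. An absorptive $n$TBI $q$-matrix ($n$-type branching with immigration, no resurrection) is a matrix on $\mathbf Z_+^n$ with $q_{\mathbf{0j}}=0$ for all $\mathbf j$ and, for $|\mathbf i|>0$, $$q_{\mathbf{ij}}=\sum_{k=1}^n i_k b^{(k)}_{\mathbf j-\mathbf i+\mathbf e_k}\chi(\mathbf j-\mathbf i+\mathbf e_k)+a_{\mathbf j-\mathbf i}\chi(\mathbf j-\mathbf i),$$ where $a_{\mathbf j}\ge 0$ ($\mathbf j\ne\mathbf 0$), $0<\sum_{\mathbf j\ne\mathbf 0}a_{\mathbf j}=-a_{\mathbf 0}<\infty$, and for each $k$: $b^{(k)}_{\mathbf j}\ge0$ ($\mathbf j\ne\mathbf e_k$), $0<\sum_{\mathbf j\ne\mathbf e_k}b^{(k)}_{\mathbf j}=-b^{(k)}_{\mathbf e_k}<\infty$. Generating functions on $[0,1]^n$: $A(u)=\sum_{\mathbf j}a_{\mathbf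 j}u_1^{j_1}\cdots u_n^{j_n}$, $B_k(u)=\sum_{\mathbf j}b^{(k)}_{\mathbf j}u_1^{j_1}\cdots u_n^{j_n}$; $B_{ij}=\partial B_i/\partial u_j$, $g_{ij}=\delta_{ij}-B_{ij}/b^{(i)}_{\mathbf e_i}$, $G=(g_{ij})$. $\rho(u)$ is the maximal eigenvalue of the matrix $(B_{ij}(u))$. (A-1) $\{B_i\}$ is nonsingular: there is no $n\times n$ matrix $M$ with $(B_1(u),\dots,B_n(u))^{T}=M(u_1,\dots,u_n)^{T}$ for all $u$. (A-2) $B_{ij}(1,\dots,1)<\infty$ for all $i,j$. (A-3) $G(1,\dots,1)$ is positively regular (some power has all entries strictly positive). $\mathbf q=(q_1,\dots,q_n)$ is the smallest nonnegative solution in $[0,1]^n$ of $B_1(u)=\dots=B_n(u)=0$; $\mathbf q=(1,\dots,1)$ if $\rho(1,\dots,1)\le0$, and all $q_k<1$ if $\rho(1,\dots,1)>0$. $(u_2(u),\dots,u_n(u))$, $u\in[0,q_1]$, is the unique solution of $u_k'(u)=B_k(u,u_2,\dots,u_n)/B_1(u,u_2,\dots,u_n)$, $u_k(0)=0$ ($2\le k\le n$), extended continuously to $u=q_1$ with $u_k(q_1)=q_k$. $J$ is used only when $\rho(1,\dots,1)\le0$ (so that $q_1=1$).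
   Formalization: In (iii), q_k > 0 does not follow from the stated hypotheses (some q_k can be 0, and then the strict inequality fails for i = e_k); so q_k > 0 for all k is assumed, only for the strict inequality a_{i0} < ∏ q_k^{i_k}, and is not asserted. *)

theory Defs
  imports "HOL-Analysis.Analysis"
begin

text \<open>
  The coordinates \<open>1, \<dots>, n\<close> are the elements of a finite type \<open>'n\<close>, and the first coordinate, which
  parametrises the curve below, is an arbitrary fixed element \<open>e :: 'n\<close>. Multi-indices have type
  \<open>nat^'n\<close>, with componentwise order and operations; the unit vector \<open>e\<^sub>k\<close> is \<open>axis k 1\<close>, and the
  point \<open>(1, \<dots>, 1)\<close> is \<open>1 :: real^'n\<close>. The order on \<open>real^'n\<close> is componentwise too, so that
  \<open>{0..1}\<close> is the unit cube.
\<close>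

definition branching_immigration_coeffs ::
    "(nat^'n \<Rightarrow> real) \<Rightarrow> ('n::finite \<Rightarrow> nat^'n \<Rightarrow> real) \<Rightarrow> bool" where
  "branching_immigration_coeffs a b \<longleftrightarrow>
     (\<forall>j. j \<noteq> 0 \<longrightarrow> a j \<ge> 0) \<and> (a has_sum (- a 0)) (- {0}) \<and> 0 < - a 0 \<and>
     (\<forall>k. (\<forall>j. j \<noteq> axis k 1 \<longrightarrow> b k j \<ge> 0) \<and>
          (b k has_sum (- b k (axis k 1))) (- {axis k 1}) \<and> 0 < - b k (axis k 1))"

text \<open>
  Subtraction of naturals truncates. The guards express that the subscripts \<open>j - i + e\<^sub>k\<close> and
  \<open>j - i\<close> have no negative component, i.e. they are the factors \<open>\<chi>\<close>.
\<close>

definition absorptive_q_matrix ::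
    "(nat^'n \<Rightarrow> real) \<Rightarrow> ('n::finite \<Rightarrow> nat^'n \<Rightarrow> real) \<Rightarrow> nat^'n \<Rightarrow> nat^'n \<Rightarrow> real" where
  "absorptive_q_matrix a b i j =
     (if i = 0 then 0
      else (\<Sum>k\<in>UNIV. real (i $ k) * (if i \<le> j + axis k 1 then b k (j + axis k 1 - i) else 0))
           + (if i \<le> j then a (j - i) else 0))"

text \<open>
  Feller's construction of the minimal \<open>Q\<close>-function of a stable \<open>q\<close>-matrix: successive approximations
  to the backward integral equation
  \[ p_{ij}(t) = \delta_{ij} e^{q_{ii} t}
       + \int_0^t e^{q_{ii} s} \sum_{k \ne i} q_{ik}\, p_{kj}(t - s)\, ds , \]
  which increase to its minimal nonnegative solution. The \<open>m\<close>-th approximation is the probability of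
  being in \<open>j\<close> at time \<open>t\<close> after at most \<open>m\<close> jumps.
\<close>

primrec feller_approx :: "('i \<Rightarrow> 'i \<Rightarrow> real) \<Rightarrow> nat \<Rightarrow> real \<Rightarrow> 'i \<Rightarrow> 'i \<Rightarrow> ennreal" where
  "feller_approx Q 0 t i j = (if i = j then ennreal (exp (Q i i * t)) else 0)"
| "feller_approx Q (Suc m) t i j =
     (if i = j then ennreal (exp (Q i i * t)) else 0) +
     (\<integral>\<^sup>+s\<in>{0..t}. (ennreal (exp (Q i i * s)) *
        (\<integral>\<^sup>+k. ennreal (Q i k) * feller_approx Q m (t - s) k j \<partial>count_space (- {i}))) \<partial>lborel)"

definition feller_minimal :: "('i \<Rightarrow> 'i \<Rightarrow> real) \<Rightarrow> real \<Rightarrow> 'i \<Rightarrow> 'i \<Rightarrow> real" where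
  "feller_minimal Q t i j = enn2real (SUP m. feller_approx Q m t i j)"

definition extinction_prob ::
    "(nat^'n \<Rightarrow> real) \<Rightarrow> ('n::finite \<Rightarrow> nat^'n \<Rightarrow> real) \<Rightarrow> nat^'n \<Rightarrow> real" where
  "extinction_prob a b i = Lim at_top (\<lambda>t. feller_minimal (absorptive_q_matrix a b) t i 0)"

definition monomial :: "real^'n \<Rightarrow> nat^'n::finite \<Rightarrow> real" where
  "monomial u j = (\<Prod>k\<in>UNIV. (u $ k) ^ (j $ k))"

definition gen_fun :: "(nat^'n \<Rightarrow> real) \<Rightarrow> real^'n::finite \<Rightarrow> real" where
  "gen_fun c u = (\<Sum>\<^sub>\<infinity>j. c j * monomial u j)"

definition slice :: "(real^'n \<Rightarrow> real) \<Rightarrow> real^'n \<Rightarrow> 'n::finite \<Rightarrow> real \<Rightarrow> real" where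
  "slice f u j x = f (\<chi> l. if l = j then x else u $ l)"

text \<open>
  Generating functions live on the unit cube, so partial derivatives are taken within \<open>{0..1}\<close>;
  they are one-sided on the boundary. At \<open>(1, \<dots>, 1)\<close> the left difference quotients of \<open>B\<^sub>i\<close> increase
  to a limit in \<open>(-\<infinity>, \<infinity>]\<close>, so that \<open>B\<^sub>i\<^sub>j(1, \<dots>, 1) < \<infinity>\<close> means differentiability there.
\<close>

definition jacobian :: "('n \<Rightarrow> nat^'n \<Rightarrow> real) \<Rightarrow> real^'n \<Rightarrow> real^'n^'n::finite" where
  "jacobian b u =
     (\<chi> i j. vector_derivative (slice (gen_fun (b i)) u j) (at (u $ j) within {0..1}))"

definition finite_means :: "('n::finite \<Rightarrow> nat^'n \<Rightarrow> real) \<Rightarrow> bool" where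
  "finite_means b \<longleftrightarrow>
     (\<forall>i j. slice (gen_fun (b i)) 1 j differentiable (at 1 within {0..1}))"

definition nonsingular_branching :: "('n::finite \<Rightarrow> nat^'n \<Rightarrow> real) \<Rightarrow> bool" where
  "nonsingular_branching b \<longleftrightarrow>
     \<not> (\<exists>M :: real^'n^'n. \<forall>u \<in> {0..1}. (\<chi> i. gen_fun (b i) u) = M *v u)"

definition G_matrix :: "('n \<Rightarrow> nat^'n \<Rightarrow> real) \<Rightarrow> real^'n \<Rightarrow> real^'n^'n::finite" where
  "G_matrix b u =
     (\<chi> i j. (if i = j then 1 else 0) - jacobian b u $ i $ j / b i (axis i 1))"

text \<open>The operation \<open>^\<close> on \<open>real^'n^'n\<close> is componentwise, hence the iterated matrix product.\<close>

definition positively_regular :: "real^'n^'n::finite \<Rightarrow> bool" where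
  "positively_regular M \<longleftrightarrow>
     (\<exists>m\<ge>1. \<forall>i j. ((\<lambda>X. M ** X) ^^ m) (mat 1) $ i $ j > 0)"

text \<open>
  The maximum ranges over the real eigenvalues. The matrices in question have nonnegative
  off-diagonal entries, so by Perron--Frobenius this maximum exists and is also the largest real
  part of a complex eigenvalue.
\<close>

definition max_eigenvalue :: "real^'n^'n::finite \<Rightarrow> real" where
  "max_eigenvalue M = Max {l. \<exists>v. v \<noteq> 0 \<and> M *v v = l *\<^sub>R v}"

definition rho :: "('n \<Rightarrow> nat^'n \<Rightarrow> real) \<Rightarrow> real^'n::finite \<Rightarrow> real" where
  "rho b u = max_eigenvalue (jacobian b u)"

definition smallest_root :: "('n \<Rightarrow> nat^'n \<Rightarrow> real) \<Rightarrow> real^'n::finite \<Rightarrow> bool" where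
  "smallest_root b q \<longleftrightarrow>
     q \<in> {0..1} \<and> (\<forall>k. gen_fun (b k) q = 0) \<and>
     (\<forall>v \<in> {0..1}. (\<forall>k. gen_fun (b k) v = 0) \<longrightarrow> q \<le> v)"

text \<open>
  \<open>U y = (y, u\<^sub>2(y), \<dots>, u\<^sub>n(y))\<close>, with \<open>y\<close> in coordinate \<open>e\<close>. Since \<open>x / 0 = 0\<close> in HOL, the denominator
  in the differential equation is required to be nonzero. At \<open>y = q\<^sub>1\<close> the right-hand side is
  \<open>0 / 0\<close>; there the solution is extended by continuity.
\<close>

definition branching_curve ::
    "('n \<Rightarrow> nat^'n \<Rightarrow> real) \<Rightarrow> 'n::finite \<Rightarrow> real^'n \<Rightarrow> (real \<Rightarrow> real^'n) \<Rightarrow> bool" where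
  "branching_curve b e q U \<longleftrightarrow>
     U 0 = 0 \<and> (\<forall>y \<in> {0..q $ e}. U y \<in> {0..1} \<and> U y $ e = y) \<and>
     (\<forall>y \<in> {0..<q $ e}. gen_fun (b e) (U y) \<noteq> 0 \<and>
        (\<forall>k. k \<noteq> e \<longrightarrow>
           ((\<lambda>x. U x $ k) has_real_derivative gen_fun (b k) (U y) / gen_fun (b e) (U y))
             (at y within {0..<q $ e}))) \<and>
     continuous_on {0..q $ e} U \<and> U (q $ e) = q"

definition weight ::
    "(nat^'n \<Rightarrow> real) \<Rightarrow> ('n \<Rightarrow> nat^'n \<Rightarrow> real) \<Rightarrow> 'n::finite \<Rightarrow> (real \<Rightarrow> real^'n) \<Rightarrow> real \<Rightarrow> real" where
  "weight a b e U y =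
     1 / gen_fun (b e) (U y) *
     exp (LBINT x:{0..y}. gen_fun a (U x) / gen_fun (b e) (U x))"

definition J_integral ::
    "(nat^'n \<Rightarrow> real) \<Rightarrow> ('n \<Rightarrow> nat^'n \<Rightarrow> real) \<Rightarrow> 'n::finite \<Rightarrow> (real \<Rightarrow> real^'n) \<Rightarrow> ennreal" where
  "J_integral a b e U = (\<integral>\<^sup>+y\<in>{0<..<1}. ennreal (weight a b e U y) \<partial>lborel)"

definition extinction_ratio ::
    "(nat^'n \<Rightarrow> real) \<Rightarrow> ('n \<Rightarrow> nat^'n \<Rightarrow> real) \<Rightarrow> 'n::finite \<Rightarrow> (real \<Rightarrow> real^'n) \<Rightarrow> real \<Rightarrow>
     nat^'n \<Rightarrow> real" where
  "extinction_ratio a b e U c i =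
     (LBINT y:{0<..<c}. monomial (U y) i * weight a b e U y) /
     (LBINT y:{0<..<c}. weight a b e U y)"

end

theory Submission
  imports Defs
begin

text \<open>
  The extinction probability is the least nonnegative superharmonic function \<open>f\<close> of the \<open>q\<close>-matrix
  with \<open>f 0 = 1\<close>. Along the curve, \<open>E y = exp (\<integral>\<^sub>0\<^sup>y A / B\<^sub>1)\<close> satisfies
  \<open>(U\<^sup>i E)' = (\<Sum>\<^sub>j q\<^sub>i\<^sub>j U\<^sup>j) E / B\<^sub>1\<close>, so the functions \<open>W y j = \<integral>\<^sub>0\<^sup>y U\<^sup>j E / B\<^sub>1\<close> satisfy
  \<open>\<Sum>\<^sub>j q\<^sub>i\<^sub>j W y j = (U y)\<^sup>i E y \<ge> 0\<close>. Thus \<open>W y\<close> is subharmonic and vanishes at infinity. A positive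
  maximum of \<open>W y - W y 0 f\<close> would be attained and then propagated to infinity by the immigration,
  hence \<open>W y \<le> W y 0 f\<close>. Letting \<open>y\<close> tend to the end point yields \<open>f = 1\<close> if \<open>J = \<infinity>\<close>. If the
  integral of the weight is finite, then \<open>E\<close> tends to \<open>0\<close>, because \<open>1 / B\<^sub>1\<close> is not integrable; so the
  normalised limit of \<open>W y\<close> is harmonic and coincides with \<open>f\<close>. The sign of \<open>\<rho>(1)\<close> is related to the
  smallest root by testing the system with positive left and right eigenvectors of the Jacobian,
  which Brouwer's fixed point theorem provides.
\<close>

section \<open>Absorption in the minimal chain\<close>

text \<open>Why the curve: on monomials the \<open>q\<close>-matrix acts as a first-order operator,
  \<open>sum_j q_ij u^j = A u^i + sum_k B_k d_k u^i\<close>. \<open>U\<close> is its characteristic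
  through the origin and \<open>E\<close> the integrating factor of the term \<open>A u^i\<close>.
  The contribution at \<open>y = 0\<close> vanishes because \<open>U 0 = 0\<close> and
  \<open>i \<noteq> 0\<close>. The obstacle is the end point \<open>q $ e\<close>: there
  \<open>B_1\<close> vanishes, the weight may fail to be integrable, and for \<open>q = 1\<close>
  the curve runs into the corner. Hence the estimates live on \<open>{0..y}\<close> with
  \<open>y\<close> below the end point, where \<open>B_1\<close> is bounded below and every
  \<open>U_k\<close> stays below a constant less than 1. The price is the boundary term
  \<open>U^i E\<close>; it has the right sign for the lower bound on \<open>f\<close>, and only the
  upper bound needs \<open>E\<close> to tend to 0. Integrability of the weight means
  \<open>J < \<infinity>\<close> if the maximal eigenvalue is at most 0. If it is positive,
  \<open>E' = A E / B_1\<close> and \<open>A \<le> A(q) < 0\<close> bound the integral by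
  \<open>-1 / A(q)\<close>. This rests on \<open>U \<le> q\<close>, which the definition of the
  curve does not state.\<close>

lemma nn_integral_count_space_has_sum:
  fixes f :: "'b \<Rightarrow> real"
  assumes "(f has_sum S) A" "\<And>x. x \<in> A \<Longrightarrow> 0 \<le> f x"
  shows "(\<integral>\<^sup>+x. ennreal (f x) \<partial>count_space A) = ennreal S"
proof -
  have "f summable_on A" using assms(1) by (auto simp: has_sum_iff)
  then have "(\<lambda>x. norm (f x)) summable_on A"
    by (rule summable_on_cong[THEN iffD1, rotated]) (use assms(2) in auto)
  then have "Infinite_Set_Sum.abs_summable_on f A"
    by (simp only: abs_summable_equivalent)
  moreover have "infsetsum f A = S"
    using infsetsum_infsum[OF calculation] assms(1) by (simp add: has_sum_iff)
  ultimately show ?thesis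
    using nn_integral_conv_infsetsum assms(2) by metis
qed

lemma nn_integral_exp_interval:
  fixes c t :: real
  assumes "c < 0" "0 \<le> t"
  shows "(\<integral>\<^sup>+s\<in>{0..t}. ennreal (exp (c * s)) \<partial>lborel) = ennreal ((1 - exp (c * t)) / - c)"
proof -
  have "(\<integral>\<^sup>+s\<in>{0..t}. ennreal (exp (c * s)) \<partial>lborel) = ennreal (exp (c * t) / c - exp (c * 0) / c)"
    by (rule nn_integral_FTC_Icc)
       (use assms in \<open>auto intro!: derivative_eq_intros\<close>)
  also have "exp (c * t) / c - exp (c * 0) / c = (1 - exp (c * t)) / - c"
    using assms by (simp add: field_simps)
  finally show ?thesis .
qed

lemma feller_approx_absorbing:
  assumes "\<And>k. Q z k = 0"
  shows "feller_approx Q m t z z = 1"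
  by (cases m) (simp_all add: assms)

lemma feller_approx_mono_jumps: "feller_approx Q m t i j \<le> feller_approx Q (Suc m) t i j"
proof (induction m arbitrary: t i)
  case 0
  then show ?case by simp
next
  case (Suc m)
  show ?case
    unfolding feller_approx.simps(2)
    by (intro add_left_mono nn_integral_mono mult_right_mono mult_left_mono
        Suc[unfolded feller_approx.simps(2)]) auto
qed

text \<open>Absorption is essential: since \<open>z\<close> is never left, being in \<open>z\<close>
  at time \<open>t\<close> means having hit it by then. In the recursion a later \<open>t\<close>
  enlarges both the range of the first jump time \<open>s\<close> and the remaining time
  \<open>t - s\<close>.\<close>

lemma feller_approx_mono_time:
  assumes "\<And>k. Q z k = 0" and "t \<le> t'"
  shows "feller_approx Q m t i z \<le> feller_approx Q m t' i z"
  using assms(2)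
proof (induction m arbitrary: t t' i)
  case 0
  then show ?case using assms(1) by auto
next
  case (Suc m)
  show ?case
  proof (cases "i = z")
    case True
    then show ?thesis by (simp only: feller_approx_absorbing[of Q z, OF assms(1)])
  next
    case False
    then show ?thesis
      unfolding feller_approx.simps(2)
      by (simp only: if_False add_0, intro nn_integral_mono mult_mono Suc)
         (use \<open>t \<le> t'\<close> in \<open>auto simp: indicator_def\<close>)
  qed
qed

text \<open>Superharmonicity bounds the inner sum by \<open>- Q i i * h i\<close>, whatever the time
  of the first jump, and the exponential density of that time has mass at most 1. So no
  approximation can climb above \<open>h\<close>.\<close>

lemma feller_approx_le_superharmonic:
  fixes h :: "'i \<Rightarrow> ennreal"
  assumes abs: "\<And>k. Q z k = 0" and stable: "\<And>i. i \<noteq> z \<Longrightarrow> Q i i < 0"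
    and h: "1 \<le> h z"
    and super: "\<And>i. i \<noteq> z \<Longrightarrow>
      (\<integral>\<^sup>+k. ennreal (Q i k) * h k \<partial>count_space (- {i})) \<le> ennreal (- Q i i) * h i"
  shows "feller_approx Q m t i z \<le> h i"
proof (induction m arbitrary: t i)
  case 0
  then show ?case using abs h by simp
next
  case (Suc m)
  show ?case
  proof (cases "i = z \<or> t < 0")
    case True
    then show ?thesis
    proof
      assume "i = z"
      then show ?thesis using h by (simp only: feller_approx_absorbing[of Q z, OF abs])
    next
      \<comment> \<open>Negative times do occur: the induction hypothesis is used at
        \<open>t - s\<close> for every real \<open>s\<close>. There \<open>{0..t}\<close> is empty
        and the recursion collapses to its zeroth stage.\<close>
      assume "t < 0"
      then have "feller_approx Q (Suc m) t i z = feller_approx Q 0 t i z" by simp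
      also have "\<dots> \<le> h i" using abs h by simp
      finally show ?thesis .
    qed
  next
    case False
    then have i: "i \<noteq> z" "0 \<le> t" by auto
    have "feller_approx Q (Suc m) t i z \<le>
        (\<integral>\<^sup>+s\<in>{0..t}. (ennreal (- Q i i) * h i) * ennreal (exp (Q i i * s)) \<partial>lborel)"
      unfolding feller_approx.simps(2)
    proof (simp only: i if_False add_0, intro nn_integral_mono mult_right_mono)
      fix s
      have "(\<integral>\<^sup>+k. ennreal (Q i k) * feller_approx Q m (t - s) k z \<partial>count_space (- {i}))
        \<le> (\<integral>\<^sup>+k. ennreal (Q i k) * h k \<partial>count_space (- {i}))"
        by (intro nn_integral_mono mult_left_mono Suc) auto
      also have "\<dots> \<le> ennreal (- Q i i) * h i" by (rule super[OF i(1)])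
      finally show "ennreal (exp (Q i i * s)) *
          (\<integral>\<^sup>+k. ennreal (Q i k) * feller_approx Q m (t - s) k z \<partial>count_space (- {i}))
          \<le> ennreal (- Q i i) * h i * ennreal (exp (Q i i * s))"
        by (subst mult.commute) (rule mult_right_mono, auto)
    qed auto
    also have "\<dots> = (ennreal (- Q i i) * h i) * (\<integral>\<^sup>+s\<in>{0..t}. ennreal (exp (Q i i * s)) \<partial>lborel)"
      by (simp add: mult.assoc nn_integral_cmult)
    also have "\<dots> = h i * (ennreal (- Q i i) * ennreal ((1 - exp (Q i i * t)) / - Q i i))"
      using nn_integral_exp_interval[OF stable[OF i(1)] i(2)] by (simp add: ac_simps)
    also have "\<dots> = h i * ennreal (1 - exp (Q i i * t))"
      using stable[OF i(1)] i(2)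
      by (subst ennreal_mult[symmetric]) (auto simp: divide_nonneg_neg mult_nonpos_nonneg)
    also have "\<dots> \<le> h i * 1" by (rule mult_left_mono) auto
    finally show ?thesis by simp
  qed
qed

text \<open>Number of jumps and time are exhausted together along the diagonal, so that one
  application of monotone convergence suffices. For absorbing \<open>z\<close> this is the
  probability of ever reaching \<open>z\<close>.\<close>

definition absorption_prob :: "('i \<Rightarrow> 'i \<Rightarrow> real) \<Rightarrow> 'i \<Rightarrow> 'i \<Rightarrow> ennreal" where
  "absorption_prob Q z i = (SUP n. feller_approx Q n (real n) i z)"

lemma feller_approx_le_absorption_prob:
  assumes "\<And>k. Q z k = 0"
  shows "feller_approx Q m t i z \<le> absorption_prob Q z i"
proof -
  define n where "n = max m (nat \<lceil>t\<rceil>)"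
  have "feller_approx Q m t i z \<le> feller_approx Q n t i z"
    by (rule lift_Suc_mono_le[of "\<lambda>m. feller_approx Q m t i z"])
       (auto simp: feller_approx_mono_jumps n_def simp del: feller_approx.simps)
  also have "\<dots> \<le> feller_approx Q n (real n) i z"
    by (rule feller_approx_mono_time[of Q z, OF assms]) (simp add: n_def, linarith)
  also have "\<dots> \<le> absorption_prob Q z i"
    unfolding absorption_prob_def by (rule SUP_upper) simp
  finally show ?thesis .
qed

text \<open>Of the paths counted at time \<open>n + N\<close>, keep those whose first jump happens
  before \<open>N\<close>; they have at least time \<open>n\<close> left. This costs only the factor
  \<open>1 - exp (Q i i * N)\<close>, which disappears as \<open>N\<close> grows with
  \<open>n\<close> fixed; the supremum over \<open>n\<close> comes last.\<close>

lemma absorption_prob_superharmonic: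
  assumes abs: "\<And>k. Q z k = 0" and "Q i i < 0" "i \<noteq> z"
  shows "(\<integral>\<^sup>+k. ennreal (Q i k) * absorption_prob Q z k \<partial>count_space (- {i}))
     \<le> ennreal (- Q i i) * absorption_prob Q z i"
proof -
  define v where "v n k = feller_approx Q n (real n) k z" for n k
  define S where "S n = (\<integral>\<^sup>+k. ennreal (Q i k) * v n k \<partial>count_space (- {i}))" for n
  have "incseq (\<lambda>n. v n k)" for k
  proof (rule incseq_SucI)
    fix n
    have "v n k \<le> feller_approx Q (Suc n) (real n) k z"
      unfolding v_def by (rule feller_approx_mono_jumps)
    also have "\<dots> \<le> v (Suc n) k"
      unfolding v_def by (rule feller_approx_mono_time[of Q z, OF abs]) simp
    finally show "v n k \<le> v (Suc n) k" .
  qed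
  then have inc: "incseq (\<lambda>n k. ennreal (Q i k) * v n k)"
    by (auto simp: incseq_def le_fun_def intro!: mult_left_mono)
  have SUP: "(\<integral>\<^sup>+k. ennreal (Q i k) * absorption_prob Q z k \<partial>count_space (- {i})) = (SUP n. S n)"
    unfolding absorption_prob_def S_def v_def[symmetric]
    by (subst nn_integral_monotone_convergence_SUP[symmetric])
       (use inc in \<open>auto simp: SUP_mult_left_ennreal\<close>)
  have S_mono: "S n \<le> S m" if "n \<le> m" for n m
    unfolding S_def using inc that
    by (intro nn_integral_mono) (auto simp: incseq_def le_fun_def)
  have bound: "ennreal (1 - exp (Q i i * real N)) * S n \<le> ennreal (- Q i i) * absorption_prob Q z i"
    for n N
  proof -
    have "ennreal ((1 - exp (Q i i * real N)) / - Q i i) * S n =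
        S n * (\<integral>\<^sup>+s\<in>{0..real N}. ennreal (exp (Q i i * s)) \<partial>lborel)"
      using nn_integral_exp_interval[OF assms(2)] by (simp add: mult.commute)
    also have "\<dots> = (\<integral>\<^sup>+s\<in>{0..real N}. (S n * ennreal (exp (Q i i * s))) \<partial>lborel)"
      by (simp add: mult.assoc nn_integral_cmult)
    also have "\<dots> \<le> feller_approx Q (Suc n) (real (n + N)) i z"
      unfolding feller_approx.simps(2)
    proof (simp only: assms if_False add_0, intro nn_integral_mono)
      fix s
      have "S n \<le> (\<integral>\<^sup>+k. ennreal (Q i k) * feller_approx Q n (real (n + N) - s) k z \<partial>count_space (- {i}))"
        if "s \<le> real N"
        unfolding S_def v_def using that
        by (intro nn_integral_mono mult_left_mono feller_approx_mono_time[of Q z, OF abs]) auto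
      then show "S n * ennreal (exp (Q i i * s)) * indicator {0..real N} s \<le>
          ennreal (exp (Q i i * s)) *
          (\<integral>\<^sup>+k. ennreal (Q i k) * feller_approx Q n (real (n + N) - s) k z \<partial>count_space (- {i})) *
          indicator {0..real (n + N)} s"
        by (auto simp: indicator_def mult.commute[of "S n"] intro!: mult_left_mono)
    qed
    also have "\<dots> \<le> absorption_prob Q z i"
      by (rule feller_approx_le_absorption_prob[of Q z, OF abs])
    finally have "ennreal (- Q i i) * (ennreal ((1 - exp (Q i i * real N)) / - Q i i) * S n)
        \<le> ennreal (- Q i i) * absorption_prob Q z i"
      by (rule mult_left_mono) simp
    also have "ennreal (- Q i i) * (ennreal ((1 - exp (Q i i * real N)) / - Q i i) * S n)
        = ennreal (1 - exp (Q i i * real N)) * S n"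
      using assms(2)
      by (subst mult.assoc[symmetric], subst ennreal_mult[symmetric])
         (auto simp: divide_nonneg_neg mult_nonpos_nonneg)
    finally show ?thesis .
  qed
  have "S n \<le> ennreal (- Q i i) * absorption_prob Q z i" for n
  proof -
    have "filterlim (\<lambda>N. Q i i * real N) at_bot sequentially"
      using assms(2) by (intro filterlim_tendsto_neg_mult_at_bot[OF tendsto_const])
        (auto simp: filterlim_real_sequentially)
    then have "(\<lambda>N. exp (Q i i * real N)) \<longlonglongrightarrow> 0"
      by (rule filterlim_compose[OF exp_at_bot])
    then have "(\<lambda>N. ennreal (1 - exp (Q i i * real N))) \<longlonglongrightarrow> ennreal (1 - 0)"
      by (intro tendsto_ennrealI tendsto_intros)
    then have "(\<lambda>N. ennreal (1 - exp (Q i i * real N)) * S n) \<longlonglongrightarrow> ennreal (1 - 0) * S n"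
      by (intro tendsto_mult_ennreal tendsto_const) auto
    then show ?thesis
      using bound by (intro LIMSEQ_le_const2) auto
  qed
  then show ?thesis unfolding SUP by (rule SUP_least)
qed

lemma feller_minimal_tendsto_absorption_prob:
  assumes abs: "\<And>k. Q z k = 0" and fin: "absorption_prob Q z i < \<infinity>"
  shows "((\<lambda>t. feller_minimal Q t i z) \<longlongrightarrow> enn2real (absorption_prob Q z i)) at_top"
proof -
  define p where "p t = (SUP m. feller_approx Q m t i z)" for t
  have le: "p t \<le> absorption_prob Q z i" for t
    unfolding p_def by (rule SUP_least) (rule feller_approx_le_absorption_prob[of Q z, OF abs])
  have "(p \<longlongrightarrow> absorption_prob Q z i) at_top"
  proof (rule increasing_tendsto)
    fix x assume "x < absorption_prob Q z i"
    then obtain n where n: "x < feller_approx Q n (real n) i z"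
      unfolding absorption_prob_def by (auto simp: less_SUP_iff)
    have "x < p t" if "real n \<le> t" for t
    proof -
      note n
      also have "feller_approx Q n (real n) i z \<le> feller_approx Q n t i z"
        by (rule feller_approx_mono_time[of Q z, OF abs that])
      also have "\<dots> \<le> p t" unfolding p_def by (rule SUP_upper) simp
      finally show ?thesis .
    qed
    then show "\<forall>\<^sub>F t in at_top. x < p t"
      using eventually_ge_at_top[of "real n"] by (rule eventually_mono[rotated])
  qed (use le in auto)
  then show ?thesis
    unfolding feller_minimal_def p_def[symmetric] using fin
    by (intro tendsto_enn2real) auto
qed

section \<open>Perron eigenvectors\<close>

abbreviation mat_power :: "real^'n^'n \<Rightarrow> nat \<Rightarrow> real^'n^'n::finite" where
  "mat_power M m \<equiv> ((\<lambda>X. M ** X) ^^ m) (mat 1)"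

lemma eigenvectors_linear_independent:
  fixes M :: "real^'n^'n::finite"
  assumes "finite L" "\<And>l. l \<in> L \<Longrightarrow> v l \<noteq> 0 \<and> M *v v l = l *\<^sub>R v l"
    "(\<Sum>l\<in>L. c l *\<^sub>R v l) = 0" "l \<in> L"
  shows "c l = 0"
  using assms
proof (induction L arbitrary: c l)
  case empty
  then show ?case by simp
next
  case (insert k L)
  have eq: "c k *\<^sub>R v k + (\<Sum>l\<in>L. c l *\<^sub>R v l) = 0" using insert by simp
  then have "M *v (c k *\<^sub>R v k + (\<Sum>l\<in>L. c l *\<^sub>R v l)) = 0" by simp
  then have "c k *\<^sub>R k *\<^sub>R v k + (\<Sum>l\<in>L. c l *\<^sub>R l *\<^sub>R v l) = 0"
    using insert.prems(1)
    by (simp add: matrix_vector_right_distrib linear_sum[OF matrix_vector_mul_linear]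
        matrix_vector_mult_scaleR)
  moreover have "k *\<^sub>R (c k *\<^sub>R v k + (\<Sum>l\<in>L. c l *\<^sub>R v l)) = 0" using eq by simp
  ultimately have "(\<Sum>l\<in>L. (c l * (l - k)) *\<^sub>R v l) = 0"
    by (simp add: algebra_simps scaleR_sum_right sum_subtractf) (metis add_left_imp_eq)
  then have "c l * (l - k) = 0" if "l \<in> L" for l
    using insert.IH[of "\<lambda>l. c l * (l - k)"] insert.prems(1) that by simp
  then have L: "c l = 0" if "l \<in> L" for l using insert.hyps(2) that by force
  then have "c k *\<^sub>R v k = 0" using eq by simp
  then have "c k = 0" using insert.prems(1) by simp
  then show ?case using L insert.prems(3) by auto
qed

text \<open>\<open>Max\<close> in \<open>max_eigenvalue\<close> is meaningful only for a finite set.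
  Eigenvectors of distinct eigenvalues are independent, so their number cannot exceed the
  dimension.\<close>

lemma finite_eigenvalues:
  fixes M :: "real^'n^'n::finite"
  shows "finite {l. \<exists>v. v \<noteq> 0 \<and> M *v v = l *\<^sub>R v}" (is "finite ?E")
proof (rule ccontr)
  assume "infinite ?E"
  then obtain L where L: "finite L" "card L = Suc CARD('n)" "L \<subseteq> ?E"
    using infinite_arbitrarily_large by blast
  have "\<forall>l. \<exists>v. l \<in> L \<longrightarrow> v \<noteq> 0 \<and> M *v v = l *\<^sub>R v" using L(3) by blast
  then obtain v where v: "\<And>l. l \<in> L \<Longrightarrow> v l \<noteq> 0 \<and> M *v v l = l *\<^sub>R v l" by metis
  have inj: "inj_on v L"
    by (rule inj_onI) (metis v real_vector.scale_right_imp_eq)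
  have "independent (v ` L)"
  proof (rule independent_if_scalars_zero)
    fix f x assume f: "(\<Sum>x\<in>v ` L. f x *\<^sub>R x) = 0" and x: "x \<in> v ` L"
    have "(\<Sum>l\<in>L. f (v l) *\<^sub>R v l) = 0" using f inj by (simp add: sum.reindex)
    then show "f x = 0"
      using eigenvectors_linear_independent[of L v M "\<lambda>l. f (v l)"] L(1) v x by blast
  qed (use L in auto)
  then have "card (v ` L) \<le> CARD('n)" using independent_bound[of "v ` L"] by simp
  then show False using L(2) card_image[OF inj] by simp
qed

lemma mat_power_commute: "mat_power M m ** M = M ** mat_power (M :: real^'n^'n::finite) m"
  by (induction m) (simp_all add: matrix_mul_assoc[symmetric])

lemma transpose_mat_power:
  "transpose (mat_power M m) = mat_power (transpose (M :: real^'n^'n::finite)) m"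
proof (induction m)
  case (Suc m)
  have "transpose (mat_power M (Suc m)) = transpose (mat_power M m ** M)"
    by (simp add: mat_power_commute)
  then show ?case using Suc by (simp add: matrix_transpose_mul)
qed (simp add: transpose_mat)

lemma mat_power_eigenvector:
  fixes M :: "real^'n^'n::finite"
  assumes "M *v x = l *\<^sub>R x"
  shows "mat_power M m *v x = l ^ m *\<^sub>R x"
proof (induction m)
  case (Suc m)
  have "mat_power M (Suc m) *v x = M *v (mat_power M m *v x)"
    by (simp add: matrix_vector_mul_assoc)
  also have "\<dots> = l ^ Suc m *\<^sub>R x"
    by (simp add: Suc matrix_vector_mult_scaleR assms)
  finally show ?case .
qed simp

lemma positive_matrix_vector:
  fixes P :: "real^'n^'n::finite"
  assumes P: "\<And>i j. 0 < P $ i $ j" and x: "0 \<le> x" "x \<noteq> 0"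
  shows "0 < (P *v x) $ i"
proof -
  obtain k where k: "x $ k \<noteq> 0" using x(2) by (auto simp: vec_eq_iff)
  have x0: "0 \<le> x $ j" for j using x(1) by (simp add: less_eq_vec_def)
  have "0 < (\<Sum>j\<in>UNIV. P $ i $ j * x $ j)"
    by (rule sum_pos2[of _ k]) (use k x0 P less_le in \<open>auto intro!: mult_nonneg_nonneg mult_pos_pos
        simp: less_imp_le less_le\<close>)
  then show ?thesis by (simp add: matrix_vector_mult_def)
qed

lemma positively_regular_eigenvector_pos:
  fixes N :: "real^'n^'n::finite"
  assumes "positively_regular N" "0 \<le> x" "x \<noteq> 0" "N *v x = l *\<^sub>R x"
  shows "0 < x $ i"
proof -
  obtain m where m: "\<And>i j. 0 < mat_power N m $ i $ j"
    using assms(1) unfolding positively_regular_def by blast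
  have "0 < l ^ m * x $ i"
    using positive_matrix_vector[OF m assms(2,3), of i] by (simp add: mat_power_eigenvector[OF assms(4)])
  moreover have "0 \<le> x $ i" using assms(2) by (simp add: less_eq_vec_def)
  ultimately show ?thesis by (metis less_eq_real_def less_irrefl mult_zero_right)
qed

text \<open>Brouwer is applied to \<open>f\<close>, the action of \<open>N\<close> on the unit
  simplex followed by normalisation. A fixed point is a nonnegative eigenvector, and positive
  regularity removes its zeros.\<close>

lemma perron_eigenvector:
  fixes N :: "real^'n^'n::finite"
  assumes N0: "\<And>i j. 0 \<le> N $ i $ j" and reg: "positively_regular N"
  obtains x l where "\<And>i. 0 < x $ i" "N *v x = l *\<^sub>R x"
proof -
  obtain m where m1: "m \<ge> 1" and m: "\<And>i j. 0 < mat_power N m $ i $ j"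
    using reg unfolding positively_regular_def by blast
  define K :: "(real^'n) set" where "K = {x. 0 \<le> x \<and> (\<Sum>i\<in>UNIV. x $ i) = 1}"
  define s where "s x = (\<Sum>i\<in>UNIV. (N *v x) $ i)" for x
  define f where "f x = (1 / s x) *\<^sub>R (N *v x)" for x
  have nz: "x \<noteq> 0" if "x \<in> K" for x using that by (auto simp: K_def)
  have N_nonneg: "0 \<le> (N *v x) $ i" if "x \<in> K" for x i
    using that N0 unfolding K_def matrix_vector_mult_def
    by (auto intro!: sum_nonneg mult_nonneg_nonneg simp: less_eq_vec_def)
  have s_pos: "0 < s x" if x: "x \<in> K" for x
  proof -
    \<comment> \<open>Otherwise the power of \<open>N\<close> with positive entries would annihilate
      the nonzero nonnegative vector \<open>x\<close>.\<close>
    have "N *v x \<noteq> 0"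
    proof
      assume N: "N *v x = 0"
      have "mat_power N m = mat_power N (m - 1) ** N"
        using m1 by (cases m) (simp_all add: mat_power_commute)
      then have "mat_power N m *v x = 0"
        using N by (simp add: matrix_vector_mul_assoc[symmetric])
      then show False
        using positive_matrix_vector[OF m, of x] x nz unfolding K_def by auto
    qed
    then obtain i where "(N *v x) $ i \<noteq> 0" by (auto simp: vec_eq_iff)
    then show ?thesis unfolding s_def
      by (intro sum_pos2[of _ i]) (use N_nonneg[OF x] less_le in \<open>auto simp: less_le\<close>)
  qed
  have "compact K"
  proof -
    have "K = {x. \<forall>i. 0 \<le> x $ i} \<inter> {x. (\<Sum>i\<in>UNIV. x $ i) = 1}"
      by (auto simp: K_def less_eq_vec_def)
    moreover have "closed \<dots>"
      by (intro closed_Int closed_Collect_all closed_Collect_le closed_Collect_eq continuous_intros)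
    moreover have "K \<subseteq> {0..1}"
    proof
      fix x assume "x \<in> K"
      then have x: "\<And>i. 0 \<le> x $ i" "(\<Sum>i\<in>UNIV. x $ i) = 1" by (auto simp: K_def less_eq_vec_def)
      have "x $ i \<le> (\<Sum>i\<in>UNIV. x $ i)" for i
        by (rule member_le_sum) (auto simp: x)
      then show "x \<in> {0..1}" using x by (simp add: less_eq_vec_def)
    qed
    ultimately show ?thesis
      by (metis closed_Int_compact compact_interval inf.absorb_iff1)
  qed
  moreover have "convex K"
    unfolding convex_alt K_def
    by (auto simp: less_eq_vec_def sum.distrib sum_distrib_left[symmetric])
  moreover have "axis i 1 \<in> K" for i
    by (auto simp: K_def less_eq_vec_def axis_def)
  then have "K \<noteq> {}" by blast
  moreover have "continuous_on K f"
    unfolding f_def s_def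
    by (intro continuous_intros linear_continuous_on matrix_vector_mul_bounded_linear)
       (use s_pos s_def in \<open>force+\<close>)
  moreover have "f \<in> K \<rightarrow> K"
  proof
    fix x assume x: "x \<in> K"
    have "(\<Sum>i\<in>UNIV. f x $ i) = 1"
      using s_pos[OF x] by (simp add: f_def sum_divide_distrib[symmetric] s_def[symmetric])
    then show "f x \<in> K"
      using N_nonneg[OF x] s_pos[OF x] by (simp add: K_def f_def less_eq_vec_def)
  qed
  ultimately obtain x where x: "x \<in> K" "f x = x" using brouwer by blast
  have eig: "N *v x = s x *\<^sub>R x"
    using x(2) s_pos[OF x(1)] by (simp add: f_def) (metis less_irrefl scaleR_one
        real_vector.scale_scale nonzero_mult_div_cancel_left times_divide_eq_right mult.right_neutral)
  have "0 < x $ i" for i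
    using positively_regular_eigenvector_pos[OF reg _ nz[OF x(1)] eig] x(1) by (simp add: K_def)
  then show thesis using that eig by blast
qed

lemma positively_regular_transpose:
  "positively_regular N \<Longrightarrow> positively_regular (transpose N)"
  unfolding positively_regular_def transpose_mat_power[symmetric]
  by (auto simp: transpose_def)

lemma inner_transpose: "(transpose M *v y) \<bullet> x = y \<bullet> (M *v (x :: real^'n::finite))"
  by (simp add: dot_lmul_matrix)

text \<open>The shift by \<open>c\<close> moves eigenvalues and keeps eigenvectors, so Perron's
  theorem for \<open>N\<close> applies to a matrix \<open>M\<close> with negative diagonal entries.
  The positive right and left eigenvectors share their eigenvalue because their inner product is
  positive.\<close>

lemma perron_max_eigenvalue:
  fixes M :: "real^'n^'n::finite" and c :: real
  defines "N \<equiv> M + c *\<^sub>R mat 1"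
  assumes N0: "\<And>i j. 0 \<le> N $ i $ j" and reg: "positively_regular N"
  obtains x y where "\<And>i. 0 < x $ i" "M *v x = max_eigenvalue M *\<^sub>R x"
    "\<And>i. 0 < y $ i" "transpose M *v y = max_eigenvalue M *\<^sub>R y"
proof -
  obtain x l where x: "\<And>i. 0 < x $ i" "N *v x = l *\<^sub>R x"
    using perron_eigenvector[OF N0 reg] by blast
  have "0 \<le> transpose N $ i $ j" for i j using N0 by (simp add: transpose_def)
  then obtain y l' where y: "\<And>i. 0 < y $ i" "transpose N *v y = l' *\<^sub>R y"
    using perron_eigenvector[of "transpose N"] positively_regular_transpose[OF reg] by blast
  have pos: "0 < y \<bullet> z" if z: "\<And>i. 0 \<le> z $ i" "z \<noteq> 0" for z
  proof -
    obtain i where "z $ i \<noteq> 0" using z(2) by (auto simp: vec_eq_iff)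
    then show ?thesis unfolding inner_vec_def
      by (intro sum_pos2[of _ i])
         (use z(1)[of i] y(1) z(1) in \<open>auto simp: less_imp_le less_le\<close>)
  qed
  have x0: "x \<noteq> 0" using x(1) by (metis less_irrefl zero_index)
  have "l * (y \<bullet> x) = l' * (y \<bullet> x)"
    using inner_transpose[of N y x] x(2) y(2) by auto
  then have l': "l' = l" using pos[OF less_imp_le[OF x(1)] x0] by simp
  have M: "M *v z = N *v z - c *\<^sub>R z" for z
    by (simp add: N_def matrix_vector_mult_add_rdistrib scaleR_matrix_vector_assoc[symmetric])
  have Mx: "M *v x = (l - c) *\<^sub>R x" using M x(2) by (simp add: algebra_simps)
  have "transpose N = transpose M + c *\<^sub>R mat 1"
    by (simp add: N_def transpose_def vec_eq_iff mat_def)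
  then have My: "transpose M *v y = (l - c) *\<^sub>R y"
    using y(2) l'
    by (simp add: algebra_simps matrix_vector_mult_add_rdistrib scaleR_matrix_vector_assoc[symmetric])
  have "max_eigenvalue M = l - c"
    unfolding max_eigenvalue_def
  proof (rule Max_eqI[OF finite_eigenvalues])
    show "l - c \<in> {l. \<exists>v. v \<noteq> 0 \<and> M *v v = l *\<^sub>R v}" using Mx x0 by blast
    fix k assume "k \<in> {l. \<exists>v. v \<noteq> 0 \<and> M *v v = l *\<^sub>R v}"
    then obtain z where z: "z \<noteq> 0" "M *v z = k *\<^sub>R z" by blast
    \<comment> \<open>Absolute values turn an arbitrary eigenvector \<open>z\<close> into the
      inequality \<open>\<bar>k + c\<bar> * w \<le> N *v w\<close>, and pairing with the positive
      left eigenvector \<open>y\<close> yields \<open>\<bar>k + c\<bar> \<le> l\<close>.\<close>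
    define w :: "real^'n" where "w = (\<chi> i. \<bar>z $ i\<bar>)"
    have "\<bar>k + c\<bar> * w $ i \<le> (N *v w) $ i" for i
    proof -
      have "N *v z = (k + c) *\<^sub>R z" using M[of z] z(2) by (simp add: algebra_simps)
      then have "(k + c) * z $ i = (\<Sum>j\<in>UNIV. N $ i $ j * z $ j)"
        by (simp add: vec_eq_iff matrix_vector_mult_def)
      then have "\<bar>k + c\<bar> * \<bar>z $ i\<bar> = \<bar>\<Sum>j\<in>UNIV. N $ i $ j * z $ j\<bar>"
        by (metis abs_mult)
      also have "\<dots> \<le> (\<Sum>j\<in>UNIV. \<bar>N $ i $ j * z $ j\<bar>)" by (rule sum_abs)
      finally show ?thesis
        by (simp add: w_def matrix_vector_mult_def abs_mult N0)
    qed
    then have "y \<bullet> (\<bar>k + c\<bar> *\<^sub>R w) \<le> y \<bullet> (N *v w)"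
      unfolding inner_vec_def by (intro sum_mono) (auto simp: y(1) less_imp_le)
    also have "\<dots> = l * (y \<bullet> w)" using inner_transpose[of N y w] y(2) l' by simp
    finally have "\<bar>k + c\<bar> * (y \<bullet> w) \<le> l * (y \<bullet> w)" by simp
    moreover have "0 < y \<bullet> w"
      using z(1) by (intro pos) (auto simp: w_def vec_eq_iff)
    ultimately have "\<bar>k + c\<bar> \<le> l" by simp
    then show "k \<le> l - c" by linarith
  qed
  then show thesis using that x(1) y(1) Mx My by metis
qed

text \<open>Entrywise domination passes to powers, up to the factor \<open>d ^ m\<close>. It carries
  regularity from \<open>G_matrix\<close>, whose rows are divided by different rates, over to the
  shifted Jacobian.\<close>

lemma positively_regular_mono:
  fixes G N :: "real^'n^'n::finite"
  assumes "positively_regular G" "0 < d"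
    and G0: "\<And>i j. 0 \<le> G $ i $ j" and le: "\<And>i j. d * G $ i $ j \<le> N $ i $ j"
  shows "positively_regular N"
proof -
  have *: "0 \<le> mat_power G m $ i $ j \<and> d ^ m * mat_power G m $ i $ j \<le> mat_power N m $ i $ j"
    for m i j
  proof (induction m arbitrary: i j)
    case 0
    then show ?case by (simp add: mat_def)
  next
    case (Suc m)
    have "d ^ Suc m * mat_power G (Suc m) $ i $ j =
        (\<Sum>k\<in>UNIV. (d * G $ i $ k) * (d ^ m * mat_power G m $ k $ j))"
      by (simp add: matrix_matrix_mult_def sum_distrib_left ac_simps)
    also have "\<dots> \<le> (\<Sum>k\<in>UNIV. N $ i $ k * mat_power N m $ k $ j)"
    proof (intro sum_mono mult_mono)
      fix k
      show "0 \<le> N $ i $ k" using le[of i k] G0[of i k] assms(2)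
        by (meson less_imp_le mult_nonneg_nonneg order_trans)
    qed (use Suc le assms(2) in auto)
    finally have "d ^ Suc m * mat_power G (Suc m) $ i $ j \<le> mat_power N (Suc m) $ i $ j"
      by (simp add: matrix_matrix_mult_def)
    moreover have "0 \<le> mat_power G (Suc m) $ i $ j"
      using Suc G0 by (auto simp: matrix_matrix_mult_def intro!: sum_nonneg)
    ultimately show ?case by blast
  qed
  show ?thesis using assms(1) * assms(2) unfolding positively_regular_def
    by (meson less_le_trans mult_pos_pos zero_less_power)
qed

section \<open>Power series on the unit cube\<close>

lemma zero_le_one_vec [simp]: "(0 :: real^'n::finite) \<le> 1"
  by (simp add: less_eq_vec_def)

lemma monomial_nonneg: "0 \<le> u \<Longrightarrow> 0 \<le> monomial u j"
  by (auto simp: monomial_def less_eq_vec_def intro!: prod_nonneg)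

lemma monomial_mono: "0 \<le> u \<Longrightarrow> u \<le> v \<Longrightarrow> monomial u j \<le> monomial v j"
  unfolding monomial_def less_eq_vec_def by (intro prod_mono conjI power_mono) auto

lemma monomial_one [simp]: "monomial 1 j = 1"
  by (simp add: monomial_def)

lemma monomial_le_one: "u \<in> {0..1} \<Longrightarrow> monomial u j \<le> 1"
  using monomial_mono[of u 1 j] by simp

lemma monomial_zero_index [simp]: "monomial u 0 = 1"
  by (simp add: monomial_def)

lemma monomial_zero: "j \<noteq> 0 \<Longrightarrow> monomial 0 j = 0"
  by (auto simp: monomial_def vec_eq_iff)

lemma monomial_add: "monomial u (i + j) = monomial u i * monomial u j"
  by (simp add: monomial_def power_add prod.distrib)

lemma monomial_axis [simp]: "monomial u (axis k 1) = u $ k"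
proof -
  have "monomial u (axis k 1) = (\<Prod>l\<in>UNIV. if l = k then u $ l else 1)"
    unfolding monomial_def by (rule prod.cong) (auto simp: axis_def)
  then show ?thesis by simp
qed

lemmas monomial_axis_Suc [simp] = monomial_axis[unfolded One_nat_def]

lemma axis_remainder:
  fixes j :: "nat^'n::finite"
  assumes "0 < j $ l"
  shows "j = axis l 1 + (j - axis l 1)"
  using assms by (auto simp: vec_eq_iff axis_def)

lemma index_pos: "(j :: nat^'n::finite) \<noteq> 0 \<Longrightarrow> \<exists>l. 0 < j $ l"
  by (auto simp: vec_eq_iff)

lemma monomial_le_component:
  assumes "u \<in> {0..1}" "0 < j $ l"
  shows "monomial u j \<le> u $ l"
proof -
  have "monomial u j = u $ l * monomial u (j - axis l 1)"
    using arg_cong[OF axis_remainder[OF assms(2)], of "monomial u"]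
    by (simp only: monomial_add monomial_axis)
  also have "\<dots> \<le> u $ l * 1"
    using assms(1) monomial_le_one by (intro mult_left_mono) (auto simp: less_eq_vec_def)
  finally show ?thesis by simp
qed

text \<open>The product is changed one factor at a time. Summed against
  \<open>offspring k j\<close>, the factors \<open>j $ l\<close> become means, so this is the source
  of the Lipschitz bounds.\<close>

lemma monomial_diff_le:
  assumes "u \<in> {0..1}" "v \<in> {0..1}"
  shows "\<bar>monomial u j - monomial v j\<bar> \<le> (\<Sum>l\<in>UNIV. real (j $ l) * \<bar>u $ l - v $ l\<bar>)"
proof -
  have u: "\<bar>u $ l\<bar> \<le> 1" "\<bar>v $ l\<bar> \<le> 1" for l 
    using assms by (auto simp: less_eq_vec_def abs_le_iff add_increasing2)
  have "norm (monomial u j - monomial v j) \<le> (\<Sum>l\<in>UNIV. norm (u $ l ^ j $ l - v $ l ^ j $ l))"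
    unfolding monomial_def
    by (rule norm_prod_diff) (use u in \<open>auto simp: power_abs power_le_one_iff\<close>)
  also have "\<dots> \<le> (\<Sum>l\<in>UNIV. real (j $ l) * norm (u $ l - v $ l))"
    by (rule sum_mono, rule norm_power_diff) (use u in auto)
  finally show ?thesis by simp
qed

lemma continuous_on_monomial: "continuous_on S (\<lambda>u. monomial u j)"
  unfolding monomial_def by (intro continuous_intros)

lemma gen_fun_term_bound:
  "u \<in> {0..1} \<Longrightarrow> norm (c j * monomial u j) \<le> \<bar>c j\<bar>"
  using monomial_le_one[of u j] monomial_nonneg[of u j]
  by (auto simp: abs_mult mult_left_le)

lemma summable_on_abs: "c summable_on A \<Longrightarrow> (\<lambda>j. \<bar>c j :: real\<bar>) summable_on A"
  using summable_on_iff_abs_summable_on_real[of c A] by simp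

lemma gen_fun_has_sum:
  fixes c :: "nat^'n::finite \<Rightarrow> real"
  assumes "c summable_on UNIV" "u \<in> {0..1}"
  shows "((\<lambda>j. c j * monomial u j) has_sum gen_fun c u) UNIV"
proof -
  have "(\<lambda>j. norm (c j * monomial u j)) summable_on UNIV"
    by (rule summable_on_comparison_test[OF summable_on_abs[OF assms(1)]])
       (rule gen_fun_term_bound[OF assms(2)], simp)
  then have "(\<lambda>j. c j * monomial u j) summable_on UNIV" by (rule abs_summable_summable)
  then show ?thesis unfolding gen_fun_def by (rule has_sum_infsum)
qed

lemma continuous_on_gen_fun:
  fixes c :: "nat^'n::finite \<Rightarrow> real"
  assumes "c summable_on UNIV"
  shows "continuous_on {0..1} (gen_fun c)"
proof -
  have "uniform_limit {0..1} (\<lambda>X u. \<Sum>j\<in>X. c j * monomial u j)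
      (\<lambda>u. \<Sum>\<^sub>\<infinity>j\<in>UNIV. c j * monomial u j) (finite_subsets_at_top UNIV)"
    by (rule Weierstrass_m_test_general[OF _ summable_on_abs[OF assms]]) (rule gen_fun_term_bound)
  moreover have "\<forall>\<^sub>F X in finite_subsets_at_top UNIV.
      continuous_on {0..1} (\<lambda>u :: real^'n. \<Sum>j\<in>X. c j * monomial u j)"
    by (intro always_eventually allI continuous_intros continuous_on_monomial)
  ultimately show ?thesis
    unfolding gen_fun_def by (intro uniform_limit_theorem) auto
qed

lemma has_sum_sum:
  fixes f :: "'i \<Rightarrow> 'b \<Rightarrow> real"
  assumes "finite I" "\<And>i. i \<in> I \<Longrightarrow> (f i has_sum S i) A"
  shows "((\<lambda>x. \<Sum>i\<in>I. f i x) has_sum (\<Sum>i\<in>I. S i)) A"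
  using assms by (induction I rule: finite_induct) (auto intro: has_sum_add)

lemma has_sum_single: "((\<lambda>j. if j = x then y else 0) has_sum (y :: real)) UNIV"
proof -
  have "((\<lambda>j. if j = x then y else 0) has_sum y) {x}"
    using has_sum_finite[of "{x}" "\<lambda>j. if j = x then y else 0"] by simp
  then show ?thesis by (rule has_sum_cong_neutral[THEN iffD1, rotated -1]) auto
qed

lemma gen_fun_mono:
  fixes c :: "nat^'n::finite \<Rightarrow> real"
  assumes "c summable_on UNIV" "\<And>j. 0 \<le> c j" "0 \<le> u" "u \<le> v" "v \<le> 1"
  shows "gen_fun c u \<le> gen_fun c v"
proof -
  have "0 \<le> v" "u \<le> 1" using order_trans[OF assms(3,4)] order_trans[OF assms(4,5)] by auto
  then show ?thesis using assms
    by (intro has_sum_mono[OF gen_fun_has_sum gen_fun_has_sum] mult_left_mono monomial_mono) auto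
qed

lemma gen_fun_nonneg:
  fixes c :: "nat^'n::finite \<Rightarrow> real"
  assumes "c summable_on UNIV" "\<And>j. 0 \<le> c j" "u \<in> {0..1}"
  shows "0 \<le> gen_fun c u"
  using assms by (intro has_sum_nonneg[OF gen_fun_has_sum] mult_nonneg_nonneg monomial_nonneg) auto

lemma gen_fun_zero:
  fixes c :: "nat^'n::finite \<Rightarrow> real"
  shows "gen_fun c 0 = c 0"
proof -
  have "gen_fun c 0 = (\<Sum>\<^sub>\<infinity>j\<in>{0}. c j * monomial 0 j)"
    unfolding gen_fun_def by (rule infsum_cong_neutral) (auto simp: monomial_zero)
  then show ?thesis by simp
qed

text \<open>The quotients \<open>(x ^ p - 1) / (x - 1)\<close> are nonnegative, at most
  \<open>p\<close>, and tend to \<open>p\<close> at 1. The limit of finite partial sums gives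
  summability and one inequality, the termwise bound by \<open>p\<close> the other. It identifies
  Jacobian entries, defined as derivatives, with sums of coefficients.\<close>

lemma power_series_left_derivative_has_sum:
  fixes c :: "'b \<Rightarrow> real" and p :: "'b \<Rightarrow> nat"
  assumes c: "c summable_on UNIV" "\<And>j. 0 \<le> c j"
    and sum: "\<And>x. x \<in> {0..1} \<Longrightarrow> ((\<lambda>j. c j * x ^ p j) has_sum f x) UNIV"
    and deriv: "(f has_real_derivative D) (at 1 within {0..1})"
  shows "((\<lambda>j. c j * real (p j)) has_sum D) UNIV"
proof -
  let ?F = "at (1::real) within {0..1}"
  have nontriv: "?F \<noteq> bot" by (simp add: at_within_Icc_at_left)
  have ev: "\<forall>\<^sub>F x in ?F. 0 \<le> x \<and> x < 1"
    by (auto simp: eventually_at_filter)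
  have lim: "((\<lambda>x. (f x - f 1) / (x - 1)) \<longlongrightarrow> D) ?F"
    using deriv by (simp add: has_field_derivative_iff)
  have quot: "((\<lambda>j. c j * ((x ^ p j - 1) / (x - 1))) has_sum (f x - f 1) / (x - 1)) UNIV"
    if "0 \<le> x" "x < 1" for x
  proof -
    have "((\<lambda>j. - (c j * 1 ^ p j)) has_sum - f 1) UNIV"
      using sum[of 1] by (simp add: has_sum_uminus)
    then have "((\<lambda>j. c j * x ^ p j + - (c j * 1 ^ p j)) has_sum f x + - f 1) UNIV"
      using that by (intro has_sum_add sum) auto
    from has_sum_cmult_left[OF this, of "1 / (x - 1)"]
    have "((\<lambda>j. (c j * x ^ p j + - (c j * 1 ^ p j)) * (1 / (x - 1))) has_sum
      (f x + - f 1) * (1 / (x - 1))) UNIV" .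
    moreover have "(c j * x ^ p j + - (c j * 1 ^ p j)) * (1 / (x - 1)) = c j * ((x ^ p j - 1) / (x - 1))"
      for j by (simp add: divide_inverse left_diff_distrib right_diff_distrib)
    moreover have "(f x + - f 1) * (1 / (x - 1)) = (f x - f 1) / (x - 1)" by simp
    ultimately show ?thesis by (simp only:)
  qed
  have pos: "0 \<le> c j * ((x ^ p j - 1) / (x - 1))" if "0 \<le> x" "x < 1" for x j
    using that c(2)[of j] by (intro mult_nonneg_nonneg divide_nonpos_nonpos) (auto simp: power_le_one)
  have le: "(\<Sum>j\<in>F. c j * real (p j)) \<le> D" if F: "finite F" for F
  proof (rule tendsto_le[OF nontriv lim])
    have "((\<lambda>x. x ^ p j) has_real_derivative real (p j)) ?F" for j
      by (auto intro!: derivative_eq_intros)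
    then show "((\<lambda>x. \<Sum>j\<in>F. c j * ((x ^ p j - 1) / (x - 1))) \<longlongrightarrow> (\<Sum>j\<in>F. c j * real (p j))) ?F"
      by (intro tendsto_sum tendsto_mult_left) (simp add: has_field_derivative_iff)
    show "\<forall>\<^sub>F x in ?F. (\<Sum>j\<in>F. c j * ((x ^ p j - 1) / (x - 1))) \<le> (f x - f 1) / (x - 1)"
      using ev by eventually_elim (rule finite_sum_le_has_sum[OF quot _ _ pos], use F in auto)
  qed
  have summ: "(\<lambda>j. c j * real (p j)) summable_on UNIV"
    by (rule nonneg_bdd_above_summable_on) (use c(2) le in \<open>auto intro!: bdd_aboveI2[of _ _ D]\<close>)
  then obtain S where S: "((\<lambda>j. c j * real (p j)) has_sum S) UNIV" by (auto simp: summable_on_def)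
  have "S \<le> D" by (rule has_sum_le_finite_sums[OF S]) (use le in auto)
  moreover have "D \<le> S"
  proof (rule tendsto_upperbound[OF lim _ nontriv])
    show "\<forall>\<^sub>F x in ?F. (f x - f 1) / (x - 1) \<le> S"
      using ev
    proof eventually_elim
      case (elim x)
      show ?case
      proof (rule has_sum_mono[OF quot S])
        fix j
        have "norm (x ^ p j - 1 ^ p j) \<le> real (p j) * norm (x - 1)"
          by (rule norm_power_diff) (use elim in auto)
        then have "1 - x ^ p j \<le> real (p j) * (1 - x)"
          using elim by simp
        then have "(x ^ p j - 1) / (x - 1) \<le> real (p j)"
          using elim by (simp add: divide_simps) (simp add: algebra_simps)
        then show "c j * ((x ^ p j - 1) / (x - 1)) \<le> c j * real (p j)"
          using c(2) by (rule mult_left_mono)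
      qed (use elim in auto)
    qed
  qed
  ultimately show ?thesis using S by simp
qed

section \<open>Branching coefficients\<close>

locale branching =
  fixes a :: "nat^'n::finite \<Rightarrow> real" and b :: "'n \<Rightarrow> nat^'n \<Rightarrow> real"
  assumes coeffs: "branching_immigration_coeffs a b"
begin

text \<open>Each coefficient family has one negative member. With it set to 0 the generating
  functions become monotone in \<open>u\<close>, and the removed part is an explicit constant or
  linear term.\<close>

definition "immigration = a(0 := 0)"
definition "offspring k = (b k)(axis k 1 := 0)"
definition "\<alpha> = - a 0"
definition "\<beta> k = - b k (axis k 1)"

lemma \<alpha>_pos: "0 < \<alpha>" and \<beta>_pos: "0 < \<beta> k"
  using coeffs by (auto simp: branching_immigration_coeffs_def \<alpha>_def \<beta>_def)

lemma immigration_nonneg: "0 \<le> immigration j"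
  using coeffs by (auto simp: branching_immigration_coeffs_def immigration_def)

lemma offspring_nonneg: "0 \<le> offspring k j"
  using coeffs by (auto simp: branching_immigration_coeffs_def offspring_def)

lemma immigration_has_sum: "(immigration has_sum \<alpha>) UNIV"
proof -
  have "(a has_sum \<alpha>) (- {0})"
    using coeffs by (simp add: branching_immigration_coeffs_def \<alpha>_def)
  then show ?thesis
    by (rule has_sum_cong_neutral[THEN iffD1, rotated -1]) (auto simp: immigration_def)
qed

lemma offspring_has_sum: "(offspring k has_sum \<beta> k) UNIV"
proof -
  have "(b k has_sum \<beta> k) (- {axis k 1})"
    using coeffs by (simp add: branching_immigration_coeffs_def \<beta>_def)
  then show ?thesis
    by (rule has_sum_cong_neutral[THEN iffD1, rotated -1]) (auto simp: offspring_def)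
qed

lemmas immigration_summable = has_sum_imp_summable[OF immigration_has_sum]
lemmas offspring_summable = has_sum_imp_summable[OF offspring_has_sum]

lemma gen_fun_immigration:
  assumes "u \<in> {0..1}"
  shows "((\<lambda>j. a j * monomial u j) has_sum gen_fun a u) UNIV"
    "gen_fun a u = gen_fun immigration u - \<alpha>"
proof -
  have "((\<lambda>j. (if j = 0 then - \<alpha> else 0)) has_sum - \<alpha>) UNIV"
    by (rule has_sum_single)
  from has_sum_add[OF gen_fun_has_sum[OF immigration_summable assms] this]
  have "((\<lambda>j. a j * monomial u j) has_sum gen_fun immigration u - \<alpha>) UNIV"
    by (subst (asm) has_sum_cong[where g = "\<lambda>j. a j * monomial u j"])
       (auto simp: immigration_def \<alpha>_def)
  then show "gen_fun a u = gen_fun immigration u - \<alpha>"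
    "((\<lambda>j. a j * monomial u j) has_sum gen_fun a u) UNIV"
    unfolding gen_fun_def by (auto simp: has_sum_iff)
qed

lemma gen_fun_offspring:
  assumes "u \<in> {0..1}"
  shows "((\<lambda>j. b k j * monomial u j) has_sum gen_fun (b k) u) UNIV"
    "gen_fun (b k) u = gen_fun (offspring k) u - \<beta> k * u $ k"
proof -
  have "((\<lambda>j. (if j = axis k 1 then - \<beta> k * u $ k else 0)) has_sum - \<beta> k * u $ k) UNIV"
    by (rule has_sum_single)
  from has_sum_add[OF gen_fun_has_sum[OF offspring_summable[of k] assms] this]
  have "((\<lambda>j. b k j * monomial u j) has_sum gen_fun (offspring k) u - \<beta> k * u $ k) UNIV"
    by (subst (asm) has_sum_cong[where g = "\<lambda>j. b k j * monomial u j"])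
       (auto simp: offspring_def \<beta>_def)
  then show "gen_fun (b k) u = gen_fun (offspring k) u - \<beta> k * u $ k"
    "((\<lambda>j. b k j * monomial u j) has_sum gen_fun (b k) u) UNIV"
    unfolding gen_fun_def by (auto simp: has_sum_iff)
qed

lemma gen_fun_immigration_le:
  assumes "0 \<le> u" "u \<le> v" "v \<le> 1"
  shows "gen_fun a u \<le> gen_fun a v"
proof -
  have "0 \<le> v" "u \<le> 1" using order_trans[OF assms(1,2)] order_trans[OF assms(2,3)] by auto
  then show ?thesis
    using assms gen_fun_mono[OF immigration_summable immigration_nonneg assms]
    by (simp add: gen_fun_immigration)
qed

lemma gen_fun_immigration_one: "gen_fun a 1 = 0"
  using immigration_has_sum gen_fun_immigration(2)[of 1] by (simp add: gen_fun_def[of immigration] has_sum_iff)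

lemma gen_fun_offspring_one: "gen_fun (offspring k) 1 = \<beta> k"
  using offspring_has_sum by (simp add: gen_fun_def has_sum_iff)

lemma gen_fun_branching_one: "gen_fun (b k) 1 = 0"
  by (simp add: gen_fun_offspring(2) gen_fun_offspring_one)

lemma continuous_on_gen_fun_coeffs:
  "continuous_on {0..1} (gen_fun a)" "continuous_on {0..1} (gen_fun (b k))"
proof -
  have "continuous_on {0..1} (\<lambda>u. gen_fun immigration u - \<alpha>)"
    by (intro continuous_intros continuous_on_gen_fun immigration_summable)
  then show "continuous_on {0..1} (gen_fun a)"
    by (rule continuous_on_cong[THEN iffD2, rotated 2]) (auto simp: gen_fun_immigration)
  have "continuous_on {0..1} (\<lambda>u. gen_fun (offspring k) u - \<beta> k * u $ k)"
    by (intro continuous_intros continuous_on_gen_fun offspring_summable)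
  then show "continuous_on {0..1} (gen_fun (b k))"
    by (rule continuous_on_cong[THEN iffD2, rotated 2]) (auto simp: gen_fun_offspring)
qed

lemma gen_fun_branching_le:
  assumes "u \<in> {0..1}"
  shows "gen_fun (b k) u \<le> \<beta> k * (1 - u $ k)"
proof -
  have "gen_fun (offspring k) u \<le> gen_fun (offspring k) 1"
    using assms by (intro gen_fun_mono offspring_summable offspring_nonneg) auto
  then show ?thesis
    by (simp add: gen_fun_offspring(2)[OF assms] gen_fun_offspring_one right_diff_distrib)
qed

lemma immigration_pos: "\<exists>j. j \<noteq> 0 \<and> 0 < a j"
proof (rule ccontr)
  assume "\<not> ?thesis"
  then have "immigration j = 0" for j
    using immigration_nonneg[of j] by (auto simp: immigration_def not_less split: if_splits)
  then have "immigration = (\<lambda>_. 0)" by (rule ext)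
  then have "(immigration has_sum 0) UNIV" by simp
  then show False using has_sum_unique[OF immigration_has_sum] \<alpha>_pos by force
qed

text \<open>A Knaster-Tarski argument for the monotone map
  \<open>u \<mapsto> (gen_fun (offspring k) u / \<beta> k)_k\<close>: roots are its fixed points,
  and \<open>u\<close> with all \<open>B_k(u) \<le> 0\<close> is mapped below itself. The
  componentwise infimum \<open>z\<close> of all such points is again one, hence so is its image
  \<open>Tz\<close>, and minimality makes \<open>z\<close> a root below \<open>u\<close>.\<close>

lemma smallest_root_le:
  assumes q: "smallest_root b q" and u: "u \<in> {0..1}" "\<And>k. gen_fun (b k) u \<le> 0"
  shows "q \<le> u"
proof -
  define S where "S = {z \<in> {0..1}. \<forall>k. gen_fun (offspring k) z \<le> \<beta> k * z $ k}"
  have uS: "u \<in> S" using u by (auto simp: S_def gen_fun_offspring)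
  define z where "z = (\<chi> k. INF w\<in>S. w $ k)"
  have bdd: "bdd_below ((\<lambda>w. w $ k) ` S)" for k
    by (rule bdd_belowI2[of _ 0]) (auto simp: S_def less_eq_vec_def)
  have z_le: "z \<le> w" if "w \<in> S" for w
    using that by (auto simp: z_def less_eq_vec_def intro!: cINF_lower bdd)
  have z_ge: "x \<le> z $ k" if "\<And>w. w \<in> S \<Longrightarrow> x \<le> w $ k" for x k
    using that uS by (auto simp: z_def intro!: cINF_greatest)
  have z0: "0 \<le> z" using z_ge by (auto simp: less_eq_vec_def S_def)
  have z1: "z \<in> {0..1}" using z0 z_le[OF uS] u(1) by auto
  define Tz where "Tz = (\<chi> k. gen_fun (offspring k) z / \<beta> k)"
  have "Tz $ k \<le> z $ k" for k
  proof (rule z_ge)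
    fix w assume w: "w \<in> S"
    have "gen_fun (offspring k) z \<le> gen_fun (offspring k) w"
      using z0 z_le[OF w] w
      by (intro gen_fun_mono offspring_summable offspring_nonneg) (auto simp: S_def)
    also have "\<dots> \<le> \<beta> k * w $ k" using w by (auto simp: S_def)
    finally show "Tz $ k \<le> w $ k" using \<beta>_pos[of k] by (simp add: Tz_def field_simps)
  qed
  then have Tz_le: "Tz \<le> z" by (simp add: less_eq_vec_def)
  have Tz0: "0 \<le> Tz"
    using z1 by (auto simp: less_eq_vec_def Tz_def less_imp_le[OF \<beta>_pos]
        intro!: divide_nonneg_nonneg gen_fun_nonneg offspring_summable offspring_nonneg)
  have "gen_fun (offspring k) Tz \<le> \<beta> k * Tz $ k" for k
  proof -
    have "gen_fun (offspring k) Tz \<le> gen_fun (offspring k) z"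
      using Tz0 Tz_le z1 by (intro gen_fun_mono offspring_summable offspring_nonneg) auto
    then show ?thesis using \<beta>_pos[of k] by (simp add: Tz_def)
  qed
  then have "Tz \<in> S" using Tz0 Tz_le z1 by (auto simp: S_def)
  then have "z = Tz" using z_le Tz_le by (simp add: antisym)
  then have "z $ k = gen_fun (offspring k) z / \<beta> k" for k by (metis Tz_def vec_lambda_beta)
  then have "gen_fun (b k) z = 0" for k
    using z1 \<beta>_pos[of k] by (simp add: gen_fun_offspring field_simps)
  then have "q \<le> z" using q z1 by (simp add: smallest_root_def)
  then show ?thesis using z_le[OF uS] by simp
qed

end

section \<open>The smallest root and the maximal eigenvalue\<close>

locale regular_branching = branching a b
  for a :: "nat^'n::finite \<Rightarrow> real" and b :: "'n \<Rightarrow> nat^'n \<Rightarrow> real" +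
  fixes e :: 'n and q :: "real^'n"
  assumes means: "finite_means b"
    and regular: "positively_regular (G_matrix b 1)"
    and death: "gen_fun (b e) 0 > 0"
    and root: "smallest_root b q"
begin

text \<open>The derivative at 1 of the series \<open>offspring k\<close>, that is, the rate at which
  one individual of type \<open>k\<close> produces individuals of type \<open>l\<close>. Adding
  \<open>\<beta> k\<close> undoes the linear term of \<open>B_k\<close>.\<close>

definition "mean k l = jacobian b 1 $ k $ l + (if k = l then \<beta> k else 0)"

lemma mean_has_sum: "((\<lambda>j. offspring k j * real (j $ l)) has_sum mean k l) UNIV"
proof -
  define v :: "real \<Rightarrow> real^'n" where "v x = (\<chi> i. if i = l then x else 1)" for x
  have mon: "monomial (v x) j = x ^ (j $ l)" for x j
  proof -
    have "monomial (v x) j = (\<Prod>i\<in>UNIV. if i = l then x ^ (j $ i) else 1)"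
      unfolding monomial_def v_def by (rule prod.cong) auto
    then show ?thesis by simp
  qed
  have v: "v x \<in> {0..1}" if "x \<in> {0..1}" for x
    using that by (auto simp: v_def less_eq_vec_def)
  have "((\<lambda>x. gen_fun (b k) (v x)) has_vector_derivative jacobian b 1 $ k $ l) (at 1 within {0..1})"
    using means unfolding finite_means_def jacobian_def slice_def v_def
    by (auto simp: vector_derivative_works cong: if_cong)
  then have d: "((\<lambda>x. gen_fun (b k) (v x)) has_real_derivative jacobian b 1 $ k $ l) (at 1 within {0..1})"
    by (simp add: has_real_derivative_iff_has_vector_derivative)
  have "((\<lambda>x. v x $ k) has_real_derivative (if k = l then 1 else 0)) (at 1 within {0..1})"
    by (auto simp: v_def)
  from DERIV_add[OF d DERIV_cmult[OF this, of "\<beta> k"]]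
  have "((\<lambda>x. gen_fun (b k) (v x) + \<beta> k * v x $ k) has_real_derivative mean k l) (at 1 within {0..1})"
    by (simp add: mean_def if_distrib cong: if_cong)
  then have "((\<lambda>x. gen_fun (offspring k) (v x)) has_real_derivative mean k l) (at 1 within {0..1})"
    by (rule has_field_derivative_transform_within[of _ _ _ _ 1])
       (use v in \<open>auto simp: gen_fun_offspring\<close>)
  moreover have "((\<lambda>j. offspring k j * x ^ (j $ l)) has_sum gen_fun (offspring k) (v x)) UNIV"
    if "x \<in> {0..1}" for x
    using gen_fun_has_sum[OF offspring_summable[of k] v[OF that]] by (simp add: mon)
  ultimately show ?thesis
    by (intro power_series_left_derivative_has_sum[OF offspring_summable offspring_nonneg])
qed

lemma mean_nonneg: "0 \<le> mean k l"
  using mean_has_sum by (rule has_sum_nonneg) (simp add: offspring_nonneg)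

lemma weighted_mean_has_sum:
  "((\<lambda>j. offspring k j * (\<Sum>l\<in>UNIV. real (j $ l) * w l)) has_sum (\<Sum>l\<in>UNIV. mean k l * w l)) UNIV"
proof -
  have "((\<lambda>j. \<Sum>l\<in>UNIV. offspring k j * real (j $ l) * w l) has_sum (\<Sum>l\<in>UNIV. mean k l * w l)) UNIV"
    by (intro has_sum_sum has_sum_cmult_left mean_has_sum finite)
  then show ?thesis by (simp add: sum_distrib_left mult.assoc)
qed

lemma gen_fun_offspring_lipschitz:
  assumes "u \<in> {0..1}" "v \<in> {0..1}"
  shows "gen_fun (offspring k) u - gen_fun (offspring k) v \<le> (\<Sum>l\<in>UNIV. mean k l * \<bar>u $ l - v $ l\<bar>)"
proof -
  have "((\<lambda>j. - (offspring k j * monomial v j)) has_sum - gen_fun (offspring k) v) UNIV"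
    using gen_fun_has_sum[OF offspring_summable[of k] assms(2)] by (simp add: has_sum_uminus)
  from has_sum_add[OF gen_fun_has_sum[OF offspring_summable[of k] assms(1)] this]
  have "gen_fun (offspring k) u + - gen_fun (offspring k) v \<le> (\<Sum>l\<in>UNIV. mean k l * \<bar>u $ l - v $ l\<bar>)"
  proof (rule has_sum_mono[OF _ weighted_mean_has_sum])
    fix j
    have "monomial u j - monomial v j \<le> (\<Sum>l\<in>UNIV. real (j $ l) * \<bar>u $ l - v $ l\<bar>)"
      using monomial_diff_le[OF assms, of j] by simp
    from mult_left_mono[OF this offspring_nonneg[of k j]]
    show "offspring k j * monomial u j + - (offspring k j * monomial v j)
        \<le> offspring k j * (\<Sum>l\<in>UNIV. real (j $ l) * \<bar>u $ l - v $ l\<bar>)"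
      by (simp add: right_diff_distrib)
  qed
  then show ?thesis by simp
qed

lemma jacobian_mult: "(jacobian b 1 *v x) $ k = (\<Sum>l\<in>UNIV. mean k l * x $ l) - \<beta> k * x $ k"
proof -
  have "(\<Sum>l\<in>UNIV. mean k l * x $ l) =
     (\<Sum>l\<in>UNIV. jacobian b 1 $ k $ l * x $ l + (if k = l then \<beta> k * x $ l else 0))"
    by (rule sum.cong) (auto simp: mean_def distrib_right)
  then show ?thesis by (simp add: sum.distrib matrix_vector_mult_def)
qed

lemma shifted_jacobian:
  obtains c where "\<And>k l. 0 \<le> (jacobian b 1 + c *\<^sub>R mat 1) $ k $ l"
    "positively_regular (jacobian b 1 + c *\<^sub>R mat 1)"
proof -
  \<comment> \<open>A common upper bound of the rates: it lifts the diagonal to at least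
    \<open>mean k k\<close>.\<close>
  define c where "c = (\<Sum>k\<in>UNIV. \<beta> k)"
  have c: "\<beta> k \<le> c" for k
    unfolding c_def by (rule member_le_sum) (auto simp: \<beta>_pos less_imp_le)
  have ge: "mean k l \<le> (jacobian b 1 + c *\<^sub>R mat 1) $ k $ l" for k l
    using c by (auto simp: mean_def mat_def)
  \<comment> \<open>The entries of \<open>G_matrix\<close> are \<open>mean k l / \<beta> k\<close>;
    the smallest rate compensates the row scaling uniformly.\<close>
  define d where "d = Min (range \<beta>)"
  have d: "0 < d" "d \<le> \<beta> k" for k
    unfolding d_def using \<beta>_pos by (auto simp: Min_gr_iff)
  have G: "G_matrix b 1 $ k $ l = mean k l / \<beta> k" for k l
    using \<beta>_pos[of k] by (auto simp: G_matrix_def mean_def \<beta>_def field_simps)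
  have "positively_regular (jacobian b 1 + c *\<^sub>R mat 1)"
  proof (rule positively_regular_mono[OF regular d(1)])
    fix k l
    show "0 \<le> G_matrix b 1 $ k $ l" using mean_nonneg \<beta>_pos[of k] by (simp add: G)
    then have "d * G_matrix b 1 $ k $ l \<le> \<beta> k * G_matrix b 1 $ k $ l"
      using d(2) by (rule mult_right_mono[rotated])
    also have "\<dots> = mean k l" using \<beta>_pos[of k] by (simp add: G)
    finally show "d * G_matrix b 1 $ k $ l \<le> (jacobian b 1 + c *\<^sub>R mat 1) $ k $ l"
      using ge[of k l] by simp
  qed
  then show thesis using that[of c] ge mean_nonneg order_trans by blast
qed

lemma q_cube: "q \<in> {0..1}" and q_root: "gen_fun (b k) q = 0"
  using root by (auto simp: smallest_root_def)

lemma q_bounds: "0 \<le> q $ k" "q $ k \<le> 1"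
  using q_cube by (auto simp: less_eq_vec_def)

text \<open>Leave the corner 1 along the positive right eigenvector \<open>x\<close>. To first order
  \<open>B_k (1 - t x)\<close> is \<open>- t * rho b 1 * x $ k < 0\<close>, so
  \<open>smallest_root_le\<close> puts \<open>q\<close> below \<open>1 - t x\<close>. Second moments
  may be infinite, so the expansion is made on a finite set of indices only.\<close>

lemma supercritical_root:
  assumes "0 < rho b 1"
  shows "q $ k < 1"
proof -
  obtain c where c: "\<And>k l. 0 \<le> (jacobian b 1 + c *\<^sub>R mat 1) $ k $ l"
    "positively_regular (jacobian b 1 + c *\<^sub>R mat 1)" using shifted_jacobian by blast
  obtain x where x: "\<And>i. 0 < x $ i" "jacobian b 1 *v x = rho b 1 *\<^sub>R x"
    using perron_max_eigenvalue[OF c] unfolding rho_def by metis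
  define s where "s j = (\<Sum>l\<in>UNIV. real (j $ l) * x $ l)" for j :: "nat^'n"
  define v where "v t = (\<chi> l. 1 - t * x $ l)" for t :: real
  \<comment> \<open>The exponential majorant sees \<open>j\<close> only through \<open>s j\<close>,
    so that the limit in \<open>t\<close> is elementary for each index.\<close>
  have mon: "monomial (v t) j \<le> exp (- t * s j)" if "v t \<in> {0..1}" for t j
  proof -
    have "monomial (v t) j \<le> (\<Prod>l\<in>UNIV. exp (- (t * x $ l)) ^ (j $ l))"
      unfolding monomial_def
    proof (intro prod_mono conjI power_mono zero_le_power)
      fix l
      show "0 \<le> v t $ l" using that by (auto simp: less_eq_vec_def)
      then show "0 \<le> v t $ l" .
      show "v t $ l \<le> exp (- (t * x $ l))"
        using exp_ge_add_one_self[of "- (t * x $ l)"] by (simp add: v_def)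
    qed
    also have "\<dots> = exp (\<Sum>l\<in>UNIV. real (j $ l) * - (t * x $ l))"
      by (simp only: exp_of_nat_mult[symmetric] exp_sum[OF finite])
    also have "(\<Sum>l\<in>UNIV. real (j $ l) * - (t * x $ l)) = - t * s j"
      by (simp add: s_def sum_distrib_left ac_simps sum_negf)
    finally show ?thesis .
  qed
  have cube: "\<forall>\<^sub>F t in at_right 0. v t \<in> {0..1}"
  proof -
    have "\<forall>\<^sub>F t in at_right 0. \<forall>l. t * x $ l < 1"
    proof (rule eventually_all_finite)
      fix l
      have "((\<lambda>t. t * x $ l) \<longlongrightarrow> 0 * x $ l) (at_right 0)" by (intro tendsto_intros)
      then show "\<forall>\<^sub>F t in at_right 0. t * x $ l < 1"
        by (rule order_tendstoD) simp
    qed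
    then show ?thesis
      using eventually_at_right_less[of 0]
      by eventually_elim (use x(1) in \<open>auto simp: v_def less_eq_vec_def less_imp_le\<close>)
  qed
  have neg: "\<forall>\<^sub>F t in at_right 0. gen_fun (b k) (v t) \<le> 0" for k
  proof -
    have sum: "((\<lambda>j. offspring k j * s j) has_sum (rho b 1 + \<beta> k) * x $ k) UNIV"
    proof -
      have "(\<Sum>l\<in>UNIV. mean k l * x $ l) = (rho b 1 + \<beta> k) * x $ k"
        using jacobian_mult[of x k] x(2) by (simp add: algebra_simps)
      then show ?thesis using weighted_mean_has_sum[of k "\<lambda>l. x $ l"] by (simp add: s_def)
    qed
    \<comment> \<open>The full series is \<open>(rho b 1 + \<beta> k) * x $ k\<close>. The positive
      eigenvalue leaves room to truncate it and still exceed \<open>\<beta> k * x $ k\<close>, the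
      slope of the linear term of \<open>B_k\<close>.\<close>
    have "\<exists>F. finite F \<and> \<beta> k * x $ k < (\<Sum>j\<in>F. offspring k j * s j)"
    proof (rule ccontr)
      assume "\<not> ?thesis"
      then have "(rho b 1 + \<beta> k) * x $ k \<le> \<beta> k * x $ k"
        by (intro has_sum_le_finite_sums[OF sum]) (auto simp: not_less)
      then show False using mult_pos_pos[OF assms x(1)[of k]] by (simp add: distrib_right)
    qed
    then obtain F where F: "finite F" "\<beta> k * x $ k < (\<Sum>j\<in>F. offspring k j * s j)" by blast
    have "((\<lambda>t. (\<Sum>j\<in>F. offspring k j * ((exp (- t * s j) - 1) / t))) \<longlongrightarrow>
        (\<Sum>j\<in>F. offspring k j * (- s j))) (at_right 0)"
    proof (intro tendsto_sum tendsto_mult_left)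
      fix j
      have "((\<lambda>t. exp (- t * s j)) has_real_derivative - s j) (at 0 within {0<..})"
        by (auto intro!: derivative_eq_intros)
      then show "((\<lambda>t. (exp (- t * s j) - 1) / t) \<longlongrightarrow> - s j) (at_right 0)"
        by (simp add: has_field_derivative_iff)
    qed
    moreover have "(\<Sum>j\<in>F. offspring k j * (- s j)) < - (\<beta> k * x $ k)"
      using F(2) by (simp add: sum_negf)
    ultimately have "\<forall>\<^sub>F t in at_right 0.
        (\<Sum>j\<in>F. offspring k j * ((exp (- t * s j) - 1) / t)) < - (\<beta> k * x $ k)"
      by (rule order_tendstoD)
    then show ?thesis using cube eventually_at_right_less[of 0]
    proof eventually_elim
      case (elim t)
      have "gen_fun (offspring k) (v t) - \<beta> k \<le> (\<Sum>j\<in>F. offspring k j * (exp (- t * s j) - 1))"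
      proof -
        have "((\<lambda>j. - (offspring k j * monomial (v t) j)) has_sum - gen_fun (offspring k) (v t)) UNIV"
          using gen_fun_has_sum[OF offspring_summable[of k] elim(2)] by (simp add: has_sum_uminus)
        from has_sum_add[OF offspring_has_sum[of k] this]
        have "(\<Sum>j\<in>F. offspring k j + - (offspring k j * monomial (v t) j)) \<le> \<beta> k + - gen_fun (offspring k) (v t)"
        proof (rule finite_sum_le_has_sum)
          fix j
          show "0 \<le> offspring k j + - (offspring k j * monomial (v t) j)"
            using mult_left_mono[OF monomial_le_one[OF elim(2), of j] offspring_nonneg[of k j]] by simp
        qed (use F in auto)
        moreover have "(\<Sum>j\<in>F. offspring k j * monomial (v t) j) \<le> (\<Sum>j\<in>F. offspring k j * exp (- t * s j))"
          by (intro sum_mono mult_left_mono mon elim offspring_nonneg)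
        ultimately show ?thesis by (simp add: right_diff_distrib sum_subtractf)
      qed
      also have "\<dots> = t * (\<Sum>j\<in>F. offspring k j * ((exp (- t * s j) - 1) / t))"
        using elim(3) by (simp add: sum_distrib_left)
      also have "\<dots> \<le> t * - (\<beta> k * x $ k)"
        using elim(1,3) by (intro mult_left_mono) auto
      finally show ?case
        by (simp add: gen_fun_offspring(2)[OF elim(2)]) (simp add: v_def algebra_simps)
    qed
  qed
  have "\<forall>\<^sub>F t in at_right 0. \<forall>k. gen_fun (b k) (v t) \<le> 0"
    using neg by (rule eventually_all_finite)
  then have "\<forall>\<^sub>F t in at_right (0::real). v t \<in> {0..1} \<and> (\<forall>k. gen_fun (b k) (v t) \<le> 0) \<and> 0 < t"
    using cube eventually_at_right_less[of 0] by eventually_elim auto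
  then obtain t where t: "v t \<in> {0..1}" "\<And>k. gen_fun (b k) (v t) \<le> 0" "0 < t"
    using eventually_happens'[OF trivial_limit_at_right_real] by blast
  have "q \<le> v t" by (rule smallest_root_le[OF root t(1,2)])
  then have "q $ k \<le> v t $ k" by (simp add: less_eq_vec_def)
  also have "\<dots> < 1" using t(3) x(1) by (simp add: v_def)
  finally show ?thesis .
qed

text \<open>\<open>d\<close> is the gap in the Bernoulli-type inequality
  \<open>1 - u^j \<le> sum_l j_l (1 - u_l)\<close>. The product term makes the gap strict as soon as
  \<open>j\<close> splits into two nonzero indices and all \<open>u_l < 1\<close>.\<close>

lemma defect_add:
  fixes j i :: "nat^'n" and u :: "real^'n"
  defines "d \<equiv> \<lambda>j. (\<Sum>l\<in>UNIV. real (j $ l) * (1 - u $ l)) - (1 - monomial u j)"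
  shows "d (i + j) = d i + d j + (1 - monomial u i) * (1 - monomial u j)"
  by (simp add: d_def monomial_add algebra_simps sum.distrib sum_subtractf)

text \<open>With \<open>v = 1 - q\<close> the Lipschitz bound gives
  \<open>jacobian b 1 *v v \<ge> 0\<close>, while pairing with the positive left eigenvector gives
  \<open>rho b 1 * (y \<bullet> v) \<le> 0\<close>. So the vector is 0, the bound is an equality
  term by term, and all \<open>B_k\<close> are affine with critical Jacobian. That degenerate case
  is incompatible with \<open>B_e(0) > 0\<close>.\<close>

lemma subcritical_root:
  assumes "rho b 1 \<le> 0"
  shows "q = 1"
proof (rule ccontr)
  assume "q \<noteq> 1"
  obtain c where c: "\<And>k l. 0 \<le> (jacobian b 1 + c *\<^sub>R mat 1) $ k $ l"
    "positively_regular (jacobian b 1 + c *\<^sub>R mat 1)" using shifted_jacobian by blast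
  obtain y where y: "\<And>i. 0 < y $ i" "transpose (jacobian b 1) *v y = rho b 1 *\<^sub>R y"
    using perron_max_eigenvalue[OF c] unfolding rho_def by metis
  define v where "v = 1 - q"
  have v: "0 \<le> v" "v \<noteq> 0" "\<And>k. 0 \<le> v $ k" using \<open>q \<noteq> 1\<close> q_bounds by (auto simp: v_def less_eq_vec_def)
  have off: "gen_fun (offspring k) q = \<beta> k * q $ k" for k
    using q_root[of k] q_cube by (simp add: gen_fun_offspring)
  have "0 \<le> (jacobian b 1 *v v) $ k" for k
  proof -
    have "gen_fun (offspring k) 1 - gen_fun (offspring k) q \<le> (\<Sum>l\<in>UNIV. mean k l * \<bar>1 $ l - q $ l\<bar>)"
      using q_cube by (intro gen_fun_offspring_lipschitz) auto
    then show ?thesis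
      using v(3) by (simp add: jacobian_mult gen_fun_offspring_one off v_def algebra_simps sum_subtractf)
  qed
  moreover have "y \<bullet> (jacobian b 1 *v v) \<le> 0"
  proof -
    have "0 \<le> y \<bullet> v" unfolding inner_vec_def using y(1) v(3) by (auto intro!: sum_nonneg simp: less_imp_le)
    moreover have "y \<bullet> (jacobian b 1 *v v) = rho b 1 * (y \<bullet> v)"
      using inner_transpose[of "jacobian b 1" y v] y(2) by simp
    ultimately show ?thesis using assms by (simp add: mult_nonpos_nonneg)
  qed
  ultimately have "y $ k * (jacobian b 1 *v v) $ k = 0" for k
    unfolding inner_vec_def inner_real_def
    using sum_nonneg_0[of UNIV "\<lambda>k. y $ k * (jacobian b 1 *v v) $ k" k] y(1)
    by (metis (no_types, lifting) UNIV_I antisym finite less_imp_le mult_nonneg_nonneg sum_nonneg)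
  then have Mv: "(jacobian b 1 *v v) $ k = 0" for k using y(1) by (metis less_irrefl mult_eq_0_iff)
  have "(jacobian b 1 + c *\<^sub>R mat 1) *v v = c *\<^sub>R v"
    using Mv by (simp add: vec_eq_iff matrix_vector_mult_add_rdistrib scaleR_matrix_vector_assoc[symmetric])
  then have vpos: "0 < v $ k" for k
    using positively_regular_eigenvector_pos[OF c(2) v(1,2)] by blast
  define d where "d u j = (\<Sum>l\<in>UNIV. real (j $ l) * (1 - u $ l)) - (1 - monomial u j)"
    for u :: "real^'n" and j :: "nat^'n"
  have d_add: "d u (i + j) = d u i + d u j + (1 - monomial u i) * (1 - monomial u j)" for u i j
    using defect_add unfolding d_def .
  have d0: "0 \<le> d q j" for j
    using monomial_diff_le[of 1 q j] q_cube q_bounds by (simp add: d_def)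
  have d_sum: "((\<lambda>j. offspring k j * d u j) has_sum
      (\<Sum>l\<in>UNIV. mean k l * (1 - u $ l)) - (\<beta> k - gen_fun (offspring k) u)) UNIV"
    if u: "u \<in> {0..1}" for u k
  proof -
    have "((\<lambda>j. - offspring k j) has_sum - \<beta> k) UNIV"
      using offspring_has_sum by (simp add: has_sum_uminus)
    from has_sum_add[OF weighted_mean_has_sum[of k "\<lambda>l. 1 - u $ l"]
        has_sum_add[OF gen_fun_has_sum[OF offspring_summable[of k] u] this]]
    show ?thesis by (simp add: d_def algebra_simps)
  qed
  \<comment> \<open>\<open>Mv\<close> says that these nonnegative terms sum to at most 0, so the
    defect vanishes wherever there is offspring.\<close>
  have term0: "offspring k j * d q j = 0" for k j
  proof (rule nonneg_has_sum_le_0D[OF d_sum[OF q_cube, of k]])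
    show "(\<Sum>l\<in>UNIV. mean k l * (1 - q $ l)) - (\<beta> k - gen_fun (offspring k) q) \<le> 0"
      using Mv[of k] by (simp add: jacobian_mult off v_def algebra_simps sum_subtractf)
  qed (use d0 offspring_nonneg in auto)
  have lt1: "monomial q j < 1" if "j \<noteq> 0" for j
  proof -
    obtain l where "0 < j $ l" using index_pos[OF \<open>j \<noteq> 0\<close>] by blast
    then have "monomial q j \<le> q $ l" by (rule monomial_le_component[OF q_cube])
    also have "\<dots> < 1" using vpos[of l] by (simp add: v_def)
    finally show ?thesis .
  qed
  \<comment> \<open>By \<open>vpos\<close> every \<open>q $ k < 1\<close>, so the defect at
    \<open>q\<close> is positive for each \<open>j\<close> of degree at least two; such
    \<open>j\<close> carry no offspring. Degrees 0 and 1 have no defect anywhere, in particular not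
    at the origin.\<close>
  have affine: "offspring k j * d 0 j = 0" for k j
  proof (cases "j = 0 \<or> (\<exists>l. j = axis l 1)")
    case True
    then show ?thesis
    proof
      assume "\<exists>l. j = axis l 1"
      then obtain l where j: "j = axis l 1" by blast
      have "(\<Sum>i\<in>UNIV. real (j $ i)) = 1"
        by (simp add: j axis_def if_distrib cong: if_cong)
      then show ?thesis by (simp add: d_def j)
    qed (simp add: d_def)
  next
    case False
    then obtain l where l: "0 < j $ l" using index_pos[of j] by blast
    define r where "r = j - axis l 1"
    have j: "j = axis l 1 + r" using axis_remainder[OF l] by (simp add: r_def)
    then have "r \<noteq> 0" using False by auto
    then have "0 < (1 - monomial q (axis l 1)) * (1 - monomial q r)"
      using lt1[of r] vpos[of l] by (simp add: v_def)
    then have "0 < d q (axis l 1 + r)"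
      using d_add[of q "axis l 1" r] d0[of "axis l 1"] d0[of r] by linarith
    then have "0 < d q j" using arg_cong[OF j, of "d q"] by simp
    then have "offspring k j = 0" using term0[of k j] by simp
    then show ?thesis by simp
  qed
  have zero_cube: "(0 :: real^'n) \<in> {0..1}" by simp
  \<comment> \<open>Each \<open>B_k\<close> now equals its linearisation at 1; this is its value at
    the origin.\<close>
  have M1: "(jacobian b 1 *v 1) $ k = - gen_fun (b k) 0" for k
  proof -
    have "((\<lambda>j :: nat^'n. 0) has_sum (\<Sum>l\<in>UNIV. mean k l * (1 - 0 $ l)) - (\<beta> k - gen_fun (offspring k) 0)) UNIV"
      using d_sum[OF zero_cube, of k] by (simp only: affine)
    from has_sum_unique[OF this has_sum_0_simp]
    have "(\<Sum>l\<in>UNIV. mean k l) - (\<beta> k - gen_fun (offspring k) 0) = 0" by simp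
    then show ?thesis
      using gen_fun_offspring(2)[OF zero_cube] by (simp add: jacobian_mult)
  qed
  have "y \<bullet> v > 0"
    unfolding inner_vec_def using y(1) vpos by (intro sum_pos) auto
  moreover have "rho b 1 * (y \<bullet> v) = y \<bullet> (jacobian b 1 *v v)"
    using inner_transpose[of "jacobian b 1" y v] y(2) by simp
  moreover have "y \<bullet> (jacobian b 1 *v v) = 0" using Mv by (simp add: inner_vec_def)
  ultimately have "rho b 1 = 0" by simp
  then have "y \<bullet> (jacobian b 1 *v 1) = 0"
    using inner_transpose[of "jacobian b 1" y 1] y(2) by simp
  then have "(\<Sum>k\<in>UNIV. y $ k * gen_fun (b k) 0) = 0"
    by (simp add: inner_vec_def M1 sum_negf)
  moreover have "0 < (\<Sum>k\<in>UNIV. y $ k * gen_fun (b k) 0)"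
  proof (rule sum_pos2[of _ e])
    fix k
    have "0 \<le> gen_fun (b k) 0"
      using gen_fun_offspring(2)[OF zero_cube, of k] offspring_nonneg by (simp add: gen_fun_zero)
    then show "0 \<le> y $ k * gen_fun (b k) 0" using y(1) by (simp add: less_imp_le)
  qed (use death y(1) in auto)
  ultimately show False by simp
qed

end

section \<open>Extinction as least superharmonic function\<close>

context branching
begin

section \<open>The action of the q-matrix on monomials\<close>

abbreviation "Q \<equiv> absorptive_q_matrix a b"

text \<open>The row generating function of \<open>Q\<close>, equivalently its generator applied to
  \<open>j \<mapsto> u^j\<close>. The truncated \<open>i - axis k 1\<close> is harmless: where it
  truncates, the factor \<open>i $ k\<close> is 0.\<close>

definition drift :: "nat^'n \<Rightarrow> real^'n \<Rightarrow> real" where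
  "drift i u = monomial u i * gen_fun a u +
     (\<Sum>k\<in>UNIV. real (i $ k) * monomial u (i - axis k 1) * gen_fun (b k) u)"

text \<open>The map \<open>l \<mapsto> l + r\<close> is a bijection onto the \<open>j\<close> that
  pass the guard \<open>i \<le> j + d\<close>. With \<open>d = 0\<close> this treats the immigration
  part of a row, with \<open>d = axis k 1\<close> the branching part.\<close>

lemma shifted_has_sum:
  fixes c :: "nat^'n \<Rightarrow> real" and d r i :: "nat^'n"
  assumes i: "i = d + r" and sum: "((\<lambda>j. c j * monomial u j) has_sum S) UNIV"
  shows "((\<lambda>j. (if i \<le> j + d then c (j + d - i) else 0) * monomial u j) has_sum monomial u r * S) UNIV"
    (is "(?f has_sum _) _")
proof -
  have "?f (l + r) = c l * monomial u l * monomial u r" for l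
  proof -
    have "l + r + d - i = l" using i by (simp add: vec_eq_iff)
    moreover have "i \<le> l + r + d" using i by (simp add: less_eq_vec_def)
    ultimately show ?thesis by (simp add: monomial_add)
  qed
  then have "((\<lambda>l. ?f (l + r)) has_sum S * monomial u r) UNIV"
    using has_sum_cmult_left[OF sum, of "monomial u r"] by simp
  moreover have "inj (\<lambda>l. l + r)" by (auto simp: inj_def)
  ultimately have *: "(?f has_sum S * monomial u r) (range (\<lambda>l. l + r))"
    by (simp add: has_sum_reindex o_def)
  have "j \<in> range (\<lambda>l. l + r)" if "i \<le> j + d" for j
  proof -
    have "j = (j - r) + r" using that i by (simp add: vec_eq_iff less_eq_vec_def)
    then show ?thesis by blast
  qed
  then show ?thesis
    using * by (subst mult.commute) (rule has_sum_cong_neutral[THEN iffD1, rotated -1], auto)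
qed

lemma Q_row_has_sum:
  assumes "i \<noteq> 0" "u \<in> {0..1}"
  shows "((\<lambda>j. Q i j * monomial u j) has_sum drift i u) UNIV"
proof -
  have A: "((\<lambda>j. (if i \<le> j then a (j - i) else 0) * monomial u j) has_sum monomial u i * gen_fun a u) UNIV"
  proof -
    have "i = 0 + i" by simp
    from shifted_has_sum[OF this gen_fun_immigration(1)[OF assms(2)]]
    show ?thesis by (simp only: add_0_right)
  qed
  have B: "((\<lambda>j. real (i $ k) * ((if i \<le> j + axis k 1 then b k (j + axis k 1 - i) else 0) * monomial u j))
      has_sum real (i $ k) * (monomial u (i - axis k 1) * gen_fun (b k) u)) UNIV" for k
  proof (cases "i $ k = 0")
    case False
    then have "i = axis k 1 + (i - axis k 1)" by (intro axis_remainder) simp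
    from shifted_has_sum[OF this gen_fun_offspring(1)[OF assms(2), of k]]
    show ?thesis by (rule has_sum_cmult_right)
  qed simp
  have "((\<lambda>j. (\<Sum>k\<in>UNIV. real (i $ k) *
        ((if i \<le> j + axis k 1 then b k (j + axis k 1 - i) else 0) * monomial u j)) +
        (if i \<le> j then a (j - i) else 0) * monomial u j) has_sum
      (\<Sum>k\<in>UNIV. real (i $ k) * (monomial u (i - axis k 1) * gen_fun (b k) u)) + monomial u i * gen_fun a u) UNIV"
    by (intro has_sum_add has_sum_sum A B finite)
  moreover have "(\<Sum>k\<in>UNIV. real (i $ k) *
        ((if i \<le> j + axis k 1 then b k (j + axis k 1 - i) else 0) * monomial u j)) +
        (if i \<le> j then a (j - i) else 0) * monomial u j = Q i j * monomial u j" for j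
    using assms(1) by (simp only: absorptive_q_matrix_def if_False sum_distrib_right distrib_right mult.assoc)
  moreover have "(\<Sum>k\<in>UNIV. real (i $ k) * (monomial u (i - axis k 1) * gen_fun (b k) u)) +
      monomial u i * gen_fun a u = drift i u"
    by (simp only: drift_def mult.assoc add.commute)
  ultimately show ?thesis by (simp only:)
qed

lemma Q_zero: "Q 0 j = 0"
  by (simp add: absorptive_q_matrix_def)

lemma Q_diag_neg:
  assumes "i \<noteq> 0"
  shows "Q i i < 0"
proof -
  have "i \<le> i + axis k 1 \<and> i + axis k 1 - i = axis k 1 \<and> i - i = 0" for k :: 'n
    by (auto simp: less_eq_vec_def vec_eq_iff)
  then have "Q i i = - (\<Sum>k\<in>UNIV. real (i $ k) * \<beta> k) - \<alpha>"
    using assms by (simp add: absorptive_q_matrix_def \<beta>_def \<alpha>_def sum_negf)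
  moreover have "0 \<le> (\<Sum>k\<in>UNIV. real (i $ k) * \<beta> k)"
    by (intro sum_nonneg mult_nonneg_nonneg) (auto simp: \<beta>_pos less_imp_le)
  ultimately show ?thesis using \<alpha>_pos by simp
qed

lemma branching_rate_nonneg:
  assumes "j \<noteq> i"
  shows "0 \<le> real (i $ k) * (if i \<le> j + axis k 1 then b k (j + axis k 1 - i) else 0)"
proof (cases "i \<le> j + axis k 1")
  case True
  have "j + axis k 1 - i \<noteq> axis k 1"
  proof
    assume eq: "j + axis k 1 - i = axis k 1"
    have "j $ l = i $ l" for l
    proof -
      have "j $ l + axis k 1 $ l - i $ l = axis k 1 $ l" using arg_cong[OF eq, of "\<lambda>v. v $ l"] by simp
      moreover have "i $ l \<le> j $ l + axis k 1 $ l" using True by (simp add: less_eq_vec_def)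
      ultimately show ?thesis by linarith
    qed
    then show False using assms by (simp add: vec_eq_iff)
  qed
  then show ?thesis
    using offspring_nonneg[of k "j + axis k 1 - i"] by (auto simp: offspring_def)
qed simp

lemma Q_offdiag_ge:
  assumes "i \<noteq> 0" "j \<noteq> i"
  shows "(if i \<le> j then a (j - i) else 0) \<le> Q i j"
  using assms sum_nonneg[OF branching_rate_nonneg[OF assms(2)]]
  by (simp add: absorptive_q_matrix_def)

lemma Q_offdiag_nonneg:
  assumes "j \<noteq> i"
  shows "0 \<le> Q i j"
proof (cases "i = 0")
  case False
  have "0 \<le> (if i \<le> j then a (j - i) else 0)"
  proof (cases "i \<le> j")
    case True
    then have "j - i \<noteq> 0" using assms by (auto simp: vec_eq_iff less_eq_vec_def intro: le_antisym)
    then show ?thesis using immigration_nonneg[of "j - i"] by (simp add: immigration_def)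
  qed simp
  then show ?thesis using Q_offdiag_ge[OF False assms] by linarith
qed (simp add: Q_zero)

lemma Q_offdiag_nn_integral:
  assumes "i \<noteq> 0" "u \<in> {0..1}"
  shows "(\<integral>\<^sup>+j. ennreal (Q i j) * ennreal (monomial u j) \<partial>count_space (- {i})) =
    ennreal (drift i u - Q i i * monomial u i)"
    and "0 \<le> drift i u - Q i i * monomial u i"
proof -
  have "((\<lambda>j. Q i j * monomial u j) has_sum drift i u - Q i i * monomial u i) (- {i})"
  proof -
    have "((\<lambda>j. (if j = i then - (Q i i * monomial u i) else 0)) has_sum - (Q i i * monomial u i)) UNIV"
      by (rule has_sum_single)
    from has_sum_add[OF Q_row_has_sum[OF assms] this]
    have "((\<lambda>j. Q i j * monomial u j + (if j = i then - (Q i i * monomial u i) else 0))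
      has_sum drift i u - Q i i * monomial u i) UNIV" by simp
    then show ?thesis
      by (rule has_sum_cong_neutral[THEN iffD1, rotated -1]) auto
  qed
  moreover have nonneg: "0 \<le> Q i j * monomial u j" if "j \<in> - {i}" for j
    using that assms(2) by (intro mult_nonneg_nonneg Q_offdiag_nonneg monomial_nonneg) auto
  ultimately have "(\<integral>\<^sup>+j. ennreal (Q i j * monomial u j) \<partial>count_space (- {i})) =
      ennreal (drift i u - Q i i * monomial u i)" and "0 \<le> drift i u - Q i i * monomial u i"
    using nn_integral_count_space_has_sum has_sum_nonneg by blast+
  moreover have "(\<integral>\<^sup>+j. ennreal (Q i j) * ennreal (monomial u j) \<partial>count_space (- {i})) =
      (\<integral>\<^sup>+j. ennreal (Q i j * monomial u j) \<partial>count_space (- {i}))"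
    by (rule nn_integral_cong) (use assms(2) in \<open>simp add: ennreal_mult Q_offdiag_nonneg monomial_nonneg\<close>)
  ultimately show "(\<integral>\<^sup>+j. ennreal (Q i j) * ennreal (monomial u j) \<partial>count_space (- {i})) =
      ennreal (drift i u - Q i i * monomial u i)" and "0 \<le> drift i u - Q i i * monomial u i"
    by auto
qed

lemma drift_one: "drift i 1 = 0"
  by (simp add: drift_def gen_fun_immigration_one gen_fun_branching_one)

text \<open>All generating functions vanish at \<open>u = 1\<close>, so the matrix is conservative;
  hence constants are harmonic.\<close>

lemma Q_total_rate:
  assumes "i \<noteq> 0"
  shows "(\<integral>\<^sup>+j. ennreal (Q i j) \<partial>count_space (- {i})) = ennreal (- Q i i)"
  using Q_offdiag_nn_integral(1)[OF assms, of 1] by (simp add: drift_one)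

lemma absorption_prob_le_one: "absorption_prob Q 0 i \<le> 1"
  unfolding absorption_prob_def
proof (intro SUP_least feller_approx_le_superharmonic)
  fix i :: "nat^'n" assume "i \<noteq> 0"
  then show "(\<integral>\<^sup>+k. ennreal (Q i k) * 1 \<partial>count_space (- {i})) \<le> ennreal (- Q i i) * 1"
    by (simp add: Q_total_rate)
qed (auto simp: Q_zero Q_diag_neg)

section \<open>Comparison of the extinction probability with super- and subharmonic
  functions\<close>

lemma extinction_prob_absorption:
  "extinction_prob a b i = enn2real (absorption_prob Q 0 i)"
  "ennreal (extinction_prob a b i) = absorption_prob Q 0 i"
proof -
  have fin: "absorption_prob Q 0 i < \<infinity>"
    using absorption_prob_le_one[of i] by (simp add: le_less_trans)
  show eq: "extinction_prob a b i = enn2real (absorption_prob Q 0 i)"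
    unfolding extinction_prob_def
    by (rule tendsto_Lim) (auto intro!: feller_minimal_tendsto_absorption_prob Q_zero fin)
  show "ennreal (extinction_prob a b i) = absorption_prob Q 0 i"
    unfolding eq using fin by simp
qed

lemma extinction_prob_le_one: "extinction_prob a b i \<le> 1"
  using absorption_prob_le_one[of i] extinction_prob_absorption(2)[of i]
  by (metis ennreal_1 ennreal_le_iff zero_le_one)

lemma extinction_prob_nonneg: "0 \<le> extinction_prob a b i"
  by (simp add: extinction_prob_absorption)

lemma extinction_prob_zero: "extinction_prob a b 0 = 1"
  unfolding extinction_prob_absorption absorption_prob_def
  by (simp add: feller_approx_absorbing[of Q 0, OF Q_zero])

text \<open>Superharmonicity is required for finite partial sums only, because these pass to
  pointwise limits of \<open>h\<close> without any convergence theorem.\<close>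

lemma extinction_prob_le_superharmonic:
  assumes h: "\<And>j. 0 \<le> h j" "1 \<le> h 0"
    and super: "\<And>i F. i \<noteq> 0 \<Longrightarrow> finite F \<Longrightarrow> i \<notin> F \<Longrightarrow> (\<Sum>j\<in>F. Q i j * h j) \<le> - Q i i * h i"
  shows "extinction_prob a b i \<le> h i"
proof -
  have "absorption_prob Q 0 i \<le> ennreal (h i)"
    unfolding absorption_prob_def
  proof (intro SUP_least feller_approx_le_superharmonic)
    fix i :: "nat^'n" assume i: "i \<noteq> 0"
    have nonneg: "0 \<le> Q i j * h j" if "j \<in> - {i}" for j
      using that h(1) by (simp add: Q_offdiag_nonneg)
    have le: "(\<Sum>j\<in>F. Q i j * h j) \<le> - Q i i * h i" if "finite F" "F \<subseteq> - {i}" for F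
      using super[OF i that(1)] that(2) by auto
    have "(\<lambda>j. Q i j * h j) summable_on (- {i})"
      by (rule nonneg_bdd_above_summable_on) (use nonneg le in \<open>auto intro!: bdd_aboveI2[of _ _ "- Q i i * h i"]\<close>)
    then obtain S where S: "((\<lambda>j. Q i j * h j) has_sum S) (- {i})" by (auto simp: summable_on_def)
    have "S \<le> - Q i i * h i" by (rule has_sum_le_finite_sums[OF S]) (use le in auto)
    have "(\<integral>\<^sup>+k. ennreal (Q i k) * ennreal (h k) \<partial>count_space (- {i})) =
        (\<integral>\<^sup>+k. ennreal (Q i k * h k) \<partial>count_space (- {i}))"
      by (rule nn_integral_cong) (auto simp: ennreal_mult h(1) Q_offdiag_nonneg)
    also have "\<dots> = ennreal S" by (rule nn_integral_count_space_has_sum[OF S nonneg])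
    also have "\<dots> \<le> ennreal (- Q i i * h i)" by (rule ennreal_leI) fact
    also have "\<dots> = ennreal (- Q i i) * ennreal (h i)"
      using Q_diag_neg[OF i] h(1) by (intro ennreal_mult) auto
    finally show "(\<integral>\<^sup>+k. ennreal (Q i k) * ennreal (h k) \<partial>count_space (- {i}))
        \<le> ennreal (- Q i i) * ennreal (h i)" .
  qed (use h(2) in \<open>auto simp: Q_zero Q_diag_neg\<close>)
  then show ?thesis
    using h(1)[of i] by (simp add: extinction_prob_absorption(2)[symmetric])
qed

text \<open>The maximum principle. \<open>vanish\<close> makes the set of maximisers of
  \<open>D\<close> finite and nonempty, which replaces an iteration towards infinity by the choice
  of one extremal maximiser.\<close>

lemma subharmonic_le_extinction_prob:
  assumes H: "\<And>j. 0 \<le> H j" and vanish: "\<And>\<epsilon>. 0 < \<epsilon> \<Longrightarrow> finite {j. \<epsilon> \<le> H j}"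
    and sub: "\<And>i. i \<noteq> 0 \<Longrightarrow> ennreal (- Q i i * H i) \<le>
      (\<integral>\<^sup>+k. ennreal (Q i k) * ennreal (H k) \<partial>count_space (- {i}))"
  shows "H i \<le> H 0 * extinction_prob a b i"
proof (rule ccontr)
  define f where "f = extinction_prob a b"
  define D where "D j = H j - H 0 * f j" for j
  assume "\<not> ?thesis"
  then have Di: "0 < D i" by (simp add: D_def f_def)
  have D_le: "D j \<le> H j" for j
    using H[of 0] extinction_prob_nonneg[of j] by (simp add: D_def f_def)
  have fin: "finite {j. D i \<le> D j}"
    by (rule finite_subset[OF _ vanish[OF Di]]) (use D_le order_trans in blast)
  define s where "s = Max (D ` {j. D i \<le> D j})"
  have s_ge: "D j \<le> s" for j
  proof (cases "D i \<le> D j")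
    case True
    then show ?thesis unfolding s_def using fin by (intro Max_ge) auto
  next
    case False
    moreover have "D i \<le> s" unfolding s_def using fin by (intro Max_ge) auto
    ultimately show ?thesis by linarith
  qed
  have "s \<in> D ` {j. D i \<le> D j}" unfolding s_def using fin by (intro Max_in) auto
  then have ne: "{j. D j = s} \<noteq> {}" by auto
  have s_pos: "0 < s" using s_ge[of i] Di by linarith
  have "finite {j. D j = s}"
    by (rule finite_subset[OF _ fin]) (use s_ge in auto)
  \<comment> \<open>Maximal in the componentwise order: an immigration jump by \<open>j0\<close>
    leads strictly above \<open>m\<close>, hence to a state where \<open>D\<close> is smaller than
    \<open>s\<close>.\<close>
  then obtain m where m: "D m = s" "\<And>j. D j = s \<Longrightarrow> m \<le> j \<Longrightarrow> m = j"
    using finite_has_maximal[OF _ ne] by auto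
  obtain j0 where j0: "j0 \<noteq> 0" "0 < a j0" using immigration_pos by blast
  define k where "k = m + j0"
  have mk: "m \<le> k" "k - m = j0" "m \<noteq> k"
    using j0(1) by (auto simp: k_def less_eq_vec_def vec_eq_iff)
  \<comment> \<open>\<open>D 0 = 0\<close>, since extinction from 0 is certain.\<close>
  have "m \<noteq> 0"
    using m(1) s_pos by (auto simp: D_def f_def extinction_prob_zero)
  have Qk: "0 < Q m k"
    using Q_offdiag_ge[OF \<open>m \<noteq> 0\<close>, of k] mk j0(2) by auto
  define \<delta> where "\<delta> = s - D k"
  have "\<delta> > 0" using m(2)[of k] mk s_ge[of k] by (force simp: \<delta>_def less_le)
  define q where "q = - Q m m"
  have q: "0 < q" using Q_diag_neg[OF \<open>m \<noteq> 0\<close>] by (simp add: q_def)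
  \<comment> \<open>\<open>D j \<le> s\<close>, improved by \<open>\<delta>\<close> at
    \<open>k\<close>, with the negative parts moved across so that it can be summed in
    \<open>ennreal\<close> against row \<open>m\<close>.\<close>
  have pt: "ennreal (H j) + ennreal \<delta> * indicator {k} j \<le> ennreal (H 0) * absorption_prob Q 0 j + ennreal s" for j
  proof -
    have "H j + \<delta> * indicator {k} j \<le> H 0 * f j + s"
      using s_ge[of j] by (auto simp: D_def \<delta>_def indicator_def)
    then have "ennreal (H j + \<delta> * indicator {k} j) \<le> ennreal (H 0 * f j + s)" by (rule ennreal_leI)
    moreover have "ennreal (H j + \<delta> * indicator {k} j) = ennreal (H j) + ennreal \<delta> * indicator {k} j"
      using H \<open>\<delta> > 0\<close> by (cases "j = k") simp_all
    moreover have "ennreal (H 0 * f j + s) = ennreal (H 0) * absorption_prob Q 0 j + ennreal s"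
      using H s_pos extinction_prob_nonneg[of j]
      by (simp add: f_def extinction_prob_absorption(2)[symmetric] ennreal_mult)
    ultimately show ?thesis by simp
  qed
  let ?I = "\<lambda>g. \<integral>\<^sup>+j. ennreal (Q m j) * g j \<partial>count_space (- {m})"
  have "ennreal (q * H m) + ennreal (Q m k * \<delta>) \<le> ?I (\<lambda>j. ennreal (H j)) + ennreal (Q m k) * ennreal \<delta>"
    using sub[OF \<open>m \<noteq> 0\<close>] Qk \<open>\<delta> > 0\<close> by (simp add: q_def ennreal_mult add_right_mono)
  also have "ennreal (Q m k) * ennreal \<delta> = ?I (\<lambda>j. ennreal \<delta> * indicator {k} j)"
  proof -
    have "?I (\<lambda>j. ennreal \<delta> * indicator {k} j) =
        (\<integral>\<^sup>+j. (ennreal (Q m k) * ennreal \<delta>) * indicator {k} j \<partial>count_space (- {m}))"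
      by (rule nn_integral_cong) (auto simp: indicator_def)
    also have "\<dots> = ennreal (Q m k) * ennreal \<delta>"
      using mk(3) by (subst nn_integral_cmult_indicator) auto
    finally show ?thesis by simp
  qed
  also have "?I (\<lambda>j. ennreal (H j)) + ?I (\<lambda>j. ennreal \<delta> * indicator {k} j) =
      ?I (\<lambda>j. ennreal (H j) + ennreal \<delta> * indicator {k} j)"
    by (simp add: nn_integral_add[symmetric] distrib_left)
  also have "\<dots> \<le> ?I (\<lambda>j. ennreal (H 0) * absorption_prob Q 0 j + ennreal s)"
    by (intro nn_integral_mono mult_left_mono pt) auto
  also have "\<dots> = ennreal (H 0) * ?I (absorption_prob Q 0) + ennreal s * ?I (\<lambda>_. 1)"
    by (simp add: nn_integral_add distrib_left nn_integral_cmult[symmetric] ac_simps)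
  also have "\<dots> \<le> ennreal (H 0) * (ennreal q * absorption_prob Q 0 m) + ennreal s * ennreal q"
    unfolding q_def
    by (intro add_mono mult_left_mono absorption_prob_superharmonic)
       (auto simp: Q_zero Q_diag_neg \<open>m \<noteq> 0\<close> Q_total_rate)
  also have "\<dots> = ennreal (H 0 * (q * f m) + s * q)"
    using H s_pos q extinction_prob_nonneg[of m]
    by (simp add: f_def extinction_prob_absorption(2)[symmetric] ennreal_mult ennreal_plus)
  finally have "ennreal (q * H m + Q m k * \<delta>) \<le> ennreal (H 0 * (q * f m) + s * q)"
    using q H Qk \<open>\<delta> > 0\<close> by (simp add: ennreal_plus)
  then have "q * H m + Q m k * \<delta> \<le> H 0 * (q * f m) + s * q"
    using H s_pos q extinction_prob_nonneg[of m] by (subst (asm) ennreal_le_iff) (auto simp: f_def)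
  also have "\<dots> = q * H m" using m(1) by (simp add: D_def algebra_simps)
  finally show False using Qk \<open>\<delta> > 0\<close> by (simp add: mult_le_0_iff)
qed

end

section \<open>Calculus on a half-open interval\<close>

lemma integral_Icc_DERIV:
  fixes f :: "real \<Rightarrow> real"
  assumes f: "continuous_on {0..<c} f" and y: "0 < y" "y < c"
  shows "((\<lambda>y. integral {0..y} f) has_real_derivative f y) (at y)"
proof -
  define z where "z = (y + c) / 2"
  have z: "y < z" "z < c" using y by (auto simp: z_def)
  have "((\<lambda>y. integral {0..y} f) has_real_derivative f y) (at y within {0..z})"
    using z y by (intro integral_has_real_derivative continuous_on_subset[OF f]) auto
  then show ?thesis using y z by (simp only: at_within_Icc_at)
qed

lemma continuous_on_integral_Icc:
  fixes f :: "real \<Rightarrow> real"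
  assumes f: "continuous_on {0..<c} f" and z: "z < c"
  shows "continuous_on {0..z} (\<lambda>y. integral {0..y} f)"
  using z by (intro indefinite_integral_continuous_1 integrable_continuous_interval
      continuous_on_subset[OF f]) auto

text \<open>The bridge from integrals over \<open>{0..y}\<close> to the Lebesgue integral over an
  interval at whose end \<open>f\<close> may blow up. The primitive is monotone and bounded, so it
  has a limit, and the fundamental theorem for nonnegative integrands gives integrability and
  value.\<close>

lemma integral_Icc_bounded_limit:
  fixes f :: "real \<Rightarrow> real"
  assumes f: "continuous_on {0..<c} f" and c: "0 < c"
    and nonneg: "\<And>x. 0 \<le> x \<Longrightarrow> x < c \<Longrightarrow> 0 \<le> f x"
    and K: "\<And>y. 0 \<le> y \<Longrightarrow> y < c \<Longrightarrow> integral {0..y} f \<le> K"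
  shows "set_integrable lborel {0<..<c} f"
    and "((\<lambda>y. integral {0..y} f) \<longlongrightarrow> (LBINT x:{0<..<c}. f x)) (at_left c)"
proof -
  define F where "F y = integral {0..y} f" for y
  have cont: "continuous_on {0..z} F" if "z < c" for z
    unfolding F_def by (rule continuous_on_integral_Icc[OF f that])
  have deriv: "(F has_real_derivative f y) (at y)" if "0 < y" "y < c" for y
    unfolding F_def by (rule integral_Icc_DERIV[OF f that])
  have mono: "F x \<le> F y" if "0 \<le> x" "x \<le> y" "y < c" for x y
  proof (rule DERIV_nonneg_imp_increasing_open[OF that(2)])
    show "continuous_on {x..y} F" using that by (intro continuous_on_subset[OF cont[of y]]) auto
    fix t assume "x < t" "t < y"
    then show "\<exists>d. (F has_real_derivative d) (at t) \<and> 0 \<le> d"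
      using deriv[of t] nonneg[of t] that by (intro exI[of _ "f t"]) auto
  qed
  define L where "L = (SUP y\<in>{0..<c}. F y)"
  have bdd: "bdd_above (F ` {0..<c})" by (rule bdd_aboveI2[of _ _ K]) (auto simp: F_def K)
  have ev: "\<forall>\<^sub>F y in at_left c. y \<in> {0..<c}"
    using eventually_at_left_real[OF c] by eventually_elim auto
  have lim: "(F \<longlongrightarrow> L) (at_left c)"
  proof (rule increasing_tendsto)
    show "\<forall>\<^sub>F y in at_left c. F y \<le> L"
      using ev by eventually_elim (auto simp: L_def intro!: cSUP_upper bdd)
    fix x assume "x < L"
    then obtain y where y: "y \<in> {0..<c}" "x < F y"
      unfolding L_def using bdd c by (subst (asm) less_cSUP_iff) auto
    show "\<forall>\<^sub>F y in at_left c. x < F y"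
    proof (rule eventually_mono[OF eventually_at_left_real[of y c]])
      fix t assume "t \<in> {y<..<c}"
      then have "F y \<le> F t" using y by (intro mono) auto
      then show "x < F t" using y(2) by simp
    qed (use y in auto)
  qed
  have lim0: "(F \<longlongrightarrow> 0) (at_right 0)"
  proof -
    have "continuous_on {0..c / 2} F" using c by (intro cont) auto
    then have "(F \<longlongrightarrow> F 0) (at 0 within {0..c / 2})"
      using c unfolding continuous_on_def by (meson atLeastAtMost_iff half_gt_zero less_imp_le order_refl)
    moreover have "F 0 = 0" by (simp add: F_def)
    moreover have "at 0 within {0..c / 2} = at_right 0" using c by (simp add: at_within_Icc_at_right)
    ultimately show ?thesis by (simp only:)
  qed
  have cts: "isCont f x" if "0 < x" "x < c" for x
  proof -
    have "continuous_on {0<..<c} f" by (rule continuous_on_subset[OF f]) auto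
    then show ?thesis using that by (simp add: continuous_on_eq_continuous_at)
  qed
  note FTC = interval_integral_FTC_nonneg[of "ereal 0" "ereal c" F f 0 L]
  have *: "((F \<circ> real_of_ereal) \<longlongrightarrow> 0) (at_right (ereal 0))"
    "((F \<circ> real_of_ereal) \<longlongrightarrow> L) (at_left (ereal c))"
    unfolding ereal_tendsto_simps by (fact lim0 lim)+
  have "set_integrable lborel (einterval (ereal 0) (ereal c)) f"
    by (rule FTC) (use c deriv cts nonneg * in auto)
  then show "set_integrable lborel {0<..<c} f" by (simp only: einterval_eq)
  have "(LBINT x=ereal 0..ereal c. f x) = L - 0"
    by (rule FTC) (use c deriv cts nonneg * in auto)
  then have "(LBINT x:{0<..<c}. f x) = L"
    using c by (simp add: interval_lebesgue_integral_def einterval_eq del: zero_ereal_def)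
  then show "((\<lambda>y. integral {0..y} f) \<longlongrightarrow> (LBINT x:{0<..<c}. f x)) (at_left c)"
    using lim by (simp add: F_def[abs_def])
qed

text \<open>A Gronwall inequality: \<open>g t * exp (- C * t)\<close> is nondecreasing.
  \<open>g\<close> may have either sign, so applying it to \<open>- g\<close> gives upper
  bounds.\<close>

lemma exponential_lower_bound:
  fixes g :: "real \<Rightarrow> real"
  assumes cont: "continuous_on {0..z} g" and z: "0 \<le> z"
    and deriv: "\<And>t. 0 < t \<Longrightarrow> t < z \<Longrightarrow> \<exists>d. (g has_real_derivative d) (at t) \<and> C * g t \<le> d"
  shows "g 0 \<le> g z * exp (- C * z)"
proof -
  have "g 0 * exp (- C * 0) \<le> g z * exp (- C * z)"
  proof (rule DERIV_nonneg_imp_increasing_open[OF z, of "\<lambda>t. g t * exp (- C * t)"])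
    fix t assume "0 < t" "t < z"
    then obtain d where d: "(g has_real_derivative d) (at t)" "C * g t \<le> d" using deriv by blast
    have "((\<lambda>t. g t * exp (- C * t)) has_real_derivative (d - C * g t) * exp (- C * t)) (at t)"
      by (auto intro!: derivative_eq_intros d(1) simp: algebra_simps)
    then show "\<exists>y. ((\<lambda>t. g t * exp (- C * t)) has_real_derivative y) (at t) \<and> 0 \<le> y"
      using d(2) by (intro exI conjI) auto
  qed (intro continuous_intros cont)
  then show ?thesis by simp
qed

text \<open>Squaring removes the kink of the positive part at 0. This makes the overshoot of the
  curve beyond \<open>q\<close> differentiable.\<close>

lemma has_real_derivative_positive_part_squared:
  fixes g :: "real \<Rightarrow> real"
  assumes "(g has_real_derivative d) (at t)"
  shows "((\<lambda>t. (max 0 (g t))\<^sup>2) has_real_derivative 2 * max 0 (g t) * d) (at t)"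
proof -
  have sq: "((\<lambda>x::real. (max 0 x)\<^sup>2) has_real_derivative 2 * max 0 x) (at x)" for x
  proof (cases x "0 :: real" rule: linorder_cases)
    case less
    have "((\<lambda>x::real. 0) has_real_derivative 0) (at x)" by simp
    then have "((\<lambda>x::real. (max 0 x)\<^sup>2) has_real_derivative 0) (at x)"
      by (rule has_field_derivative_transform_within_open[of _ _ _ "{..<0}"]) (use less in auto)
    then show ?thesis using less by simp
  next
    case greater
    have "((\<lambda>x::real. x\<^sup>2) has_real_derivative 2 * x) (at x)"
      by (auto intro!: derivative_eq_intros)
    then have "((\<lambda>x::real. (max 0 x)\<^sup>2) has_real_derivative 2 * x) (at x)"
      by (rule has_field_derivative_transform_within_open[of _ _ _ "{0<..}"]) (use greater in auto)
    then show ?thesis using greater by simp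
  next
    case equal
    have "((\<lambda>h :: real. (max 0 h)\<^sup>2 / h) \<longlongrightarrow> 0) (at 0)"
    proof (rule Lim_null_comparison)
      show "\<forall>\<^sub>F h in at 0. norm ((max 0 h)\<^sup>2 / h) \<le> \<bar>h\<bar>"
        by (rule always_eventually) (auto simp: max_def power2_eq_square)
      show "((\<lambda>h :: real. \<bar>h\<bar>) \<longlongrightarrow> 0) (at 0)"
        by (rule tendsto_eq_intros refl | simp)+
    qed
    then show ?thesis using equal by (simp add: has_field_derivative_iff)
  qed
  show ?thesis using DERIV_chain2[OF sq assms] .
qed

section \<open>Multi-indices and monomials along a curve\<close>

lemma finite_bounded_vec: "finite {j :: nat^'n::finite. \<forall>k. j $ k < N}"
proof -
  have "{j :: nat^'n. \<forall>k. j $ k < N} \<subseteq> vec_lambda ` (PiE UNIV (\<lambda>_. {..<N}))"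
  proof
    fix j :: "nat^'n" assume "j \<in> {j. \<forall>k. j $ k < N}"
    then show "j \<in> vec_lambda ` (PiE UNIV (\<lambda>_. {..<N}))"
      by (intro image_eqI[of _ _ "($) j"]) auto
  qed
  then show ?thesis by (rule finite_subset) (intro finite_imageI finite_PiE, auto)
qed

lemma monomial_le_power:
  assumes "u \<in> {0..1}"
  shows "monomial u j \<le> (u $ k) ^ (j $ k)"
proof -
  have u: "0 \<le> u $ l" "u $ l \<le> 1" for l using assms by (auto simp: less_eq_vec_def)
  have "monomial u j = (u $ k) ^ (j $ k) * (\<Prod>l\<in>UNIV - {k}. (u $ l) ^ (j $ l))"
    unfolding monomial_def by (simp add: prod.remove)
  also have "\<dots> \<le> (u $ k) ^ (j $ k) * 1"
    by (intro mult_left_mono prod_le_1) (auto simp: u power_le_one)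
  finally show ?thesis by simp
qed

lemma monomial_has_real_derivative:
  fixes U :: "real \<Rightarrow> real^'n::finite"
  assumes "\<And>k. ((\<lambda>x. U x $ k) has_real_derivative d k) (at x)"
  shows "((\<lambda>x. monomial (U x) i) has_real_derivative
    (\<Sum>k\<in>UNIV. real (i $ k) * monomial (U x) (i - axis k 1) * d k)) (at x)"
proof -
  have deriv: "((\<lambda>x. monomial (U x) i) has_real_derivative
    (\<Sum>k\<in>UNIV. (real (i $ k) * U x $ k ^ (i $ k - 1) * d k) * (\<Prod>l\<in>UNIV - {k}. U x $ l ^ (i $ l)))) (at x)"
    unfolding monomial_def
    by (intro has_field_derivative_prod) (auto intro!: derivative_eq_intros assms)
  have eq: "U x $ k ^ (i $ k - 1) * (\<Prod>l\<in>UNIV - {k}. U x $ l ^ (i $ l)) = monomial (U x) (i - axis k 1)"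
    for k
  proof -
    have "monomial (U x) (i - axis k 1) =
        U x $ k ^ ((i - axis k 1) $ k) * (\<Prod>l\<in>UNIV - {k}. U x $ l ^ ((i - axis k 1) $ l))"
      unfolding monomial_def by (rule prod.remove) auto
    moreover have "(\<Prod>l\<in>UNIV - {k}. U x $ l ^ ((i - axis k 1) $ l)) = (\<Prod>l\<in>UNIV - {k}. U x $ l ^ (i $ l))"
      by (rule prod.cong) (auto simp: axis_def)
    ultimately show ?thesis by (simp add: axis_def)
  qed
  have "(real (i $ k) * U x $ k ^ (i $ k - 1) * d k) * (\<Prod>l\<in>UNIV - {k}. U x $ l ^ (i $ l)) =
      real (i $ k) * monomial (U x) (i - axis k 1) * d k" for k
    unfolding eq[symmetric] by (simp only: ac_simps)
  with deriv show ?thesis by (simp only:)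
qed

section \<open>Integrals along the curve\<close>

locale branching_along_curve = regular_branching a b e q
  for a :: "nat^'n::finite \<Rightarrow> real" and b :: "'n \<Rightarrow> nat^'n \<Rightarrow> real"
    and e :: 'n and q :: "real^'n" +
  fixes U :: "real \<Rightarrow> real^'n"
  assumes curve: "branching_curve b e q U"
begin

section \<open>The curve inside the cube\<close>

definition "c = q $ e"
definition "Ac y = gen_fun a (U y)"
definition "Bc y = gen_fun (b e) (U y)"
definition "E y = exp (LBINT x:{0..y}. Ac x / Bc x)"

abbreviation "w \<equiv> weight a b e U"

text \<open>If \<open>q $ e = 0\<close>, the negative linear term of \<open>B_e\<close> vanishes at
  \<open>q\<close>, so \<open>B_e(q) \<ge> B_e(0) > 0\<close> and \<open>q\<close> is no
  root.\<close>

lemma c_pos: "0 < c"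
proof -
  have "c \<noteq> 0"
  proof
    assume "c = 0"
    have "gen_fun (offspring e) 0 \<le> gen_fun (offspring e) q"
      using q_cube by (intro gen_fun_mono offspring_summable offspring_nonneg) auto
    then have "gen_fun (b e) 0 \<le> gen_fun (b e) q"
      using q_cube \<open>c = 0\<close> gen_fun_offspring(2)[of 0 e] gen_fun_offspring(2)[of q e]
      by (simp add: c_def)
    then show False using death q_root[of e] by simp
  qed
  then show ?thesis using q_bounds[of e] by (auto simp: c_def)
qed

lemma U_cube: "0 \<le> y \<Longrightarrow> y \<le> c \<Longrightarrow> U y \<in> {0..1}"
  and U_e: "0 \<le> y \<Longrightarrow> y \<le> c \<Longrightarrow> U y $ e = y"
  and U_0: "U 0 = 0" and U_c: "U c = q"
  and continuous_on_U: "continuous_on {0..c} U"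
  using curve by (auto simp: branching_curve_def c_def)

lemma U_bounds: "0 \<le> y \<Longrightarrow> y \<le> c \<Longrightarrow> 0 \<le> U y $ k \<and> U y $ k \<le> 1"
  using U_cube[of y] by (auto simp: less_eq_vec_def)

lemma continuous_on_Ac: "continuous_on {0..c} Ac"
  and continuous_on_Bc: "continuous_on {0..c} Bc"
  unfolding Ac_def[abs_def] Bc_def[abs_def]
  by (rule continuous_on_compose2[OF continuous_on_gen_fun_coeffs(1) continuous_on_U] continuous_on_compose2[OF continuous_on_gen_fun_coeffs(2) continuous_on_U],
      use U_cube in auto)+

text \<open>The curve only guarantees a nonzero denominator; the sign is inherited from
  \<open>B_e(0) > 0\<close> by continuity.\<close>

lemma Bc_pos:
  assumes "0 \<le> y" "y < c"
  shows "0 < Bc y"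
proof (rule ccontr)
  assume "\<not> 0 < Bc y"
  moreover have "0 < Bc 0" using death by (simp add: Bc_def U_0)
  ultimately obtain x where "0 \<le> x" "x \<le> y" "Bc x = 0"
    using IVT2'[of Bc y 0 0] assms continuous_on_subset[OF continuous_on_Bc, of "{0..y}"] by auto
  then show False using curve assms by (auto simp: branching_curve_def Bc_def c_def)
qed

lemma U_deriv:
  assumes "0 < y" "y < c"
  shows "((\<lambda>x. U x $ k) has_real_derivative gen_fun (b k) (U y) / Bc y) (at y)"
proof (cases "k = e")
  case True
  have "((\<lambda>x. x) has_real_derivative 1) (at y)" by simp
  then have "((\<lambda>x. U x $ e) has_real_derivative 1) (at y)"
    by (rule has_field_derivative_transform_within_open[of _ _ _ "{0<..<c}"])
       (use assms U_e in auto)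
  then show ?thesis using True Bc_pos[of y] assms by (simp add: Bc_def)
next
  case False
  then have "((\<lambda>x. U x $ k) has_real_derivative gen_fun (b k) (U y) / Bc y) (at y within {0..<c})"
    using curve assms by (auto simp: branching_curve_def Bc_def c_def)
  moreover have "y \<in> interior {0..<c}"
    using assms by (auto simp: interior_atLeastLessThan)
  ultimately show ?thesis by (simp only: at_within_interior)
qed

lemma Bc_lower_bound:
  assumes "z < c"
  obtains d where "0 < d" "\<And>y. 0 \<le> y \<Longrightarrow> y \<le> z \<Longrightarrow> d \<le> Bc y"
proof (cases "0 \<le> z")
  case True
  have "\<exists>x\<in>{0..z}. \<forall>y\<in>{0..z}. Bc x \<le> Bc y"
    by (rule continuous_attains_inf)
       (use True assms in \<open>auto intro!: continuous_on_subset[OF continuous_on_Bc]\<close>)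
  then obtain x where "x \<in> {0..z}" "\<forall>y\<in>{0..z}. Bc x \<le> Bc y" by blast
  then show thesis using Bc_pos[of x] assms by (intro that[of "Bc x"]) auto
qed (use that[of 1] in auto)

lemma continuous_on_U_component: "z \<le> c \<Longrightarrow> continuous_on {0..z} (\<lambda>y. U y $ k)"
  by (intro continuous_intros continuous_on_subset[OF continuous_on_U]) auto

text \<open>\<open>B_k(u) \<le> \<beta> k * (1 - u_k)\<close>, so \<open>1 - U_k\<close> decays at
  most exponentially as long as \<open>Bc\<close> is bounded below. This is what makes monomials
  small for large indices on \<open>{0..y}\<close>.\<close>

lemma U_less_one:
  assumes "0 \<le> y" "y < c"
  shows "U y $ k < 1"
proof -
  obtain d where d: "0 < d" "\<And>x. 0 \<le> x \<Longrightarrow> x \<le> y \<Longrightarrow> d \<le> Bc x"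
    using Bc_lower_bound[OF assms(2)] by blast
  have "1 - U 0 $ k \<le> (1 - U y $ k) * exp (- (- (\<beta> k / d)) * y)"
  proof (rule exponential_lower_bound[OF _ assms(1)])
    show "continuous_on {0..y} (\<lambda>y. 1 - U y $ k)"
      using assms by (intro continuous_intros continuous_on_U_component) simp
    fix t assume t: "0 < t" "t < y"
    have "((\<lambda>y. 1 - U y $ k) has_real_derivative - (gen_fun (b k) (U t) / Bc t)) (at t)"
      using t assms by (auto intro!: derivative_eq_intros U_deriv)
    moreover have "gen_fun (b k) (U t) / Bc t \<le> \<beta> k / d * (1 - U t $ k)"
    proof -
      have nn: "0 \<le> \<beta> k * (1 - U t $ k)"
        using U_bounds[of t k] t assms \<beta>_pos[of k] by simp
      have "gen_fun (b k) (U t) / Bc t \<le> \<beta> k * (1 - U t $ k) / Bc t"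
        using gen_fun_branching_le[OF U_cube[of t], of k] Bc_pos[of t] t assms
        by (intro divide_right_mono) auto
      also have "\<dots> \<le> \<beta> k * (1 - U t $ k) / d"
        using d(1) d(2)[of t] t nn by (intro divide_left_mono mult_pos_pos) auto
      finally show ?thesis by simp
    qed
    ultimately show "\<exists>d'. ((\<lambda>y. 1 - U y $ k) has_real_derivative d') (at t) \<and>
        - (\<beta> k / d) * (1 - U t $ k) \<le> d'"
      by (intro exI conjI) auto
  qed
  then have "0 < (1 - U y $ k) * exp (- (- (\<beta> k / d)) * y)" by (simp add: U_0)
  then show ?thesis by (simp add: zero_less_mult_iff)
qed

text \<open>A comparison principle: off-diagonal coefficients are nonnegative, so no component of
  the curve can cross the equilibrium \<open>q\<close>. The total squared overshoot \<open>M\<close>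
  satisfies a linear differential inequality and starts at 0. At \<open>y = c\<close> the
  denominator vanishes, but there \<open>U c = q\<close>.\<close>

lemma U_le_q:
  assumes "0 \<le> y" "y \<le> c"
  shows "U y \<le> q"
proof (cases "y = c")
  case False
  then have yc: "y < c" using assms by simp
  obtain d where d: "0 < d" "\<And>x. 0 \<le> x \<Longrightarrow> x \<le> y \<Longrightarrow> d \<le> Bc x"
    using Bc_lower_bound[OF yc] by blast
  define z where "z x k = max 0 (U x $ k - q $ k)" for x k
  define M where "M x = (\<Sum>k\<in>UNIV. (z x k)\<^sup>2)" for x
  define L where "L = (\<Sum>k\<in>UNIV. \<Sum>l\<in>UNIV. mean k l)"
  have M0: "0 \<le> M x" for x by (simp add: M_def sum_nonneg)
  have zz: "z x k * z x l \<le> M x" for x k l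
  proof -
    have "(z x k)\<^sup>2 \<le> M x" "(z x l)\<^sup>2 \<le> M x"
      unfolding M_def by (rule member_le_sum; simp)+
    moreover have "2 * z x k * z x l \<le> (z x k)\<^sup>2 + (z x l)\<^sup>2" by (rule sum_squares_bound)
    ultimately show ?thesis by linarith
  qed
  have growth: "z x k * gen_fun (b k) (U x) \<le> (\<Sum>l\<in>UNIV. mean k l) * M x"
    if x: "0 \<le> x" "x \<le> c" for x k
  proof (cases "U x $ k \<le> q $ k")
    case True
    then have "z x k = 0" by (simp add: z_def)
    then show ?thesis using M0 by (simp add: mean_nonneg sum_nonneg)
  next
    case False
    \<comment> \<open>Raising \<open>U x\<close> to \<open>v\<close> only increases the offspring
      series, and \<open>v\<close> exceeds \<open>q\<close> exactly by the overshoots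
      \<open>z x\<close>. Thus \<open>B_k(U x)\<close> is compared with \<open>B_k(q) = 0\<close> in
      terms of overshoots alone.\<close>
    define v where "v = (\<chi> l. max (U x $ l) (q $ l))"
    have v: "v \<in> {0..1}" "U x \<le> v" "\<And>l. \<bar>v $ l - q $ l\<bar> = z x l"
      using U_bounds[OF x] q_bounds by (auto simp: v_def z_def less_eq_vec_def le_max_iff_disj)
    have "gen_fun (b k) (U x) = gen_fun (offspring k) (U x) - \<beta> k * U x $ k"
      by (rule gen_fun_offspring(2)[OF U_cube[OF x]])
    also have "\<dots> \<le> gen_fun (offspring k) v - \<beta> k * q $ k"
    proof (rule diff_mono)
      show "gen_fun (offspring k) (U x) \<le> gen_fun (offspring k) v"
        using U_cube[OF x] v by (intro gen_fun_mono offspring_summable offspring_nonneg) auto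
      show "\<beta> k * q $ k \<le> \<beta> k * U x $ k" using False \<beta>_pos[of k] by simp
    qed
    also have "\<beta> k * q $ k = gen_fun (offspring k) q"
      using q_root[of k] gen_fun_offspring(2)[OF q_cube, of k] by simp
    also have "gen_fun (offspring k) v - gen_fun (offspring k) q \<le> (\<Sum>l\<in>UNIV. mean k l * z x l)"
      using gen_fun_offspring_lipschitz[OF v(1) q_cube, of k] by (simp add: v(3))
    finally have "z x k * gen_fun (b k) (U x) \<le> z x k * (\<Sum>l\<in>UNIV. mean k l * z x l)"
      by (rule mult_left_mono) (simp add: z_def)
    also have "\<dots> = (\<Sum>l\<in>UNIV. mean k l * (z x k * z x l))"
      by (simp add: sum_distrib_left ac_simps)
    also have "\<dots> \<le> (\<Sum>l\<in>UNIV. mean k l * M x)"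
      by (intro sum_mono mult_left_mono zz mean_nonneg)
    finally show ?thesis by (simp add: sum_distrib_right)
  qed
  have "- M 0 \<le> - M y * exp (- (2 * L / d) * y)"
  proof (rule exponential_lower_bound[OF _ assms(1)])
    show "continuous_on {0..y} (\<lambda>x. - M x)"
      unfolding M_def z_def using assms(2)
      by (intro continuous_intros continuous_on_U_component)
    fix t assume t: "0 < t" "t < y"
    have "((\<lambda>x. - M x) has_real_derivative
        - (\<Sum>k\<in>UNIV. 2 * z t k * (gen_fun (b k) (U t) / Bc t))) (at t)"
      unfolding M_def z_def
      by (intro DERIV_minus DERIV_sum has_real_derivative_positive_part_squared)
         (use t yc in \<open>auto intro!: derivative_eq_intros U_deriv\<close>)
    moreover have "(\<Sum>k\<in>UNIV. 2 * z t k * (gen_fun (b k) (U t) / Bc t)) \<le> 2 * L / d * M t"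
    proof -
      have "(\<Sum>k\<in>UNIV. 2 * z t k * (gen_fun (b k) (U t) / Bc t)) =
          2 / Bc t * (\<Sum>k\<in>UNIV. z t k * gen_fun (b k) (U t))"
        by (simp add: sum_distrib_left ac_simps)
      also have "\<dots> \<le> 2 / Bc t * (\<Sum>k\<in>UNIV. (\<Sum>l\<in>UNIV. mean k l) * M t)"
        using t yc Bc_pos[of t] by (intro mult_left_mono sum_mono growth) auto
      also have "\<dots> = 2 / Bc t * (L * M t)" by (simp add: L_def sum_distrib_right)
      also have "\<dots> \<le> 2 / d * (L * M t)"
        using t d(1) d(2)[of t] M0[of t]
        by (intro mult_right_mono divide_left_mono mult_nonneg_nonneg mult_pos_pos)
           (auto simp: L_def mean_nonneg sum_nonneg)
      finally show ?thesis by simp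
    qed
    ultimately show "\<exists>d'. ((\<lambda>x. - M x) has_real_derivative d') (at t) \<and> 2 * L / d * - M t \<le> d'"
      by (intro exI conjI) auto
  qed
  moreover have "M 0 = 0"
    using q_bounds by (simp add: M_def z_def U_0)
  ultimately have "M y * exp (- (2 * L / d) * y) \<le> 0" by simp
  then have "M y = 0" using M0[of y] by (simp add: mult_le_0_iff)
  then have "z y k = 0" for k
    unfolding M_def by (subst (asm) sum_nonneg_eq_0_iff) auto
  then have "U y $ k \<le> q $ k" for k unfolding z_def by (smt (verit) max.cobounded2)
  then show ?thesis by (simp add: less_eq_vec_def)
qed (simp add: U_c)

section \<open>The integrating factor and the weight below the end point\<close>

lemma weight_eq: "w y = 1 / Bc y * E y"
  by (simp add: weight_def E_def Ac_def Bc_def)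

lemma continuous_on_ratio: "continuous_on {0..<c} (\<lambda>x. Ac x / Bc x)"
proof -
  have "\<forall>x\<in>{0..<c}. Bc x \<noteq> 0" using Bc_pos by force
  then show ?thesis
    by (intro continuous_on_divide continuous_on_subset[OF continuous_on_Ac]
        continuous_on_subset[OF continuous_on_Bc]) auto
qed

lemma E_eq: "y < c \<Longrightarrow> E y = exp (integral {0..y} (\<lambda>x. Ac x / Bc x))"
proof -
  assume "y < c"
  then have "continuous_on {0..y} (\<lambda>x. Ac x / Bc x)"
    by (intro continuous_on_subset[OF continuous_on_ratio]) auto
  then have "set_integrable lborel {0..y} (\<lambda>x. Ac x / Bc x)"
    by (rule borel_integrable_atLeastAtMost')
  then show ?thesis by (simp add: E_def set_borel_integral_eq_integral(2))
qed

lemma E_pos: "0 < E y" and E_0: "E 0 = 1"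
  using E_eq[of 0] c_pos by (auto simp: E_def[of y])

lemma continuous_on_E: "continuous_on {0..<c} E"
proof -
  have "continuous_on {0..<c} (\<lambda>y. exp (integral {0..y} (\<lambda>x. Ac x / Bc x)))"
  proof (rule continuous_on_exp)
    show "continuous_on {0..<c} (\<lambda>y. integral {0..y} (\<lambda>x. Ac x / Bc x))"
      unfolding continuous_on_eq_continuous_within
    proof
      fix y assume y: "y \<in> {0..<c}"
      define z where "z = (y + c) / 2"
      have z: "y < z" "z < c" using y by (auto simp: z_def)
      have "continuous (at y within {0..z}) (\<lambda>y. integral {0..y} (\<lambda>x. Ac x / Bc x))"
        using continuous_on_integral_Icc[OF continuous_on_ratio z(2)] y z
        by (auto simp: continuous_on_eq_continuous_within)
      moreover have "at y within {0..z} = at y within {0..<c}"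
        by (rule at_within_nhd[of _ "{..<z}"]) (use y z in auto)
      ultimately show "continuous (at y within {0..<c}) (\<lambda>y. integral {0..y} (\<lambda>x. Ac x / Bc x))"
        by simp
    qed
  qed
  then show ?thesis by (rule continuous_on_cong[THEN iffD1, rotated 2]) (auto simp: E_eq)
qed

lemma E_deriv:
  assumes "0 < y" "y < c"
  shows "(E has_real_derivative Ac y * w y) (at y)"
proof -
  have "((\<lambda>y. exp (integral {0..y} (\<lambda>x. Ac x / Bc x))) has_real_derivative
      exp (integral {0..y} (\<lambda>x. Ac x / Bc x)) * (Ac y / Bc y)) (at y)"
    by (rule DERIV_chain2[OF DERIV_exp integral_Icc_DERIV[OF continuous_on_ratio assms]])
  then have "((\<lambda>y. exp (integral {0..y} (\<lambda>x. Ac x / Bc x))) has_real_derivative Ac y * w y) (at y)"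
    using assms by (simp add: weight_eq E_eq mult.commute)
  then show ?thesis
    by (rule has_field_derivative_transform_within_open[of _ _ _ "{0<..<c}"]) (use assms E_eq in auto)
qed

lemma w_pos: "0 \<le> y \<Longrightarrow> y < c \<Longrightarrow> 0 < w y"
  using Bc_pos[of y] E_pos[of y] by (simp add: weight_eq)

lemma continuous_on_w: "continuous_on {0..<c} w"
proof -
  have "\<forall>x\<in>{0..<c}. Bc x \<noteq> 0" using Bc_pos by force
  then have "continuous_on {0..<c} (\<lambda>y. 1 / Bc y * E y)"
    by (intro continuous_on_mult continuous_on_divide continuous_on_const continuous_on_E
        continuous_on_subset[OF continuous_on_Bc]) auto
  then show ?thesis by (simp add: weight_eq[abs_def])
qed

lemma continuous_on_integrand: "continuous_on {0..<c} (\<lambda>x. monomial (U x) j * w x)"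
  by (intro continuous_on_mult continuous_on_w continuous_on_compose2[OF continuous_on_monomial]
      continuous_on_subset[OF continuous_on_U]) auto

lemma integrand_nonneg: "0 \<le> x \<Longrightarrow> x < c \<Longrightarrow> 0 \<le> monomial (U x) j * w x"
  using U_cube[of x] w_pos[of x] monomial_nonneg[of "U x" j] by auto

section \<open>The partial integrals and their balance equation\<close>

definition "W y j = integral {0..y} (\<lambda>x. monomial (U x) j * w x)"

lemma W_0: "W 0 j = 0"
  by (simp add: W_def)

lemma W_deriv: "0 < y \<Longrightarrow> y < c \<Longrightarrow> ((\<lambda>y. W y j) has_real_derivative monomial (U y) j * w y) (at y)"
  unfolding W_def by (rule integral_Icc_DERIV[OF continuous_on_integrand])

lemma continuous_on_W: "z < c \<Longrightarrow> continuous_on {0..z} (\<lambda>y. W y j)"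
  unfolding W_def by (rule continuous_on_integral_Icc[OF continuous_on_integrand])

lemma W_has_integral:
  assumes "0 \<le> y" "y < c"
  shows "((\<lambda>x. monomial (U x) j * w x) has_integral W y j) {0..y}"
  unfolding W_def using assms
  by (intro integrable_integral integrable_continuous_interval
      continuous_on_subset[OF continuous_on_integrand]) auto

lemma W_nonneg: "0 \<le> y \<Longrightarrow> y < c \<Longrightarrow> 0 \<le> W y j"
  by (rule has_integral_nonneg[OF W_has_integral]) (auto intro: integrand_nonneg)

lemma W_nn_integral:
  assumes "0 \<le> y" "y < c"
  shows "(\<integral>\<^sup>+x. ennreal (indicator {0..y} x * (monomial (U x) j * w x)) \<partial>lborel) = ennreal (W y j)"
  by (rule nn_integral_has_integral_lebesgue[OF _ W_has_integral[OF assms]])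
     (use assms integrand_nonneg in auto)

lemma boundary_deriv:
  assumes x: "0 < x" "x < c"
  shows "((\<lambda>y. monomial (U y) i * E y) has_real_derivative drift i (U x) * w x) (at x)"
proof -
  note mon = monomial_has_real_derivative[of U, OF U_deriv[OF x]]
  have "((\<lambda>y. monomial (U y) i * E y) has_real_derivative
    (\<Sum>k\<in>UNIV. real (i $ k) * monomial (U x) (i - axis k 1) * (gen_fun (b k) (U x) / Bc x)) * E x +
    (Ac x * w x) * monomial (U x) i) (at x)"
    by (rule DERIV_mult'[THEN DERIV_cong, OF mon E_deriv[OF x]]) (simp add: mult.commute)
  moreover have "(\<Sum>k\<in>UNIV. real (i $ k) * monomial (U x) (i - axis k 1) * (gen_fun (b k) (U x) / Bc x)) * E x +
    (Ac x * w x) * monomial (U x) i = drift i (U x) * w x"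
  proof -
    have aux: "T / B * F + (A * (1 / B * F)) * m = (m * A + T) * (1 / B * F)" for T B F A m :: real
      by (simp add: algebra_simps add_divide_distrib)
    have "(\<Sum>k\<in>UNIV. real (i $ k) * monomial (U x) (i - axis k 1) * (gen_fun (b k) (U x) / Bc x)) =
      (\<Sum>k\<in>UNIV. real (i $ k) * monomial (U x) (i - axis k 1) * gen_fun (b k) (U x)) / Bc x"
      by (simp add: sum_divide_distrib)
    then show ?thesis by (simp only: drift_def weight_eq Ac_def aux)
  qed
  ultimately show ?thesis by (simp only:)
qed

lemma boundary_has_integral:
  assumes i: "i \<noteq> 0" and y: "0 \<le> y" "y < c"
  shows "((\<lambda>x. drift i (U x) * w x) has_integral monomial (U y) i * E y) {0..y}"
proof -
  have "((\<lambda>x. drift i (U x) * w x) has_integral monomial (U y) i * E y - monomial (U 0) i * E 0) {0..y}"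
  proof (rule fundamental_theorem_of_calculus_interior[OF y(1)])
    show "continuous_on {0..y} (\<lambda>x. monomial (U x) i * E x)"
      using y by (intro continuous_on_mult continuous_on_subset[OF continuous_on_E]
          continuous_on_compose2[OF continuous_on_monomial] continuous_on_subset[OF continuous_on_U]) auto
    fix x assume "x \<in> {0<..<y}"
    then show "((\<lambda>x. monomial (U x) i * E x) has_vector_derivative drift i (U x) * w x) (at x)"
      using boundary_deriv[of x i] y by (simp add: has_real_derivative_iff_has_vector_derivative)
  qed
  then show ?thesis using i by (simp add: U_0 monomial_zero)
qed

text \<open>Tonelli exchanges the row sum with the integral along the curve. With the diagonal term
  kept on the right all quantities are nonnegative, so the exchange needs no separate
  integrability.\<close>

lemma W_balance:
  assumes i: "i \<noteq> 0" and y: "0 \<le> y" "y < c"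
  shows "(\<integral>\<^sup>+k. ennreal (Q i k) * ennreal (W y k) \<partial>count_space (- {i})) =
    ennreal (monomial (U y) i * E y - Q i i * W y i)"
proof -
  have meas: "(\<lambda>x. ennreal (indicator {0..y} x * (monomial (U x) k * w x))) \<in> borel_measurable lborel" for k
  proof -
    have "continuous_on {0..y} (\<lambda>x. monomial (U x) k * w x)"
      using y by (intro continuous_on_subset[OF continuous_on_integrand]) auto
    then have "set_borel_measurable lborel {0..y} (\<lambda>x. monomial (U x) k * w x)"
      using set_integrable_def borel_integrable_atLeastAtMost'
      by (metis borel_measurable_integrable set_borel_measurable_def)
    then show ?thesis by (simp add: set_borel_measurable_def)
  qed
  have "(\<integral>\<^sup>+k. ennreal (Q i k) * ennreal (W y k) \<partial>count_space (- {i})) =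
      (\<integral>\<^sup>+k. (\<integral>\<^sup>+x. ennreal (Q i k) * ennreal (indicator {0..y} x * (monomial (U x) k * w x)) \<partial>lborel) \<partial>count_space (- {i}))"
    by (subst nn_integral_cmult) (use meas in \<open>auto simp: W_nn_integral[OF y]\<close>)
  also have "\<dots> = (\<integral>\<^sup>+x. (\<integral>\<^sup>+k. ennreal (Q i k) * ennreal (indicator {0..y} x * (monomial (U x) k * w x)) \<partial>count_space (- {i})) \<partial>lborel)"
    using meas by (intro nn_integral_count_space_nn_integral[symmetric]) auto
  also have "\<dots> = (\<integral>\<^sup>+x. ennreal (indicator {0..y} x * (drift i (U x) * w x - Q i i * (monomial (U x) i * w x))) \<partial>lborel)"
  proof (rule nn_integral_cong)
    fix x :: real
    show "(\<integral>\<^sup>+k. ennreal (Q i k) * ennreal (indicator {0..y} x * (monomial (U x) k * w x)) \<partial>count_space (- {i}))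
      = ennreal (indicator {0..y} x * (drift i (U x) * w x - Q i i * (monomial (U x) i * w x)))"
    proof (cases "x \<in> {0..y}")
      case True
      then have x: "0 \<le> x" "x < c" using y by auto
      have u: "U x \<in> {0..1}" using U_cube[of x] x by simp
      have "(\<integral>\<^sup>+k. ennreal (Q i k) * ennreal (indicator {0..y} x * (monomial (U x) k * w x)) \<partial>count_space (- {i}))
        = (\<integral>\<^sup>+k. (ennreal (Q i k) * ennreal (monomial (U x) k)) * ennreal (w x) \<partial>count_space (- {i}))"
        using True u w_pos[OF x] by (intro nn_integral_cong) (simp add: ennreal_mult monomial_nonneg mult.assoc)
      also have "\<dots> = ennreal (drift i (U x) - Q i i * monomial (U x) i) * ennreal (w x)"
        by (simp add: nn_integral_multc Q_offdiag_nn_integral(1)[OF i u])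
      also have "\<dots> = ennreal ((drift i (U x) - Q i i * monomial (U x) i) * w x)"
        using Q_offdiag_nn_integral(2)[OF i u] w_pos[OF x] by (simp add: ennreal_mult)
      finally show ?thesis using True by (simp add: left_diff_distrib mult.assoc)
    qed simp
  qed
  also have "\<dots> = ennreal (monomial (U y) i * E y - Q i i * W y i)"
  proof (rule nn_integral_has_integral_lebesgue)
    show "((\<lambda>x. drift i (U x) * w x - Q i i * (monomial (U x) i * w x)) has_integral
        monomial (U y) i * E y - Q i i * W y i) {0..y}"
      by (intro has_integral_diff has_integral_mult_right boundary_has_integral[OF i y] W_has_integral[OF y])
    fix x assume "x \<in> {0..y}"
    then have "0 \<le> (drift i (U x) - Q i i * monomial (U x) i) * w x"
      using Q_offdiag_nn_integral(2)[OF i U_cube[of x]] w_pos[of x] y by simp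
    then show "0 \<le> drift i (U x) * w x - Q i i * (monomial (U x) i * w x)"
      by (simp add: left_diff_distrib mult.assoc)
  qed
  finally show ?thesis .
qed

end

section \<open>The extinction probability\<close>

context branching_along_curve
begin

text \<open>The difference has the derivative \<open>(r - monomial (U y) i) * w y\<close>. With
  \<open>W 0 j = 0\<close> it bounds \<open>W y i\<close> by \<open>r * W y 0\<close>.\<close>

lemma W_mono:
  assumes "0 \<le> x" "x \<le> y" "y < c" and "\<And>t. x < t \<Longrightarrow> t < y \<Longrightarrow> monomial (U t) i \<le> r"
  shows "r * W x 0 - W x i \<le> r * W y 0 - W y i"
proof (rule DERIV_nonneg_imp_increasing_open[OF assms(2), of "\<lambda>y. r * W y 0 - W y i"])
  fix t assume t: "x < t" "t < y"
  have "((\<lambda>y. r * W y 0 - W y i) has_real_derivative r * (monomial (U t) 0 * w t) - monomial (U t) i * w t) (at t)"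
    using t assms by (intro DERIV_diff DERIV_cmult W_deriv) auto
  moreover have "0 \<le> (r - monomial (U t) i) * w t"
    using assms(4)[OF t] w_pos[of t] t assms by simp
  ultimately show "\<exists>d. ((\<lambda>y. r * W y 0 - W y i) has_real_derivative d) (at t) \<and> 0 \<le> d"
    by (intro exI conjI) (auto simp: left_diff_distrib)
qed (use assms in \<open>intro continuous_intros continuous_on_subset[OF continuous_on_W[of y]]; auto\<close>)

text \<open>\<open>r k\<close>, the maximum of \<open>U_k\<close> on the compact interval, is less
  than 1, and \<open>W y j \<le> r k ^ (j $ k) * W y 0\<close> for every \<open>k\<close>. So a
  value of at least \<open>\<epsilon>\<close> limits each coordinate of \<open>j\<close>.\<close>

lemma W_vanishes:
  assumes y: "0 \<le> y" "y < c" and \<epsilon>: "0 < \<epsilon>"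
  shows "finite {j. \<epsilon> \<le> W y j}"
proof -
  have "\<exists>x\<in>{0..y}. \<forall>t\<in>{0..y}. U t $ k \<le> U x $ k" for k
    by (rule continuous_attains_sup) (use y continuous_on_U_component in auto)
  then obtain x where x: "\<And>k. x k \<in> {0..y}" "\<And>k t. t \<in> {0..y} \<Longrightarrow> U t $ k \<le> U (x k) $ k"
    by metis
  define r where "r k = U (x k) $ k" for k
  have r: "0 \<le> r k" "r k < 1" for k
    using x(1)[of k] y U_less_one[of "x k" k] U_bounds[of "x k" k] by (auto simp: r_def)
  have "\<exists>N. \<forall>n\<ge>N. r k ^ n * W y 0 < \<epsilon>" for k
  proof -
    have "(\<lambda>n. r k ^ n * W y 0) \<longlonglongrightarrow> 0 * W y 0"
      using r by (intro tendsto_mult tendsto_const LIMSEQ_realpow_zero) auto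
    then have "\<forall>\<^sub>F n in sequentially. r k ^ n * W y 0 < \<epsilon>"
      using \<epsilon> by (intro order_tendstoD) auto
    then show ?thesis by (simp add: eventually_sequentially)
  qed
  then obtain N where N: "\<And>k n. N k \<le> n \<Longrightarrow> r k ^ n * W y 0 < \<epsilon>" by metis
  have "j $ k < Max (range N)" if j: "\<epsilon> \<le> W y j" for j k
  proof (rule ccontr)
    assume "\<not> ?thesis"
    then have "N k \<le> j $ k" by (meson Max_ge finite finite_imageI leI order_trans rangeI)
    have "r k ^ (j $ k) * W 0 0 - W 0 j \<le> r k ^ (j $ k) * W y 0 - W y j"
    proof (rule W_mono[OF order_refl y])
      fix t assume t: "0 < t" "t < y"
      have "monomial (U t) j \<le> (U t $ k) ^ (j $ k)"
        using t y by (intro monomial_le_power U_cube) auto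
      also have "\<dots> \<le> r k ^ (j $ k)"
        unfolding r_def using t y U_bounds[of t k] by (intro power_mono x(2)) auto
      finally show "monomial (U t) j \<le> r k ^ (j $ k)" .
    qed
    then show False using N[OF \<open>N k \<le> j $ k\<close>] j by (simp add: W_0)
  qed
  then have "{j. \<epsilon> \<le> W y j} \<subseteq> {j. \<forall>k. j $ k < Max (range N)}" by blast
  then show ?thesis by (rule finite_subset) (rule finite_bounded_vec)
qed

lemma W_le_extinction_prob:
  assumes y: "0 \<le> y" "y < c"
  shows "W y i \<le> W y 0 * extinction_prob a b i"
proof (rule subharmonic_le_extinction_prob[of "W y", OF W_nonneg[OF y] W_vanishes[OF y]])
  fix i :: "nat^'n" assume i: "i \<noteq> 0"
  have "0 \<le> monomial (U y) i * E y"
    using U_cube[of y] y E_pos[of y] by (intro mult_nonneg_nonneg monomial_nonneg) auto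
  then show "ennreal (- Q i i * W y i) \<le> (\<integral>\<^sup>+k. ennreal (Q i k) * ennreal (W y k) \<partial>count_space (- {i}))"
    unfolding W_balance[OF i y] by (intro ennreal_leI) simp
qed

text \<open>Approximate superharmonicity with error \<open>E y\<close>, in the finite form required
  by \<open>extinction_prob_le_superharmonic\<close>.\<close>

lemma W_finite_sum_le:
  assumes i: "i \<noteq> 0" and y: "0 \<le> y" "y < c" and F: "finite F" "i \<notin> F"
  shows "(\<Sum>j\<in>F. Q i j * W y j) \<le> E y - Q i i * W y i"
proof -
  have nonneg: "0 \<le> Q i j * W y j" if "j \<in> F" for j
  proof -
    have "j \<noteq> i" using that F by auto
    then show ?thesis by (intro mult_nonneg_nonneg Q_offdiag_nonneg W_nonneg y)
  qed
  have mon: "monomial (U y) i * E y \<le> E y"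
    using monomial_le_one[OF U_cube[of y], of i] E_pos[of y] y by simp
  have "ennreal (\<Sum>j\<in>F. Q i j * W y j) = (\<Sum>j\<in>F. ennreal (Q i j * W y j))"
    by (rule sum_ennreal[symmetric]) (rule nonneg)
  also have "\<dots> = (\<Sum>j\<in>F. ennreal (Q i j) * ennreal (W y j))"
  proof (rule sum.cong[OF refl])
    fix j assume "j \<in> F"
    then have "j \<noteq> i" using F(2) by auto
    then show "ennreal (Q i j * W y j) = ennreal (Q i j) * ennreal (W y j)"
      by (intro ennreal_mult Q_offdiag_nonneg W_nonneg y)
  qed
  also have "\<dots> = (\<integral>\<^sup>+j. ennreal (Q i j) * ennreal (W y j) \<partial>count_space F)"
    by (simp add: nn_integral_count_space_finite F(1))
  also have "\<dots> = (\<integral>\<^sup>+j. ennreal (Q i j) * ennreal (W y j) * indicator F j \<partial>count_space UNIV)"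
    by (rule nn_integral_count_space_indicator) simp
  also have "\<dots> \<le> (\<integral>\<^sup>+j. ennreal (Q i j) * ennreal (W y j) * indicator (- {i}) j \<partial>count_space UNIV)"
    using F(2) by (intro nn_integral_mono mult_left_mono) (auto simp: indicator_def)
  also have "\<dots> = (\<integral>\<^sup>+j. ennreal (Q i j) * ennreal (W y j) \<partial>count_space (- {i}))"
    by (rule nn_integral_count_space_indicator[symmetric]) simp
  also have "\<dots> = ennreal (monomial (U y) i * E y - Q i i * W y i)" by (rule W_balance[OF i y])
  also have "\<dots> \<le> ennreal (E y - Q i i * W y i)" using mon by (intro ennreal_leI) simp
  finally show ?thesis
    using Q_diag_neg[OF i] W_nonneg[OF y, of i] E_pos[of y]
    by (subst (asm) ennreal_le_iff) (auto simp: mult_nonpos_nonneg less_imp_le intro: order_trans[of _ 0])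
qed

lemma E_antimono:
  assumes "0 \<le> x" "x \<le> y" "y < c"
  shows "E y \<le> E x"
proof (rule DERIV_nonpos_imp_decreasing_open[OF assms(2)])
  show "continuous_on {x..y} E"
    using assms by (intro continuous_on_subset[OF continuous_on_E]) auto
  fix t assume t: "x < t" "t < y"
  have "gen_fun a (U t) \<le> gen_fun a 1"
    using U_cube[of t] t assms by (intro gen_fun_immigration_le) auto
  then have "Ac t * w t \<le> 0"
    using w_pos[of t] t assms by (simp add: Ac_def gen_fun_immigration_one mult_nonpos_nonneg)
  then show "\<exists>d. (E has_real_derivative d) (at t) \<and> d \<le> 0"
    using E_deriv[of t] t assms by (intro exI conjI) auto
qed

section \<open>The limit at the end point when the weight is integrable\<close>

definition "H j = (LBINT y:{0<..<c}. monomial (U y) j * w y)"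

text \<open>The bound \<open>K\<close> expresses integrability of the weight and lets the
  subcritical case with finite \<open>J\<close> and the supercritical case share one
  argument.\<close>

context
  fixes K :: real
  assumes K: "\<And>y. 0 \<le> y \<Longrightarrow> y < c \<Longrightarrow> W y 0 \<le> K"
begin

lemma W_le_K: "0 \<le> y \<Longrightarrow> y < c \<Longrightarrow> W y j \<le> K"
  using W_mono[of 0 y j 1] monomial_le_one[OF U_cube] K[of y] by (force simp: W_0)

lemma w_integrable: "set_integrable lborel {0<..<c} w"
  using integral_Icc_bounded_limit(1)[OF continuous_on_integrand[of 0] c_pos integrand_nonneg, of K] K
  by (simp add: W_def)

lemma W_tendsto_H: "((\<lambda>y. W y j) \<longlongrightarrow> H j) (at_left c)"
  unfolding W_def H_def
  by (rule integral_Icc_bounded_limit(2)[OF continuous_on_integrand c_pos integrand_nonneg])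
     (use W_le_K in \<open>auto simp: W_def\<close>)

lemma at_left_c: "\<forall>\<^sub>F y in at_left c. 0 < y \<and> y < c"
  using eventually_at_left_real[OF c_pos] by eventually_elim auto

text \<open>Since \<open>Bc y \<le> \<beta> e * (c - y)\<close> on the curve, \<open>1 / Bc\<close> is not integrable at \<open>c\<close>.\<close>

lemma E_tendsto_0: "(E \<longlongrightarrow> 0) (at_left c)"
proof (rule order_tendstoI)
  fix l :: real assume "l < 0"
  then have "l < E y" for y using E_pos[of y] by simp
  then show "\<forall>\<^sub>F y in at_left c. l < E y" by simp
next
  fix l :: real assume l: "0 < l"
  have "\<exists>y. 0 \<le> y \<and> y < c \<and> E y < l"
  proof (rule ccontr)
    assume "\<not> ?thesis"
    then have E: "l \<le> E y" if "0 \<le> y" "y < c" for y using that by force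
    define s where "s = l / \<beta> e"
    have s: "0 < s" using l \<beta>_pos by (simp add: s_def)
    \<comment> \<open>If \<open>E\<close> stayed above \<open>l\<close>, the weight would be at
      least \<open>s / (c - t)\<close>, whose integral grows logarithmically.\<close>
    have bound: "W 0 0 + s * ln (c - 0) \<le> W y 0 + s * ln (c - y)" if y: "0 \<le> y" "y < c" for y
    proof (rule DERIV_nonneg_imp_increasing_open[OF y(1), of "\<lambda>y. W y 0 + s * ln (c - y)"])
      show "continuous_on {0..y} (\<lambda>y. W y 0 + s * ln (c - y))"
        using y by (intro continuous_intros continuous_on_W) auto
      fix t assume t: "0 < t" "t < y"
      have Bt: "0 < Bc t" "Bc t \<le> \<beta> e * (c - t)"
      proof -
        show "0 < Bc t" using Bc_pos t y by simp
        \<comment> \<open>\<open>U \<le> q\<close> enters here: it bounds the offspring series along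
          the curve by its value \<open>\<beta> e * c\<close> at the root.\<close>
        have "gen_fun (offspring e) (U t) \<le> gen_fun (offspring e) q"
          using U_le_q[of t] U_cube[of t] q_cube t y
          by (intro gen_fun_mono offspring_summable offspring_nonneg) auto
        also have "\<dots> = \<beta> e * c"
          using q_root[of e] gen_fun_offspring(2)[OF q_cube, of e] by (simp add: c_def)
        finally show "Bc t \<le> \<beta> e * (c - t)"
          using gen_fun_offspring(2)[OF U_cube[of t], of e] U_e[of t] t y
          by (simp add: Bc_def right_diff_distrib)
      qed
      have "((\<lambda>y. W y 0 + s * ln (c - y)) has_real_derivative
          monomial (U t) 0 * w t + s * (1 / (c - t) * (0 - 1))) (at t)"
        using t y by (intro DERIV_add W_deriv DERIV_cmult DERIV_chain2[OF DERIV_ln_divide] DERIV_diff) auto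
      moreover have "s / (c - t) \<le> w t"
      proof -
        have "s / (c - t) = l / (\<beta> e * (c - t))" by (simp add: s_def)
        also have "\<dots> \<le> E t / Bc t"
          using Bt E[of t] l t y by (intro frac_le) auto
        finally show ?thesis by (simp add: weight_eq)
      qed
      ultimately show "\<exists>d. ((\<lambda>y. W y 0 + s * ln (c - y)) has_real_derivative d) (at t) \<and> 0 \<le> d"
        by (intro exI conjI) auto
    qed
    \<comment> \<open>Chosen so that the logarithm drops by exactly \<open>K + 1\<close>, which
      would force \<open>W y 0 \<ge> K + 1\<close>.\<close>
    define y where "y = c - c * exp (- (K + 1) / s)"
    have "0 \<le> K" using K[of 0] c_pos by (simp add: W_0)
    then have "exp (- (K + 1) / s) \<le> 1" using s by (simp add: divide_nonpos_pos)
    then have y: "0 \<le> y" "y < c"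
      using c_pos by (auto simp: y_def mult_left_le)
    have "s * ln (c - y) = s * ln c - (K + 1)"
      using s c_pos by (simp add: y_def ln_mult field_simps)
    then show False using bound[OF y] K[OF y] by (simp add: W_0)
  qed
  then obtain y0 where y0: "0 \<le> y0" "y0 < c" "E y0 < l" by blast
  show "\<forall>\<^sub>F y in at_left c. E y < l"
  proof (rule eventually_mono[OF eventually_at_left_real[OF y0(2)]])
    fix y assume "y \<in> {y0<..<c}"
    then show "E y < l" using E_antimono[of y0 y] y0 by simp
  qed
qed

text \<open>Near the origin of the curve \<open>monomial (U t) i\<close> is close to 0, hence
  strictly below \<open>r\<close>. The gain made on this initial piece cannot be lost later, by
  \<open>W_mono\<close>.\<close>

lemma H_strict:
  assumes i: "i \<noteq> 0" and r: "0 < r" "\<And>t. 0 \<le> t \<Longrightarrow> t < c \<Longrightarrow> monomial (U t) i \<le> r"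
  shows "H i < r * H 0"
proof -
  have "continuous_on {0..c} (\<lambda>t. monomial (U t) i)"
    by (intro continuous_on_compose2[OF continuous_on_monomial continuous_on_U]) auto
  then have "((\<lambda>t. monomial (U t) i) \<longlongrightarrow> monomial (U 0) i) (at_right 0)"
    using c_pos unfolding continuous_on_def
    by (metis at_within_Icc_at_right atLeastAtMost_iff less_imp_le order_refl)
  then have "\<forall>\<^sub>F t in at_right 0. monomial (U t) i < r"
    using i r by (intro order_tendstoD) (auto simp: U_0 monomial_zero)
  then obtain y1 where y1: "0 < y1" "\<And>t. 0 < t \<Longrightarrow> t < y1 \<Longrightarrow> monomial (U t) i < r"
    by (auto simp: eventually_at_right_field)
  define y0 where "y0 = min y1 (c / 2)"
  have y0: "0 < y0" "y0 < c" "y0 \<le> y1" using y1 c_pos by (auto simp: y0_def)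
  have "r * W 0 0 - W 0 i < r * W y0 0 - W y0 i"
  proof (rule DERIV_pos_imp_increasing_open[OF y0(1), of "\<lambda>y. r * W y 0 - W y i"])
    fix t assume t: "0 < t" "t < y0"
    have "((\<lambda>y. r * W y 0 - W y i) has_real_derivative r * (monomial (U t) 0 * w t) - monomial (U t) i * w t) (at t)"
      using t y0 by (intro DERIV_diff DERIV_cmult W_deriv) auto
    moreover have "0 < (r - monomial (U t) i) * w t"
      using y1(2)[of t] w_pos[of t] t y0 by simp
    ultimately show "\<exists>d. ((\<lambda>y. r * W y 0 - W y i) has_real_derivative d) (at t) \<and> 0 < d"
      by (intro exI conjI) (auto simp: left_diff_distrib)
  qed (intro continuous_intros continuous_on_W y0)
  moreover have "r * W y0 0 - W y0 i \<le> r * H 0 - H i"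
  proof (rule tendsto_lowerbound)
    show "((\<lambda>y. r * W y 0 - W y i) \<longlongrightarrow> r * H 0 - H i) (at_left c)"
      by (intro tendsto_intros W_tendsto_H)
    show "\<forall>\<^sub>F y in at_left c. r * W y0 0 - W y0 i \<le> r * W y 0 - W y i"
    proof (rule eventually_mono[OF eventually_at_left_real[OF y0(2)]])
      fix y assume "y \<in> {y0<..<c}"
      then show "r * W y0 0 - W y0 i \<le> r * W y 0 - W y i"
        using y0 r(2) by (intro W_mono) auto
    qed
  qed simp
  ultimately show ?thesis by (simp add: W_0)
qed

text \<open>Strictness for a single nonzero index with \<open>r = 1\<close> gives
  \<open>0 \<le> H i < H 0\<close>.\<close>

lemma H_pos: "0 < H 0"
proof -
  define i :: "nat^'n" where "i = axis e 1"
  have "i \<noteq> 0" by (simp add: i_def axis_eq_0_iff)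
  then have "H i < 1 * H 0"
    using monomial_le_one[OF U_cube] by (intro H_strict) auto
  moreover have "0 \<le> H i"
  proof (rule tendsto_lowerbound[OF W_tendsto_H])
    show "\<forall>\<^sub>F y in at_left c. 0 \<le> W y i"
      using at_left_c by eventually_elim (auto intro: W_nonneg)
  qed simp
  ultimately show ?thesis by simp
qed

lemma extinction_prob_eq: "extinction_prob a b i = H i / H 0"
proof (rule antisym)
  have H_nonneg: "0 \<le> H j" for j
  proof (rule tendsto_lowerbound[OF W_tendsto_H])
    show "\<forall>\<^sub>F y in at_left c. 0 \<le> W y j"
      using at_left_c by eventually_elim (auto intro: W_nonneg)
  qed simp
  show "extinction_prob a b i \<le> H i / H 0"
  proof (rule extinction_prob_le_superharmonic)
    fix i :: "nat^'n" and F assume i: "i \<noteq> 0" and F: "finite F" "i \<notin> F"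
    have "(\<Sum>j\<in>F. Q i j * H j) \<le> 0 - Q i i * H i"
    proof (rule tendsto_le)
      show "((\<lambda>y. E y - Q i i * W y i) \<longlongrightarrow> 0 - Q i i * H i) (at_left c)"
        by (intro tendsto_intros E_tendsto_0 W_tendsto_H)
      show "((\<lambda>y. \<Sum>j\<in>F. Q i j * W y j) \<longlongrightarrow> (\<Sum>j\<in>F. Q i j * H j)) (at_left c)"
        by (intro tendsto_intros W_tendsto_H)
      show "\<forall>\<^sub>F y in at_left c. (\<Sum>j\<in>F. Q i j * W y j) \<le> E y - Q i i * W y i"
        using at_left_c by eventually_elim (rule W_finite_sum_le[OF i _ _ F], auto)
    qed simp
    then have "(\<Sum>j\<in>F. Q i j * H j) / H 0 \<le> (- Q i i * H i) / H 0"
      using H_pos by (intro divide_right_mono) auto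
    then show "(\<Sum>j\<in>F. Q i j * (H j / H 0)) \<le> - Q i i * (H i / H 0)"
      by (simp add: sum_divide_distrib)
  qed (use H_nonneg H_pos in auto)
  have "H i \<le> H 0 * extinction_prob a b i"
  proof (rule tendsto_le)
    show "((\<lambda>y. W y 0 * extinction_prob a b i) \<longlongrightarrow> H 0 * extinction_prob a b i) (at_left c)"
      by (intro tendsto_intros W_tendsto_H)
    show "\<forall>\<^sub>F y in at_left c. W y i \<le> W y 0 * extinction_prob a b i"
      using at_left_c by eventually_elim (auto intro: W_le_extinction_prob)
  qed (auto intro: W_tendsto_H)
  then show "H i / H 0 \<le> extinction_prob a b i"
    using H_pos by (simp add: divide_le_eq mult.commute)
qed

lemma extinction_prob_eq_ratio: "extinction_prob a b i = extinction_ratio a b e U c i"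
  using extinction_prob_eq[of i] by (simp add: extinction_ratio_def H_def)

lemma extinction_prob_less:
  assumes "i \<noteq> 0" "0 < r" "\<And>t. 0 \<le> t \<Longrightarrow> t < c \<Longrightarrow> monomial (U t) i \<le> r"
  shows "extinction_prob a b i < r"
  using H_strict[OF assms] H_pos by (simp add: extinction_prob_eq divide_less_eq)

end

section \<open>Boundedness of the partial integrals and the role of \<open>J\<close>\<close>

lemma monomial_U_le_q: "0 \<le> t \<Longrightarrow> t < c \<Longrightarrow> monomial (U t) i \<le> monomial q i"
  using U_le_q[of t] U_cube[of t] by (intro monomial_mono) auto

text \<open>Immigration loses mass at \<open>q\<close>, so \<open>A(q) < 0\<close>, and
  \<open>A \<le> A(q)\<close> along the curve. As \<open>E' = A w\<close>, the decrease of
  \<open>E\<close> from 1, which is less than 1 in total, controls \<open>- A(q)\<close> times the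
  integral of the weight.\<close>

lemma W_bounded_if_subunit_root:
  assumes "\<And>k. q $ k < 1" "0 \<le> y" "y < c"
  shows "W y 0 \<le> - 1 / gen_fun a q"
proof -
  obtain j where j: "j \<noteq> 0" "0 < a j" using immigration_pos by blast
  have neg: "gen_fun a q < 0"
  proof -
    obtain l where l: "0 < j $ l" using index_pos[OF j(1)] by blast
    have "monomial q j < 1"
      using monomial_le_component[OF q_cube l] assms(1)[of l] by simp
    then have "immigration j * monomial q j < immigration j"
      using j by (simp add: immigration_def)
    moreover have "immigration i * monomial q i \<le> immigration i" for i
      using monomial_le_one[OF q_cube] immigration_nonneg[of i] by (simp add: mult_left_le)
    ultimately have "gen_fun immigration q < \<alpha>"
      using has_sum_strict_mono[OF gen_fun_has_sum[OF immigration_summable q_cube] immigration_has_sum]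
      by blast
    then show ?thesis by (simp add: gen_fun_immigration(2)[OF q_cube])
  qed
  have "gen_fun a q * W 0 0 - E 0 \<le> gen_fun a q * W y 0 - E y"
  proof (rule DERIV_nonneg_imp_increasing_open[OF assms(2), of "\<lambda>y. gen_fun a q * W y 0 - E y"])
    show "continuous_on {0..y} (\<lambda>y. gen_fun a q * W y 0 - E y)"
      using assms by (intro continuous_intros continuous_on_W continuous_on_subset[OF continuous_on_E]) auto
    fix t assume t: "0 < t" "t < y"
    have "gen_fun a (U t) \<le> gen_fun a q"
      using U_le_q[of t] U_cube[of t] q_cube t assms by (intro gen_fun_immigration_le) auto
    then have "0 \<le> (gen_fun a q - Ac t) * w t"
      using w_pos[of t] t assms by (simp add: Ac_def)
    moreover have "((\<lambda>y. gen_fun a q * W y 0 - E y) has_real_derivative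
        gen_fun a q * (monomial (U t) 0 * w t) - Ac t * w t) (at t)"
      using t assms by (intro DERIV_diff DERIV_cmult W_deriv E_deriv) auto
    ultimately show "\<exists>d. ((\<lambda>y. gen_fun a q * W y 0 - E y) has_real_derivative d) (at t) \<and> 0 \<le> d"
      by (intro exI conjI) (auto simp: left_diff_distrib)
  qed
  then have "- 1 \<le> gen_fun a q * W y 0" using E_pos[of y] by (simp add: W_0 E_0)
  then show ?thesis
    using neg_le_divide_eq[OF neg, of "W y 0" "- 1"] by (simp only: mult.commute)
qed

lemma W_nn_integral_le_J:
  assumes "c = 1" "0 \<le> y" "y < c"
  shows "ennreal (W y 0) \<le> J_integral a b e U"
proof -
  have "ennreal (W y 0) = (\<integral>\<^sup>+x. ennreal (indicator {0..y} x * w x) \<partial>lborel)"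
    using W_nn_integral[OF assms(2,3), of 0] by simp
  also have "\<dots> \<le> J_integral a b e U"
    unfolding J_integral_def
  proof (rule nn_integral_mono_AE)
    \<comment> \<open>\<open>W\<close> includes the point 0 and \<open>J\<close> does not, hence
      only almost everywhere.\<close>
    show "AE x in lborel. ennreal (indicator {0..y} x * w x) \<le> ennreal (w x) * indicator {0<..<1} x"
      using AE_lborel_singleton[of 0] by eventually_elim (use assms in \<open>auto simp: indicator_def\<close>)
  qed
  finally show ?thesis .
qed

lemma J_finite_imp_bounded:
  assumes "c = 1" "J_integral a b e U < \<infinity>"
  obtains K where "\<And>y. 0 \<le> y \<Longrightarrow> y < c \<Longrightarrow> W y 0 \<le> K"
proof (rule that[of "enn2real (J_integral a b e U)"])
  fix y assume "0 \<le> y" "y < c"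
  then have "ennreal (W y 0) \<le> ennreal (enn2real (J_integral a b e U))"
    using W_nn_integral_le_J[OF assms(1)] assms(2) by simp
  then show "W y 0 \<le> enn2real (J_integral a b e U)" by (simp add: ennreal_le_iff)
qed

lemma bounded_imp_J_finite:
  assumes "c = 1" and K: "\<And>y. 0 \<le> y \<Longrightarrow> y < c \<Longrightarrow> W y 0 \<le> K"
  shows "J_integral a b e U < \<infinity>"
proof -
  have "integrable lborel (\<lambda>x. indicator {0<..<1} x *\<^sub>R w x)"
    using w_integrable[OF K] assms(1) by (simp add: set_integrable_def)
  then have "(\<integral>\<^sup>+x. ennreal (norm (indicator {0<..<1} x *\<^sub>R w x)) \<partial>lborel) < \<infinity>"
    by (simp add: integrable_iff_bounded)
  moreover have "J_integral a b e U = (\<integral>\<^sup>+x. ennreal (norm (indicator {0<..<1} x *\<^sub>R w x)) \<partial>lborel)"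
    unfolding J_integral_def
    by (rule nn_integral_cong) (use w_pos assms(1) in \<open>auto simp: indicator_def abs_of_pos\<close>)
  ultimately show ?thesis by simp
qed

text \<open>Close to the end point \<open>monomial (U t) i\<close> exceeds any \<open>r < 1\<close>,
  so \<open>W y i\<close> grows at least like \<open>r * W y 0\<close>. If the extinction
  probability \<open>f\<close> were below \<open>r\<close>, then
  \<open>W y i \<le> f * W y 0\<close> would keep \<open>W y 0\<close> bounded and \<open>J\<close>
  finite.\<close>

lemma extinction_prob_one:
  assumes "q = 1" "J_integral a b e U = \<infinity>"
  shows "extinction_prob a b i = 1"
proof (rule antisym[OF extinction_prob_le_one])
  have c1: "c = 1" by (subst c_def, subst assms(1)) simp
  define f where "f = extinction_prob a b i"
  show "1 \<le> extinction_prob a b i"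
  proof (rule ccontr)
    assume "\<not> ?thesis"
    then have f: "f < 1" by (simp add: f_def)
    define r where "r = (f + 1) / 2"
    have r: "f < r" "r < 1" using f by (auto simp: r_def)
    have "continuous_on {0..c} (\<lambda>t. monomial (U t) i)"
      by (intro continuous_on_compose2[OF continuous_on_monomial continuous_on_U]) auto
    then have "((\<lambda>t. monomial (U t) i) \<longlongrightarrow> monomial (U c) i) (at_left c)"
      using c_pos unfolding continuous_on_def
      by (metis at_within_Icc_at_left atLeastAtMost_iff less_imp_le order_refl)
    moreover have "monomial (U c) i = 1" unfolding U_c by (simp add: assms(1))
    ultimately have "\<forall>\<^sub>F t in at_left c. r < monomial (U t) i"
      using r by (intro order_tendstoD(1)) auto
    then obtain y1 where y1: "y1 < c" "\<And>t. y1 < t \<Longrightarrow> t < c \<Longrightarrow> r < monomial (U t) i"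
      by (auto simp: eventually_at_left_field)
    define y0 where "y0 = max y1 0"
    have y0: "0 \<le> y0" "y0 < c" "y1 \<le> y0" using y1 c_pos by (auto simp: y0_def)
    have mono: "W y0 i - r * W y0 0 \<le> W y i - r * W y 0" if y: "y0 \<le> y" "y < c" for y
    proof (rule DERIV_nonneg_imp_increasing_open[OF y(1), of "\<lambda>y. W y i - r * W y 0"])
      show "continuous_on {y0..y} (\<lambda>y. W y i - r * W y 0)"
        using y y0 by (intro continuous_intros continuous_on_subset[OF continuous_on_W[of y]]) auto
      fix t assume t: "y0 < t" "t < y"
      have "((\<lambda>y. W y i - r * W y 0) has_real_derivative monomial (U t) i * w t - r * (monomial (U t) 0 * w t)) (at t)"
        using t y y0 by (intro DERIV_diff DERIV_cmult W_deriv) auto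
      moreover have "0 \<le> (monomial (U t) i - r) * w t"
        using y1(2)[of t] w_pos[of t] t y y0 by simp
      ultimately show "\<exists>d. ((\<lambda>y. W y i - r * W y 0) has_real_derivative d) (at t) \<and> 0 \<le> d"
        by (intro exI conjI) (auto simp: left_diff_distrib)
    qed
    \<comment> \<open>Solves \<open>r * W y 0 + W y0 i - r * W y0 0 \<le> f * W y 0\<close> for
      \<open>W y 0\<close>.\<close>
    define C where "C = (r * W y0 0 - W y0 i) / (r - f)"
    have C: "W y 0 \<le> C" if y: "y0 \<le> y" "y < c" for y
    proof -
      have "(r - f) * W y 0 \<le> r * W y0 0 - W y0 i"
        using mono[OF y] W_le_extinction_prob[of y i] y y0 by (simp add: f_def algebra_simps)
      then show ?thesis using r by (simp add: C_def pos_le_divide_eq mult.commute)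
    qed
    have "W y 0 \<le> C" if y: "0 \<le> y" "y < c" for y
    proof (cases "y0 \<le> y")
      case False
      have "W y 0 \<le> W y0 0"
        using has_integral_subset_le[OF _ W_has_integral[OF y, of 0] W_has_integral[OF y0(1,2), of 0]]
          False y y0 integrand_nonneg[of _ 0] by auto
      also have "\<dots> \<le> C" using C[of y0] y0 by simp
      finally show ?thesis .
    qed (use C y in auto)
    then show False using bounded_imp_J_finite[OF c1] assms(2) by force
  qed
qed

end


theorem theorem3p2:
  fixes a :: "nat^'n::finite \<Rightarrow> real"
    and b :: "'n \<Rightarrow> nat^'n \<Rightarrow> real"
    and e :: 'n
    and q :: "real^'n"
    and U :: "real \<Rightarrow> real^'n"
  assumes coeffs: "branching_immigration_coeffs a b"
    and A1: "nonsingular_branching b"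
    and A2: "finite_means b"
    and A3: "positively_regular (G_matrix b 1)"
    and death: "gen_fun (b e) 0 > 0"
    and q: "smallest_root b q"
    and U: "branching_curve b e q U"
  shows "(\<forall>i. i \<noteq> 0 \<longrightarrow>
            (extinction_prob a b i = 1 \<longleftrightarrow> rho b 1 \<le> 0 \<and> J_integral a b e U = \<infinity>)) \<and>
         (rho b 1 \<le> 0 \<and> J_integral a b e U = \<infinity> \<longrightarrow>
            (\<forall>i. i \<noteq> 0 \<longrightarrow> extinction_prob a b i = 1)) \<and>
         (rho b 1 \<le> 0 \<and> J_integral a b e U < \<infinity> \<longrightarrow>
            (\<forall>i. i \<noteq> 0 \<longrightarrow>
               extinction_prob a b i = extinction_ratio a b e U 1 i \<and>
               extinction_prob a b i < 1)) \<and>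
         (0 < rho b 1 \<longrightarrow>
            (\<forall>k. q $ k < 1) \<and>
            set_integrable lborel {0<..<q $ e} (weight a b e U) \<and>
            (\<forall>i. i \<noteq> 0 \<longrightarrow>
               extinction_prob a b i = extinction_ratio a b e U (q $ e) i \<and>
               ((\<forall>k. 0 < q $ k) \<longrightarrow> extinction_prob a b i < monomial q i) \<and>
               monomial q i < 1))"
proof -
  interpret branching a b by unfold_locales (rule coeffs)
  interpret branching_along_curve a b e q U
    by unfold_locales (rule A2 A3 death q U)+
  have sub: "extinction_prob a b i = extinction_ratio a b e U 1 i" "extinction_prob a b i < 1"
    if rho: "rho b 1 \<le> 0" and J: "J_integral a b e U < \<infinity>" and i: "i \<noteq> 0" for i
  proof -
    have c1: "c = 1" by (subst c_def, subst subcritical_root[OF rho]) simp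
    obtain K where K: "\<And>y. 0 \<le> y \<Longrightarrow> y < c \<Longrightarrow> W y 0 \<le> K"
      using J_finite_imp_bounded[OF c1 J] by blast
    show "extinction_prob a b i = extinction_ratio a b e U 1 i"
      using extinction_prob_eq_ratio[OF K, of i] by (simp only: c1)
    show "extinction_prob a b i < 1"
      using monomial_le_one[OF U_cube] by (intro extinction_prob_less[OF K i]) auto
  qed
  have crit: "extinction_prob a b i = 1" if "rho b 1 \<le> 0" "J_integral a b e U = \<infinity>" for i
    using extinction_prob_one[OF subcritical_root] that by blast
  have super: "(\<forall>k. q $ k < 1) \<and> set_integrable lborel {0<..<q $ e} w \<and>
      (\<forall>i. i \<noteq> 0 \<longrightarrow> extinction_prob a b i = extinction_ratio a b e U (q $ e) i \<and>
        ((\<forall>k. 0 < q $ k) \<longrightarrow> extinction_prob a b i < monomial q i) \<and> monomial q i < 1)"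
    and super_less: "\<And>i. i \<noteq> 0 \<Longrightarrow> extinction_prob a b i < 1"
    if rho: "0 < rho b 1"
  proof -
    have q1: "q $ k < 1" for k by (rule supercritical_root[OF rho])
    note K = W_bounded_if_subunit_root[OF q1]
    have mon: "monomial q i < 1" if i: "i \<noteq> 0" for i
    proof -
      obtain l where "0 < i $ l" using index_pos[OF i] by blast
      then show ?thesis using monomial_le_component[OF q_cube] q1[of l] le_less_trans by blast
    qed
    \<comment> \<open>The comparison constant \<open>r = monomial q i\<close> must be positive,
      which is where the positivity of all components of \<open>q\<close> enters.\<close>
    have "extinction_prob a b i < monomial q i" if "i \<noteq> 0" "\<forall>k. 0 < q $ k" for i
      using that monomial_U_le_q
      by (intro extinction_prob_less[OF K]) (auto simp: monomial_def intro!: prod_pos)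
    then show "(\<forall>k. q $ k < 1) \<and> set_integrable lborel {0<..<q $ e} w \<and>
      (\<forall>i. i \<noteq> 0 \<longrightarrow> extinction_prob a b i = extinction_ratio a b e U (q $ e) i \<and>
        ((\<forall>k. 0 < q $ k) \<longrightarrow> extinction_prob a b i < monomial q i) \<and> monomial q i < 1)"
      using q1 mon w_integrable[OF K] extinction_prob_eq_ratio[OF K] by (simp add: c_def)
    show "extinction_prob a b i < 1" if "i \<noteq> 0" for i
      using monomial_le_one[OF U_cube] by (intro extinction_prob_less[OF K that]) auto
  qed
  have "extinction_prob a b i = 1 \<longleftrightarrow> rho b 1 \<le> 0 \<and> J_integral a b e U = \<infinity>" if "i \<noteq> 0" for i
  proof
    assume one: "extinction_prob a b i = 1"
    then have rho: "rho b 1 \<le> 0" using super_less[OF _ that] by (cases "0 < rho b 1") auto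
    moreover have "\<not> J_integral a b e U < \<infinity>" using sub(2)[OF rho _ that] one by auto
    ultimately show "rho b 1 \<le> 0 \<and> J_integral a b e U = \<infinity>" by (simp add: not_less top_unique)
  qed (use crit in blast)
  then show ?thesis using sub crit super by blast
qed

end
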